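(* Let $c\in\{1,2\}$ and let $d\ge1$ be an integer. Let $A_1,\dots,A_{n^c}$ be i.i.d. random $n^d\times n^d$ matrices, either with independent uniform $\pm1$ entries or with independent $\mathcal{N}(0,1)$ entries. Then with probability $1-O(n^{-100})$, $$\Big\|\sum_{i\in[n^c]}\big(A_i\otimes A_i-\mathbb{E}A_i\otimes A_i\big)\Big\|\le O\big(\sqrt d\,n^{(2d+c)/2}(\log n)^{1/2}\big)$$ and $$\Big\|\sum_{i\in[n^c]}\big(A_i\otimes A_i^T-\mathbb{E}A_i\otimes A_i^T\big)\Big\|\le O\big(\sqrt d\,n^{(2d+c)/2}(\log n)^{1/2}\big).$$
   Context: Norms are operator norms; the constants in $O(\cdot)$ are absolute. *)

theory Defs
  imports "HOL-Probability.Probability"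
begin

text \<open>Square matrices of size m are represented as functions nat => nat => real,
  only the entries with indices below m being relevant.\<close>

definition opnorm :: "nat \<Rightarrow> (nat \<Rightarrow> nat \<Rightarrow> real) \<Rightarrow> real" where
  "opnorm m M = (SUP x \<in> {x :: nat \<Rightarrow> real. (\<Sum>s<m. (x s)\<^sup>2) \<le> 1}.
                    sqrt (\<Sum>r<m. (\<Sum>s<m. M r s * x s)\<^sup>2))"

definition kron :: "nat \<Rightarrow> (nat \<Rightarrow> nat \<Rightarrow> real) \<Rightarrow> (nat \<Rightarrow> nat \<Rightarrow> real) \<Rightarrow> nat \<Rightarrow> nat \<Rightarrow> real" where
  "kron N A B r s = A (r div N) (s div N) * B (r mod N) (s mod N)"

definition transp_mat :: "(nat \<Rightarrow> nat \<Rightarrow> real) \<Rightarrow> nat \<Rightarrow> nat \<Rightarrow> real" where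
  "transp_mat A j k = A k j"

definition rademacher_measure :: "real measure" where
  "rademacher_measure = distr (measure_pmf (pmf_of_set {-1, 1})) borel (\<lambda>x. x)"

definition gaussian_measure :: "real measure" where
  "gaussian_measure = density lborel std_normal_density"

text \<open>Sample space: all entries omega (i,j,k) = (A_i)_{jk}, i < K, j,k < N,
  independent with law D.\<close>
definition entry_space :: "nat \<Rightarrow> nat \<Rightarrow> real measure \<Rightarrow> (nat \<times> nat \<times> nat \<Rightarrow> real) measure" where
  "entry_space K N D = PiM ({..<K} \<times> {..<N} \<times> {..<N}) (\<lambda>_. D)"

definition rmat :: "(nat \<times> nat \<times> nat \<Rightarrow> real) \<Rightarrow> nat \<Rightarrow> nat \<Rightarrow> nat \<Rightarrow> real" where
  "rmat \<omega> i j k = \<omega> (i, j, k)"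

definition centered_sum ::
  "nat \<Rightarrow> nat \<Rightarrow> real measure \<Rightarrow> ((nat \<Rightarrow> nat \<Rightarrow> real) \<Rightarrow> nat \<Rightarrow> nat \<Rightarrow> real)
     \<Rightarrow> (nat \<times> nat \<times> nat \<Rightarrow> real) \<Rightarrow> nat \<Rightarrow> nat \<Rightarrow> real" where
  "centered_sum K N D f \<omega> r s =
     (\<Sum>i<K. f (rmat \<omega> i) r s - (\<integral>\<omega>'. f (rmat \<omega>' i) r s \<partial>entry_space K N D))"

end

(* Represent each entry as a normalised sum of m independent signs: m = 1 is the Rademacher case, and
   m -> infinity gives the Gaussian case by the central limit theorem, Skorohod's theorem and Fatou's
   lemma, the event "norm > B" being open. For signs, averaging over a random mask J writes the
   centered sum as 4 times an average of sums of A_i^J (x) B_i, where A_i^J only involves the signs in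
   J and B_i only the others. Given the B_i, this is a matrix sign series, whose 2p-th trace moment is
   at most 2 N^2 (4 p v)^p (noncommutative Khintchine) with v = N max |[B_1 ... B_K]|^2 over the two
   ways of stacking the B_i. A net argument bounds these norms by a constant times sqrt (N K), and
   Markov's inequality with p ~ ln N finishes the proof. *)
theory Submission
  imports Defs "HOL-Real_Asymp.Real_Asymp"
begin

section \<open>Trace moments of sign series\<close>

text \<open>In A_i \<otimes> A_i an entry meets itself, and for Gaussian entries the square
  fluctuates, so decoupling on the level of entries would leave a diagonal part to be treated
  separately. Resolving an entry into m signs removes this obstacle: its square minus the mean is
  1/m times a sum of products of distinct signs, so the whole centered sum is a chaos without
  diagonal, and the constants do not depend on m, which is what survives the limit. The scale of the
  bound: given the B_i, a sign at position (j,k) has the coefficient E_jk \<otimes> B_i. The free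
  index contributes N to the variance and the stacked norm contributes N K, so the norm is of order
  N sqrt (K ln N). With N = n^d and K = n^c this is n^((2d+c)/2) sqrt (d ln n); the factor sqrt d
  stems from ln N alone. Applying the trace moment bound to the stacked matrices as well would cost
  a second logarithm. Their moments are instead taken at an order q ~ N K, where the size of a net
  is harmless, and then lowered to p ~ ln N.\<close>

definition rsign :: "'a set \<Rightarrow> 'a \<Rightarrow> real" where
  "rsign T a = (if a \<in> T then 1 else -1)"

definition flip :: "'a \<Rightarrow> 'a set \<Rightarrow> 'a set" where
  "flip k T = sym_diff T {k}"

lemma rsign_flip: "rsign (flip k T) a = (if a = k then - rsign T a else rsign T a)"
  unfolding rsign_def flip_def by (cases "a = k") simp_all

lemma rsign_square [simp]: "rsign T a * rsign T a = 1"
  by (simp add: rsign_def)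

lemma sum_Pow_flip:
  assumes "k \<in> S"
  shows "(\<Sum>T\<in>Pow S. f (flip k T)) = (\<Sum>T\<in>Pow S. f T)"
  using assms
  by (intro sum.reindex_bij_witness[of _ "flip k" "flip k"]) (auto simp: flip_def)

text \<open>A sign vector is encoded by the set \<open>T\<close> of its +1 positions, so a sum over
  \<open>Pow S\<close> is \<open>2 ^ card S\<close> times an expectation. The involution
  \<open>flip k\<close> negates the weight, hence only the part of \<open>f\<close> that is odd in
  coordinate \<open>k\<close> survives.\<close>

lemma sum_rsign_by_parts:
  fixes f :: "'a set \<Rightarrow> real"
  assumes "k \<in> S"
  shows "(\<Sum>T\<in>Pow S. rsign T k * f T) = (\<Sum>T\<in>Pow S. rsign T k * (f T - f (flip k T))) / 2"
proof -
  have "(\<Sum>T\<in>Pow S. rsign T k * f T) = (\<Sum>T\<in>Pow S. - (rsign T k * f (flip k T)))"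
    using sum_Pow_flip[OF assms, of "\<lambda>T. rsign T k * f T"] by (simp add: rsign_flip)
  then show ?thesis
    by (simp add: right_diff_distrib sum_subtractf sum_negf)
qed

section \<open>Matrix products and the Frobenius pairing\<close>

definition mmul :: "'i set \<Rightarrow> ('i \<Rightarrow> 'i \<Rightarrow> real) \<Rightarrow> ('i \<Rightarrow> 'i \<Rightarrow> real) \<Rightarrow> 'i \<Rightarrow> 'i \<Rightarrow> real" where
  "mmul I A B = (\<lambda>i j. \<Sum>k\<in>I. A i k * B k j)"

definition frob :: "'i set \<Rightarrow> ('i \<Rightarrow> 'i \<Rightarrow> real) \<Rightarrow> ('i \<Rightarrow> 'i \<Rightarrow> real) \<Rightarrow> real" where
  "frob I A B = (\<Sum>i\<in>I. \<Sum>j\<in>I. A i j * B i j)"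

definition idmat :: "'i \<Rightarrow> 'i \<Rightarrow> real" where
  "idmat i j = of_bool (i = j)"

definition symmat :: "('i \<Rightarrow> 'i \<Rightarrow> real) \<Rightarrow> bool" where
  "symmat A \<longleftrightarrow> (\<forall>i j. A i j = A j i)"

text \<open>The fixed factor comes first so that powers acting from the right can be iterated with
  \<open>^^\<close>, in the same way as \<open>mmul I X ^^ a\<close> acts from the left.\<close>

definition mmulr :: "'i set \<Rightarrow> ('i \<Rightarrow> 'i \<Rightarrow> real) \<Rightarrow> ('i \<Rightarrow> 'i \<Rightarrow> real) \<Rightarrow> 'i \<Rightarrow> 'i \<Rightarrow> real" where
  "mmulr I X A = mmul I A X"

lemma mmulr_pow_Suc [simp]: "(mmulr I X ^^ Suc k) A = mmul I ((mmulr I X ^^ k) A) X"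
  by (simp add: mmulr_def)

lemma mmulr_pow_swap: "(mmulr I X ^^ k) (mmul I A X) = mmul I ((mmulr I X ^^ k) A) X"
  by (induction k) (simp_all del: funpow.simps(2) add: id_apply)

lemma mmul_assoc: "mmul I (mmul I A B) C = mmul I A (mmul I B C)"
  unfolding mmul_def
  by (intro ext) (simp add: sum_distrib_left sum_distrib_right mult.assoc, rule sum.swap)

lemma frob_commute: "frob I A B = frob I B A"
  by (simp add: frob_def mult.commute)

lemma frob_nonneg: "0 \<le> frob I A A"
  by (simp add: frob_def sum_nonneg)

lemma frob_transpose: "frob I (\<lambda>i j. A j i) (\<lambda>i j. B j i) = frob I A B"
  unfolding frob_def by (rule sum.swap)

lemma frob_cong:
  assumes "\<And>i j. i \<in> I \<Longrightarrow> j \<in> I \<Longrightarrow> A i j = A' i j"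
    and "\<And>i j. i \<in> I \<Longrightarrow> j \<in> I \<Longrightarrow> B i j = B' i j"
  shows "frob I A B = frob I A' B'"
  unfolding frob_def using assms by (intro sum.cong) auto

lemma frob_mmul_left:
  assumes "symmat X"
  shows "frob I (mmul I X A) B = frob I A (mmul I X B)"
proof -
  have "frob I (mmul I X A) B = (\<Sum>i\<in>I. \<Sum>j\<in>I. \<Sum>k\<in>I. X i k * A k j * B i j)"
    by (simp add: frob_def mmul_def sum_distrib_right)
  also have "\<dots> = (\<Sum>i\<in>I. \<Sum>k\<in>I. \<Sum>j\<in>I. X i k * A k j * B i j)"
    by (intro sum.cong refl sum.swap)
  also have "\<dots> = (\<Sum>k\<in>I. \<Sum>i\<in>I. \<Sum>j\<in>I. X i k * A k j * B i j)"
    by (rule sum.swap)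
  also have "\<dots> = (\<Sum>k\<in>I. \<Sum>j\<in>I. \<Sum>i\<in>I. X i k * A k j * B i j)"
    by (intro sum.cong refl sum.swap)
  also have "\<dots> = (\<Sum>k\<in>I. \<Sum>j\<in>I. \<Sum>i\<in>I. A k j * (X k i * B i j))"
    using assms by (intro sum.cong refl) (auto simp: symmat_def mult_ac)
  also have "\<dots> = frob I A (mmul I X B)"
    by (simp add: frob_def mmul_def sum_distrib_left)
  finally show ?thesis .
qed

lemma mmul_transpose:
  "(\<lambda>i j. mmul I A B j i) = mmul I (\<lambda>i j. B j i) (\<lambda>i j. A j i)"
  by (simp add: mmul_def mult.commute)

lemma symmat_transpose: "symmat X \<Longrightarrow> (\<lambda>i j. X j i) = X"
  by (auto simp: symmat_def)

lemma frob_mmul_right: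
  assumes "symmat X"
  shows "frob I (mmul I A X) B = frob I A (mmul I B X)"
proof -
  have "frob I (mmul I A X) B = frob I (\<lambda>i j. mmul I A X j i) (\<lambda>i j. B j i)"
    by (rule frob_transpose[symmetric])
  also have "\<dots> = frob I (\<lambda>i j. A j i) (mmul I X (\<lambda>i j. B j i))"
    by (simp only: mmul_transpose symmat_transpose[OF assms] frob_mmul_left[OF assms])
  also have "mmul I X (\<lambda>i j. B j i) = (\<lambda>i j. mmul I B X j i)"
    by (simp only: mmul_transpose symmat_transpose[OF assms])
  also have "frob I (\<lambda>i j. A j i) \<dots> = frob I A (mmul I B X)"
    by (rule frob_transpose)
  finally show ?thesis .
qed

lemma frob_mmul_left_pow:
  assumes "symmat X"
  shows "frob I ((mmul I X ^^ k) A) B = frob I A ((mmul I X ^^ k) B)"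
proof (induction k arbitrary: B)
  case (Suc k)
  have "frob I ((mmul I X ^^ Suc k) A) B = frob I ((mmul I X ^^ k) A) (mmul I X B)"
    by (simp add: frob_mmul_left[OF assms])
  also have "\<dots> = frob I A ((mmul I X ^^ Suc k) B)"
    by (simp add: Suc.IH funpow_swap1)
  finally show ?case .
qed simp

lemma frob_mmul_right_pow:
  assumes "symmat X"
  shows "frob I ((mmulr I X ^^ k) A) B = frob I A ((mmulr I X ^^ k) B)"
proof (induction k arbitrary: B)
  case (Suc k)
  have "frob I ((mmulr I X ^^ Suc k) A) B = frob I ((mmulr I X ^^ k) A) (mmul I B X)"
    by (simp del: funpow.simps(2) add: frob_mmul_right[OF assms])
  also have "\<dots> = frob I A ((mmulr I X ^^ Suc k) B)"
    by (simp del: funpow.simps(2) add: Suc.IH mmulr_pow_swap)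
  finally show ?case .
qed simp

lemma mmul_mmulr_pow_commute1: "mmul I X ((mmulr I Y ^^ b) A) = (mmulr I Y ^^ b) (mmul I X A)"
  by (induction b) (simp_all del: funpow.simps(2) add: mmul_assoc[symmetric])

lemma mmul_mmulr_pow_commute:
  "(mmul I X ^^ a) ((mmulr I Y ^^ b) A) = (mmulr I Y ^^ b) ((mmul I X ^^ a) A)"
  by (induction a) (simp_all add: mmul_mmulr_pow_commute1)

section \<open>Cauchy-Schwarz for sandwiched powers\<close>

lemma frob_Cauchy_Schwarz:
  "(frob I A B)\<^sup>2 \<le> frob I A A * frob I B B"
proof -
  have *: "frob I A B = (\<Sum>p\<in>I \<times> I. A (fst p) (snd p) * B (fst p) (snd p))" for A B
    unfolding frob_def sum.cartesian_product case_prod_unfold ..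
  show ?thesis
    using Cauchy_Schwarz_ineq_sum[of "\<lambda>p. A (fst p) (snd p)" "\<lambda>p. B (fst p) (snd p)" "I \<times> I"]
    unfolding * by (simp only: power2_eq_square)
qed

text \<open>This is tr (H^T X^a H Y^b). In the moment step \<open>X\<close> and \<open>Y\<close> are
  a sign series before and after one flip, and such forms are the terms of the telescoped difference
  of powers.\<close>

definition sandwich :: "'i set \<Rightarrow> ('i \<Rightarrow> 'i \<Rightarrow> real) \<Rightarrow> ('i \<Rightarrow> 'i \<Rightarrow> real) \<Rightarrow> ('i \<Rightarrow> 'i \<Rightarrow> real) \<Rightarrow>
    nat \<Rightarrow> nat \<Rightarrow> real" where
  "sandwich I X Y H a b = frob I H ((mmul I X ^^ a) ((mmulr I Y ^^ b) H))"

text \<open>Left and right multiplication by symmetric matrices are self-adjoint for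
  \<open>frob\<close> and commute, so any part of the exponents can move to the first argument. For
  two equal halves the result is a squared Frobenius norm.\<close>

lemma sandwich_split:
  assumes "symmat X" "symmat Y"
  shows "sandwich I X Y H (a + a') (b + b') =
    frob I ((mmul I X ^^ a) ((mmulr I Y ^^ b) H)) ((mmul I X ^^ a') ((mmulr I Y ^^ b') H))"
proof -
  have "sandwich I X Y H (a + a') (b + b') =
      frob I H ((mmul I X ^^ a) ((mmul I X ^^ a') ((mmulr I Y ^^ b) ((mmulr I Y ^^ b') H))))"
    by (simp add: sandwich_def funpow_add)
  also have "\<dots> = frob I ((mmul I X ^^ a) H) ((mmulr I Y ^^ b) ((mmul I X ^^ a') ((mmulr I Y ^^ b') H)))"
    by (simp add: frob_mmul_left_pow[OF assms(1)] mmul_mmulr_pow_commute)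
  also have "\<dots> = frob I ((mmulr I Y ^^ b) ((mmul I X ^^ a) H)) ((mmul I X ^^ a') ((mmulr I Y ^^ b') H))"
    by (simp add: frob_mmul_right_pow[OF assms(2)])
  finally show ?thesis by (simp add: mmul_mmulr_pow_commute)
qed

lemma sandwich_even_nonneg:
  assumes "symmat X" "symmat Y"
  shows "0 \<le> sandwich I X Y H (a + a) (b + b)"
  unfolding sandwich_split[OF assms] by (rule frob_nonneg)

lemma sandwich_Cauchy_Schwarz:
  assumes "symmat X" "symmat Y"
  shows "(sandwich I X Y H (a + a') (b + b'))\<^sup>2 \<le>
    sandwich I X Y H (a + a) (b + b) * sandwich I X Y H (a' + a') (b' + b')"
  unfolding sandwich_split[OF assms] by (rule frob_Cauchy_Schwarz)

text \<open>An interior maximum \<open>m\<close> above both ends contradicts log-convexity at the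
  first place where it is attained: the left neighbour is smaller than \<open>m\<close> and the
  right one at most \<open>m\<close>, giving m^2 < m^2. Working with products instead of ratios
  admits zero values.\<close>

lemma log_convex_le_max:
  fixes F :: "nat \<Rightarrow> real"
  assumes nonneg: "\<And>e. e \<le> r \<Longrightarrow> 0 \<le> F e"
    and conv: "\<And>e. Suc (Suc e) \<le> r \<Longrightarrow> (F (Suc e))\<^sup>2 \<le> F e * F (Suc (Suc e))"
    and "e \<le> r"
  shows "F e \<le> max (F 0) (F r)"
proof (rule ccontr)
  assume *: "\<not> F e \<le> max (F 0) (F r)"
  define m where "m = Max (F ` {..r})"
  have m: "F k \<le> m" if "k \<le> r" for k
    unfolding m_def using that by (intro Max_ge) auto
  have "m \<in> F ` {..r}"
    unfolding m_def by (intro Max_in) auto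
  then have ex: "\<exists>k. k \<le> r \<and> F k = m" by auto
  \<comment> \<open>The least maximiser is chosen so that its left neighbour is strictly smaller
    than \<open>m\<close>.\<close>
  define k where "k = (LEAST k. k \<le> r \<and> F k = m)"
  have k: "k \<le> r" "F k = m"
    using LeastI_ex[OF ex] by (auto simp: k_def)
  have least: "F l \<noteq> m" if "l < k" for l
    using not_less_Least[of l "\<lambda>k. k \<le> r \<and> F k = m"] that k(1)
    unfolding k_def[symmetric] by simp
  have big: "m > F 0" "m > F r"
    using * m[OF \<open>e \<le> r\<close>] by simp_all
  have "k \<noteq> 0" using big(1) k(2) by (metis less_irrefl)
  have "k \<noteq> r" using big(2) k(2) by (metis less_irrefl)
  from \<open>k \<noteq> 0\<close> obtain l where l: "k = Suc l" using not0_implies_Suc by blast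
  have lr: "Suc (Suc l) \<le> r" using l k(1) \<open>k \<noteq> r\<close> by simp
  have pos: "m > 0" using big nonneg[of 0] by simp
  have "l \<le> r" "F l \<noteq> m" using lr least[of l] l by simp_all
  then have "F l < m" using m[of l] by simp
  have "m\<^sup>2 \<le> F l * F (Suc (Suc l))"
    using conv[OF lr] k(2) l by simp
  also have "\<dots> \<le> F l * m"
    using m[OF lr] nonneg[of l] lr by (intro mult_left_mono) auto
  also have "\<dots> < m * m"
    using \<open>F l < m\<close> pos by simp
  finally show False by (simp add: power2_eq_square)
qed

text \<open>Repeated Cauchy--Schwarz makes the sandwiches with even exponents log-convex, so the extreme
  ones dominate; this replaces the usual diagonalisation of \<open>X\<close> and \<open>Y\<close>.\<close>

lemma sandwich_bound:
  assumes "symmat X" "symmat Y" and ab: "a + b = 2 * r"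
  shows "sandwich I X Y H a b \<le> sandwich I X Y H (2 * r) 0 + sandwich I X Y H 0 (2 * r)"
proof -
  define F where "F e = sandwich I X Y H (e + e) ((r - e) + (r - e))" for e
  have nn: "0 \<le> F e" for e
    unfolding F_def by (rule sandwich_even_nonneg[OF assms(1,2)])
  have conv: "(F (Suc e))\<^sup>2 \<le> F e * F (Suc (Suc e))" if "Suc (Suc e) \<le> r" for e
  proof -
    have "F (Suc e) = sandwich I X Y H (e + Suc (Suc e)) ((r - e) + (r - Suc (Suc e)))"
      unfolding F_def using that by (intro arg_cong2[of _ _ _ _ "sandwich I X Y H"]) auto
    then show ?thesis
      unfolding F_def[of e] F_def[of "Suc (Suc e)"] by (simp only: sandwich_Cauchy_Schwarz[OF assms(1,2)])
  qed
  have mx: "F e \<le> max (F 0) (F r)" if "e \<le> r" for e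
    using log_convex_le_max[of r F e] nn conv that by blast
  have F0: "F 0 = sandwich I X Y H 0 (2 * r)" and Fr: "F r = sandwich I X Y H (2 * r) 0"
    by (simp_all add: F_def mult_2)
  \<comment> \<open>For odd exponents the two halves \<open>e\<close> and \<open>a - e\<close>
    differ by one. Cauchy-Schwarz on this splitting leaves only the even forms \<open>F e\<close>
    and \<open>F (a - e)\<close>.\<close>
  define e where "e = a div 2"
  have le: "e \<le> r" "a - e \<le> r" using ab by (auto simp: e_def)
  have "a = e + (a - e)" "b = (r - e) + (r - (a - e))"
    using ab by (auto simp: e_def)
  then have "(sandwich I X Y H a b)\<^sup>2 \<le> F e * F (a - e)"
    unfolding F_def using sandwich_Cauchy_Schwarz[OF assms(1,2)] by metis
  also have "\<dots> \<le> max (F 0) (F r) * max (F 0) (F r)"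
    by (intro mult_mono mx le nn order_trans[OF nn[of 0] max.cobounded1])
  finally have "(sandwich I X Y H a b)\<^sup>2 \<le> (max (F 0) (F r))\<^sup>2"
    by (simp only: power2_eq_square)
  then have "sandwich I X Y H a b \<le> max (F 0) (F r)"
    by (rule power2_le_imp_le) (rule order_trans[OF nn[of 0] max.cobounded1])
  also have "\<dots> \<le> F 0 + F r" using nn[of 0] nn[of r] by (simp add: max_def)
  finally show ?thesis by (simp add: F0 Fr)
qed

lemma mmul_idmat: "finite I \<Longrightarrow> j \<in> I \<Longrightarrow> mmul I A idmat i j = A i j"
  by (simp add: mmul_def idmat_def)

lemma frob_mmul_idmat: "finite I \<Longrightarrow> frob I A (mmul I B idmat) = frob I A B"
  by (intro frob_cong) (auto simp: mmul_idmat)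

text \<open>Powers of \<open>X\<close> behind \<open>H\<close> are turned into right
  multiplications. The trailing \<open>idmat\<close> stays because multiplying by it truncates the
  columns outside \<open>I\<close>; with it the identity holds for all indices.\<close>

lemma mmul_pow_idmat: "mmul I H ((mmul I X ^^ b) idmat) = mmul I ((mmulr I X ^^ b) H) idmat"
proof (induction b arbitrary: H)
  case (Suc b)
  have "mmul I H ((mmul I X ^^ Suc b) idmat) = mmul I (mmul I H X) ((mmul I X ^^ b) idmat)"
    by (simp add: mmul_assoc)
  then show ?case by (simp del: funpow.simps(2) add: Suc.IH mmulr_pow_swap)
qed simp

lemma mmul_pow_mmul: "(mmul I X ^^ a) (mmul I A B) = mmul I ((mmul I X ^^ a) A) B"
  by (induction a) (simp_all add: mmul_assoc)

lemma mmul_linear: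
  "mmul I A (\<lambda>i j. B i j + C i j) = (\<lambda>i j. mmul I A B i j + mmul I A C i j)"
  "mmul I A (\<lambda>i j. c * B i j) = (\<lambda>i j. c * mmul I A B i j)"
  by (simp_all add: mmul_def sum.distrib sum_distrib_left algebra_simps)

lemma frob_linear:
  "frob I A (\<lambda>i j. B i j + C i j) = frob I A B + frob I A C"
  "frob I A (\<lambda>i j. c * B i j) = c * frob I A B"
  by (simp_all add: frob_def sum.distrib sum_distrib_left algebra_simps)

text \<open>The identity X^n - X'^n = \<Sum> X^q (X - X') X'^(n-1-q), paired with
  \<open>G\<close>.\<close>

lemma pow_diff_telescope:
  assumes "finite I" and X: "\<And>i j. X i j = X' i j + c * H i j"
  shows "frob I G ((mmul I X ^^ n) idmat) =
    frob I G ((mmul I X' ^^ n) idmat) +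
      c * (\<Sum>q<n. frob I G ((mmul I X ^^ q) ((mmulr I X' ^^ (n - 1 - q)) H)))"
proof -
  define s where "s q = frob I G ((mmul I X ^^ q) ((mmulr I X' ^^ (n - 1 - q)) H))" for q
  \<comment> \<open>\<open>k\<close> counts the rightmost factors already changed from
    \<open>X\<close> to \<open>X'\<close>. Changing one more contributes the term with
    \<open>q = n - Suc k\<close>.\<close>
  have *: "frob I G ((mmul I X ^^ n) idmat) = frob I G ((mmul I X ^^ (n - k)) ((mmul I X' ^^ k) idmat)) +
      c * (\<Sum>q\<in>{n-k..<n}. s q)" if "k \<le> n" for k
    using that
  proof (induction k)
    case (Suc k)
    define a where "a = n - Suc k"
    have nk: "n - k = Suc a" "n - 1 - a = k" and set: "{n - k..<n} = {Suc a..<n}"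
      "{n - Suc k..<n} = insert a {Suc a..<n}"
      using Suc.prems by (auto simp: a_def)
    let ?Z = "(mmul I X' ^^ k) idmat"
    have mX: "mmul I X ?Z = (\<lambda>i j. mmul I X' ?Z i j + c * mmul I H ?Z i j)"
      by (simp add: mmul_def X sum.distrib sum_distrib_left algebra_simps)
    have swap: "(mmul I X ^^ a) (mmul I X' ((mmul I X' ^^ k) idmat)) = (mmul I X ^^ a) ((mmul I X' ^^ Suc k) idmat)"
      by simp
    have lin: "(mmul I X ^^ a) (\<lambda>i j. A i j + c * B i j) =
        (\<lambda>i j. (mmul I X ^^ a) A i j + c * (mmul I X ^^ a) B i j)" for A B
      by (induction a) (simp_all add: mmul_linear)
    have "frob I G ((mmul I X ^^ Suc a) ?Z) = frob I G ((mmul I X ^^ a) (mmul I X ?Z))"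
      by (simp add: funpow_swap1)
    also have "\<dots> = frob I G ((mmul I X ^^ a) (mmul I X' ?Z)) + c * frob I G ((mmul I X ^^ a) (mmul I H ?Z))"
      unfolding mX lin frob_linear ..
    also have "frob I G ((mmul I X ^^ a) (mmul I H ?Z)) = frob I G ((mmul I X ^^ a) ((mmulr I X' ^^ k) H))"
      by (simp add: mmul_pow_idmat mmul_pow_mmul frob_mmul_idmat[OF assms(1)])
    finally have "frob I G ((mmul I X ^^ (n - k)) ?Z) = frob I G ((mmul I X ^^ a) ((mmul I X' ^^ Suc k) idmat))
        + c * s a"
      by (simp only: nk s_def swap)
    then show ?case
      using Suc.IH Suc.prems unfolding set unfolding a_def[symmetric]
      by (subst sum.insert) (simp_all add: algebra_simps)
  qed simp
  from *[of n] have "frob I G ((mmul I X ^^ n) idmat) = frob I G ((mmul I X' ^^ n) idmat) + c * (\<Sum>q<n. s q)"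
    by (simp only: diff_self_eq_0 atLeast0LessThan order_refl funpow_0)
  then show ?thesis by (simp only: s_def)
qed

section \<open>Moments of tr X^(2p) for a matrix sign series\<close>

definition trpow :: "'i set \<Rightarrow> nat \<Rightarrow> ('i \<Rightarrow> 'i \<Rightarrow> real) \<Rightarrow> real" where
  "trpow I n X = frob I idmat ((mmul I X ^^ n) idmat)"

lemma trpow_0: "finite I \<Longrightarrow> trpow I 0 X = real (card I)"
  by (simp add: trpow_def frob_def idmat_def of_bool_def if_distrib cong: if_cong)

lemma trpow_Suc:
  assumes "finite I" "symmat X"
  shows "trpow I (Suc n) X = frob I X ((mmul I X ^^ n) idmat)"
proof -
  have "trpow I (Suc n) X = frob I (mmul I X idmat) ((mmul I X ^^ n) idmat)"
    by (simp add: trpow_def frob_mmul_left[OF assms(2)])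
  then show ?thesis by (metis frob_commute frob_mmul_idmat[OF assms(1)])
qed

lemma trpow_even:
  assumes "symmat X"
  shows "trpow I (2 * n) X = frob I ((mmul I X ^^ n) idmat) ((mmul I X ^^ n) idmat)"
  by (simp add: trpow_def frob_mmul_left_pow[OF assms] mult_2 funpow_add)

definition signsum :: "'k set \<Rightarrow> ('k \<Rightarrow> 'i \<Rightarrow> 'j \<Rightarrow> real) \<Rightarrow> 'k set \<Rightarrow> 'i \<Rightarrow> 'j \<Rightarrow> real" where
  "signsum S H T i j = (\<Sum>k\<in>S. rsign T k * H k i j)"

lemma frob_sum_left:
  "frob I (\<lambda>i j. \<Sum>k\<in>S. c k * H k i j) B = (\<Sum>k\<in>S. c k * frob I (H k) B)"
proof -
  have "frob I (\<lambda>i j. \<Sum>k\<in>S. c k * H k i j) B =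
      (\<Sum>p\<in>I \<times> I. \<Sum>k\<in>S. c k * (H k (fst p) (snd p) * B (fst p) (snd p)))"
    by (simp add: frob_def sum.cartesian_product[of _ I I] case_prod_unfold sum_distrib_right mult.assoc)
  also have "\<dots> = (\<Sum>k\<in>S. \<Sum>p\<in>I \<times> I. c k * (H k (fst p) (snd p) * B (fst p) (snd p)))"
    by (rule sum.swap)
  finally show ?thesis
    by (simp add: frob_def sum.cartesian_product[of _ I I] case_prod_unfold sum_distrib_left)
qed

text \<open>Transposition carries powers from the left to the right of a symmetric \<open>H\<close>.
  The two extreme forms in \<open>sandwich_bound\<close> thereby become the same quantity, evaluated
  at the original and at the flipped sign vector.\<close>

lemma sandwich_left_eq_right:
  assumes "symmat X" "symmat H"
  shows "sandwich I X Y H (2 * r) 0 = sandwich I Y X H 0 (2 * r)"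
proof -
  have tr: "(\<lambda>i j. ((mmul I X ^^ n) A) j i) = (mmulr I X ^^ n) (\<lambda>i j. A j i)" for n A
  proof (induction n)
    case (Suc n)
    have "(\<lambda>i j. ((mmul I X ^^ Suc n) A) j i) = mmul I (\<lambda>i j. ((mmul I X ^^ n) A) j i) X"
      by (simp only: funpow.simps o_apply mmul_transpose symmat_transpose[OF assms(1)])
    then show ?case by (simp only: Suc mmulr_pow_Suc)
  qed simp
  have "sandwich I X Y H (2 * r) 0 = frob I (\<lambda>i j. H j i) (\<lambda>i j. ((mmul I X ^^ (2*r)) H) j i)"
    unfolding sandwich_def funpow_0 by (rule frob_transpose[symmetric])
  then show ?thesis by (simp only: tr sandwich_def symmat_transpose[OF assms(2)] funpow_0)
qed

text \<open>Flipping one sign is the discrete counterpart of Gaussian integration by parts: it changes the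
  series by twice a single summand, and the difference of the powers telescopes.\<close>

theorem sign_trace_moment_step:
  assumes fin: "finite I" "finite S" and sym: "\<And>k. k \<in> S \<Longrightarrow> symmat (H k)"
    and var: "\<And>x. (\<Sum>k\<in>S. \<Sum>i\<in>I. (\<Sum>j\<in>I. H k i j * x j)\<^sup>2) \<le> v * (\<Sum>j\<in>I. (x j)\<^sup>2)"
  shows "(\<Sum>T\<in>Pow S. trpow I (2 * Suc r) (signsum S H T)) \<le>
    2 * real (2 * r + 1) * v * (\<Sum>T\<in>Pow S. trpow I (2 * r) (signsum S H T))"
proof -
  let ?X = "signsum S H"
  let ?n = "2 * r + 1"
  have symX: "symmat (?X T)" for T
    using sym by (auto simp: symmat_def signsum_def intro!: sum.cong)
  define F where "F k T = sandwich I (?X T) (?X T) (H k) 0 (2 * r)" for k T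
  \<comment> \<open>\<open>F k T\<close> is the squared Frobenius norm of \<open>H k\<close> times
    X^r, so the variance hypothesis can be applied to each column of X^r.\<close>
  have Fsum: "(\<Sum>k\<in>S. F k T) \<le> v * trpow I (2 * r) (?X T)" for T
  proof -
    let ?P = "(mmul I (?X T) ^^ r) idmat"
    have "F k T = (\<Sum>j\<in>I. \<Sum>i\<in>I. (\<Sum>l\<in>I. H k i l * ?P l j)\<^sup>2)" for k
    proof -
      have "F k T = frob I ((mmulr I (?X T) ^^ r) (H k)) ((mmulr I (?X T) ^^ r) (H k))"
        unfolding F_def using sandwich_split[OF symX symX, of I T T "H k" 0 0 r r] by (simp add: mult_2)
      also have "\<dots> = frob I (mmul I (H k) ?P) (mmul I (H k) ?P)"
        by (intro frob_cong) (simp_all add: mmul_pow_idmat mmul_idmat fin)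
      also have "\<dots> = (\<Sum>i\<in>I. \<Sum>j\<in>I. (\<Sum>l\<in>I. H k i l * ?P l j)\<^sup>2)"
        by (simp add: frob_def mmul_def power2_eq_square)
      finally show ?thesis by (subst sum.swap)
    qed
    then have "(\<Sum>k\<in>S. F k T) = (\<Sum>j\<in>I. \<Sum>k\<in>S. \<Sum>i\<in>I. (\<Sum>l\<in>I. H k i l * ?P l j)\<^sup>2)"
      by (simp only:) (rule sum.swap)
    also have "\<dots> \<le> (\<Sum>j\<in>I. v * (\<Sum>l\<in>I. (?P l j)\<^sup>2))"
      by (intro sum_mono var)
    also have "\<dots> = v * (\<Sum>l\<in>I. \<Sum>j\<in>I. (?P l j)\<^sup>2)"
      unfolding sum_distrib_left[symmetric] by (subst sum.swap) (rule refl)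
    also have "\<dots> = v * frob I ?P ?P"
      by (simp add: frob_def power2_eq_square)
    also have "\<dots> = v * trpow I (2 * r) (?X T)"
      by (simp add: trpow_even[OF symX])
    finally show ?thesis .
  qed
  define f where "f k T = frob I (H k) ((mmul I (?X T) ^^ ?n) idmat)" for k T
  have diff: "rsign T k * (f k T - f k (flip k T)) \<le> 2 * real ?n * (F k T + F k (flip k T))"
    if k: "k \<in> S" for k T
  proof -
    let ?X' = "?X (flip k T)"
    have XX: "?X T i j = ?X' i j + 2 * rsign T k * H k i j" for i j
      using fin k by (simp add: signsum_def sum.remove[of S k] rsign_flip)
    define s where "s = (\<Sum>q<?n. frob I (H k) ((mmul I (?X T) ^^ q) ((mmulr I ?X' ^^ (?n - 1 - q)) (H k))))"
    have "f k T = f k (flip k T) + 2 * rsign T k * s"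
      unfolding f_def s_def by (rule pow_diff_telescope[OF fin(1) XX])
    then have "rsign T k * (f k T - f k (flip k T)) = 2 * (rsign T k * rsign T k) * s"
      by (simp only: add_diff_cancel_left' mult_ac)
    then have "rsign T k * (f k T - f k (flip k T)) = 2 * s" by simp
    also have "\<dots> = 2 * (\<Sum>q<?n. sandwich I (?X T) ?X' (H k) q (?n - 1 - q))"
      by (simp only: sandwich_def s_def)
    also have "\<dots> \<le> 2 * (\<Sum>q<?n. sandwich I (?X T) ?X' (H k) (2 * r) 0 + sandwich I (?X T) ?X' (H k) 0 (2 * r))"
      by (intro mult_left_mono sum_mono sandwich_bound symX) auto
    also have "\<dots> = 2 * real ?n * (F k T + F k (flip k T))"
      using sandwich_left_eq_right[OF symX sym[OF k], of I T ?X' r]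
      by (simp add: F_def sandwich_def)
    finally show ?thesis .
  qed
  \<comment> \<open>One factor of the trace is expanded into its signs. The remaining power still
    depends on sign \<open>k\<close>, which is what the flip measures.\<close>
  have "(\<Sum>T\<in>Pow S. trpow I (2 * Suc r) (?X T)) = (\<Sum>T\<in>Pow S. \<Sum>k\<in>S. rsign T k * f k T)"
  proof (intro sum.cong refl)
    fix T
    have "trpow I (2 * Suc r) (?X T) = frob I (?X T) ((mmul I (?X T) ^^ ?n) idmat)"
      using trpow_Suc[OF fin(1) symX[of T], of ?n] by simp
    also have "\<dots> = frob I (\<lambda>i j. \<Sum>k\<in>S. rsign T k * H k i j) ((mmul I (?X T) ^^ ?n) idmat)"
      by (intro frob_cong) (simp_all add: signsum_def)
    finally show "trpow I (2 * Suc r) (?X T) = (\<Sum>k\<in>S. rsign T k * f k T)"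
      by (simp add: frob_sum_left f_def)
  qed
  also have "\<dots> = (\<Sum>k\<in>S. \<Sum>T\<in>Pow S. rsign T k * f k T)"
    by (rule sum.swap)
  also have "\<dots> = (\<Sum>k\<in>S. (\<Sum>T\<in>Pow S. rsign T k * (f k T - f k (flip k T))) / 2)"
    by (intro sum.cong refl sum_rsign_by_parts)
  also have "\<dots> \<le> (\<Sum>k\<in>S. (\<Sum>T\<in>Pow S. 2 * real ?n * (F k T + F k (flip k T))) / 2)"
    by (intro sum_mono divide_right_mono diff) auto
  \<comment> \<open>After summation over all \<open>T\<close> the flipped terms equal the unflipped
    ones, which cancels the division by 2.\<close>
  also have "\<dots> = (\<Sum>k\<in>S. 2 * real ?n * (\<Sum>T\<in>Pow S. F k T))"
  proof (intro sum.cong refl)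
    fix k assume "k \<in> S"
    then show "(\<Sum>T\<in>Pow S. 2 * real ?n * (F k T + F k (flip k T))) / 2 = 2 * real ?n * (\<Sum>T\<in>Pow S. F k T)"
      using sum_Pow_flip[of k S "F k"] by (simp add: sum_distrib_left[symmetric] sum.distrib)
  qed
  also have "\<dots> = 2 * real ?n * (\<Sum>T\<in>Pow S. \<Sum>k\<in>S. F k T)"
    unfolding sum_distrib_left[symmetric] by (subst sum.swap) (rule refl)
  also have "\<dots> \<le> 2 * real ?n * (\<Sum>T\<in>Pow S. v * trpow I (2 * r) (?X T))"
    by (intro mult_left_mono sum_mono Fsum) auto
  finally show ?thesis by (simp add: sum_distrib_left mult_ac)
qed

text \<open>The one-step inequality is iterated from tr X^0 = \<open>card I\<close>; for r < p its
  factor 2 (2r + 1) v is at most 4 p v. The hypothesis \<open>var\<close> says that \<Sum> H_k^T H_k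
  is at most \<open>v\<close> times the identity.\<close>

theorem sign_trace_moment:
  assumes fin: "finite I" "finite S" and sym: "\<And>k. k \<in> S \<Longrightarrow> symmat (H k)"
    and v: "0 \<le> v"
    and var: "\<And>x. (\<Sum>k\<in>S. \<Sum>i\<in>I. (\<Sum>j\<in>I. H k i j * x j)\<^sup>2) \<le> v * (\<Sum>j\<in>I. (x j)\<^sup>2)"
  shows "(\<Sum>T\<in>Pow S. trpow I (2 * p) (signsum S H T)) \<le> 2 ^ card S * real (card I) * (4 * real p * v) ^ p"
proof -
  have "(\<Sum>T\<in>Pow S. trpow I (2 * r) (signsum S H T)) \<le> 2 ^ card S * real (card I) * (4 * real p * v) ^ r"
    if "r \<le> p" for r
    using that
  proof (induction r)
    case 0
    then show ?case by (simp add: trpow_0 fin card_Pow)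
  next
    case (Suc r)
    have "(\<Sum>T\<in>Pow S. trpow I (2 * Suc r) (signsum S H T)) \<le>
        2 * real (2 * r + 1) * v * (\<Sum>T\<in>Pow S. trpow I (2 * r) (signsum S H T))"
      by (rule sign_trace_moment_step[OF fin sym var])
    also have "\<dots> \<le> (4 * real p * v) * (2 ^ card S * real (card I) * (4 * real p * v) ^ r)"
    proof (rule mult_mono)
      show "2 * real (2 * r + 1) * v \<le> 4 * real p * v"
        using Suc.prems v by (intro mult_right_mono) auto
      show "0 \<le> (\<Sum>T\<in>Pow S. trpow I (2 * r) (signsum S H T))"
      proof (intro sum_nonneg)
        fix T
        have "symmat (signsum S H T)"
          using sym by (auto simp: symmat_def signsum_def intro!: sum.cong)
        then show "0 \<le> trpow I (2 * r) (signsum S H T)"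
          by (simp add: trpow_even frob_nonneg)
      qed
    qed (use Suc v in auto)
    finally show ?case by (simp add: mult_ac)
  qed
  then show ?thesis by simp
qed

section \<open>Operator norms of sign series\<close>

text \<open>Rows and columns have arbitrary index sets, so that stacked rectangular matrices and
  Kronecker products indexed by pairs can be used without coding the indices as numbers.\<close>

definition opn :: "'a set \<Rightarrow> 'b set \<Rightarrow> ('a \<Rightarrow> 'b \<Rightarrow> real) \<Rightarrow> real" where
  "opn I J M = (SUP x \<in> {x. (\<Sum>s\<in>J. (x s)\<^sup>2) \<le> 1}. L2_set (\<lambda>r. \<Sum>s\<in>J. M r s * x s) I)"

lemma opnorm_eq_opn: "opnorm m M = opn {..<m} {..<m} M"
  by (simp add: opnorm_def opn_def L2_set_def)

lemma L2_set_mult_vec_le: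
  "L2_set (\<lambda>r. \<Sum>s\<in>J. M r s * x s) I \<le> sqrt (\<Sum>r\<in>I. \<Sum>s\<in>J. (M r s)\<^sup>2) * L2_set x J"
proof -
  have "(\<Sum>r\<in>I. (\<Sum>s\<in>J. M r s * x s)\<^sup>2) \<le> (\<Sum>r\<in>I. (\<Sum>s\<in>J. (M r s)\<^sup>2) * (\<Sum>s\<in>J. (x s)\<^sup>2))"
    by (intro sum_mono Cauchy_Schwarz_ineq_sum)
  then show ?thesis
    by (simp add: L2_set_def real_sqrt_mult[symmetric] sum_distrib_right)
qed

lemma L2_set_le_1_iff: "L2_set x J \<le> 1 \<longleftrightarrow> (\<Sum>s\<in>J. (x s)\<^sup>2) \<le> 1"
  by (simp add: L2_set_def)

text \<open>A real-valued \<open>SUP\<close> carries information only for bounded sets; the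
  Hilbert-Schmidt norm supplies the bound.\<close>

lemma opn_bdd_above:
  fixes M :: "'a \<Rightarrow> 'b \<Rightarrow> real"
  shows "bdd_above ((\<lambda>x. L2_set (\<lambda>r. \<Sum>s\<in>J. M r s * x s) I) ` {x :: 'b \<Rightarrow> real. (\<Sum>s\<in>J. (x s)\<^sup>2) \<le> 1})"
proof (rule bdd_aboveI2)
  fix x :: "'b \<Rightarrow> real" assume "x \<in> {x. (\<Sum>s\<in>J. (x s)\<^sup>2) \<le> 1}"
  then have "L2_set x J \<le> 1" by (simp add: L2_set_le_1_iff)
  then show "L2_set (\<lambda>r. \<Sum>s\<in>J. M r s * x s) I \<le> sqrt (\<Sum>r\<in>I. \<Sum>s\<in>J. (M r s)\<^sup>2)"
    by (intro order_trans[OF L2_set_mult_vec_le] mult_left_le) (auto intro!: sum_nonneg)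
qed

lemma opn_unit:
  assumes "L2_set x J \<le> 1"
  shows "L2_set (\<lambda>r. \<Sum>s\<in>J. M r s * x s) I \<le> opn I J M"
  unfolding opn_def using assms by (intro cSUP_upper opn_bdd_above) (simp add: L2_set_le_1_iff)

lemma opn_least:
  fixes M :: "'a \<Rightarrow> 'b \<Rightarrow> real"
  assumes "\<And>x. L2_set x J \<le> 1 \<Longrightarrow> L2_set (\<lambda>r. \<Sum>s\<in>J. M r s * x s) I \<le> b"
  shows "opn I J M \<le> b"
  unfolding opn_def
proof (rule cSUP_least)
  show "{x::'b \<Rightarrow> real. (\<Sum>s\<in>J. (x s)\<^sup>2) \<le> 1} \<noteq> {}"
    by (intro ex_in_conv[THEN iffD1] exI[of _ "\<lambda>_. 0"]) simp
next
  fix x :: "'b \<Rightarrow> real" assume "x \<in> {x. (\<Sum>s\<in>J. (x s)\<^sup>2) \<le> 1}"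
  then show "L2_set (\<lambda>r. \<Sum>s\<in>J. M r s * x s) I \<le> b"
    by (intro assms) (simp only: mem_Collect_eq L2_set_le_1_iff)
qed

lemma opn_nonneg: "0 \<le> opn I J M"
proof -
  have "0 \<le> L2_set (\<lambda>r. \<Sum>s\<in>J. M r s * 0) I" by (rule L2_set_nonneg)
  also have "\<dots> \<le> opn I J M" by (rule opn_unit) (simp add: L2_set_def)
  finally show ?thesis .
qed

lemma L2_set_scale: "L2_set (\<lambda>i. c * f i) A = \<bar>c\<bar> * L2_set f A"
  by (simp add: L2_set_def power_mult_distrib sum_distrib_left[symmetric] real_sqrt_mult)

lemma opn_mult_vec:
  "L2_set (\<lambda>r. \<Sum>s\<in>J. M r s * x s) I \<le> opn I J M * L2_set x J"
proof (cases "L2_set x J = 0")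
  case True
  have "L2_set (\<lambda>r. \<Sum>s\<in>J. M r s * x s) I \<le> sqrt (\<Sum>r\<in>I. \<Sum>s\<in>J. (M r s)\<^sup>2) * L2_set x J"
    by (rule L2_set_mult_vec_le)
  then show ?thesis by (simp add: True)
next
  case False
  define t where "t = L2_set x J"
  have t: "t > 0" using False L2_set_nonneg[of x J] by (simp add: t_def less_le)
  have "L2_set (\<lambda>s. inverse t * x s) J \<le> 1"
    unfolding L2_set_scale using t by (simp add: t_def[symmetric])
  then have "L2_set (\<lambda>r. \<Sum>s\<in>J. M r s * (inverse t * x s)) I \<le> opn I J M"
    by (rule opn_unit)
  moreover have "(\<lambda>r. \<Sum>s\<in>J. M r s * (inverse t * x s)) = (\<lambda>r. inverse t * (\<Sum>s\<in>J. M r s * x s))"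
    by (simp add: sum_distrib_left mult_ac)
  ultimately have "inverse t * L2_set (\<lambda>r. \<Sum>s\<in>J. M r s * x s) I \<le> opn I J M"
    using t by (simp add: L2_set_scale)
  then show ?thesis using t by (simp add: t_def[symmetric] field_simps)
qed

lemma opn_sumsq:
  "(\<Sum>r\<in>I. (\<Sum>s\<in>J. M r s * x s)\<^sup>2) \<le> (opn I J M)\<^sup>2 * (\<Sum>s\<in>J. (x s)\<^sup>2)"
proof -
  have "(L2_set (\<lambda>r. \<Sum>s\<in>J. M r s * x s) I)\<^sup>2 \<le> (opn I J M * L2_set x J)\<^sup>2"
    by (intro power_mono opn_mult_vec L2_set_nonneg)
  then show ?thesis by (simp add: L2_set_def power_mult_distrib sum_nonneg)
qed

lemma L2_set_sum_le: "L2_set (\<lambda>i. \<Sum>k\<in>S. f k i) A \<le> (\<Sum>k\<in>S. L2_set (f k) A)"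
proof (induction S rule: infinite_finite_induct)
  case (insert k S)
  then show ?case
    using L2_set_triangle_ineq[of "f k" "\<lambda>i. \<Sum>k\<in>S. f k i" A] by simp
qed (simp_all add: L2_set_def)

lemma opn_lincomb_le:
  "opn I J (\<lambda>r s. \<Sum>k\<in>S. c k * M k r s) \<le> (\<Sum>k\<in>S. \<bar>c k\<bar> * opn I J (M k))"
proof (rule opn_least)
  fix x assume x: "L2_set x J \<le> 1"
  have "(\<Sum>s\<in>J. (\<Sum>k\<in>S. c k * M k r s) * x s) = (\<Sum>k\<in>S. c k * (\<Sum>s\<in>J. M k r s * x s))" for r
    unfolding sum_distrib_left sum_distrib_right by (subst sum.swap) (simp add: mult_ac)
  then have "L2_set (\<lambda>r. \<Sum>s\<in>J. (\<Sum>k\<in>S. c k * M k r s) * x s) I =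
      L2_set (\<lambda>r. \<Sum>k\<in>S. c k * (\<Sum>s\<in>J. M k r s * x s)) I"
    by (simp only:)
  also have "\<dots> \<le> (\<Sum>k\<in>S. \<bar>c k\<bar> * L2_set (\<lambda>r. \<Sum>s\<in>J. M k r s * x s) I)"
    by (rule order_trans[OF L2_set_sum_le]) (simp add: L2_set_scale)
  also have "\<dots> \<le> (\<Sum>k\<in>S. \<bar>c k\<bar> * opn I J (M k))"
    by (intro sum_mono mult_left_mono opn_unit x) auto
  finally show "L2_set (\<lambda>r. \<Sum>s\<in>J. (\<Sum>k\<in>S. c k * M k r s) * x s) I \<le> \<dots>" .
qed

text \<open>The symmetric block matrix with \<open>M\<close> and its transpose off the diagonal. It
  reduces rectangular sign series to the symmetric trace bound and is linear in
  \<open>M\<close>.\<close>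

definition dilation :: "('a \<Rightarrow> 'b \<Rightarrow> real) \<Rightarrow> 'a + 'b \<Rightarrow> 'a + 'b \<Rightarrow> real" where
  "dilation M a b = (case a of Inl i \<Rightarrow> (case b of Inl _ \<Rightarrow> 0 | Inr j \<Rightarrow> M i j)
                        | Inr j \<Rightarrow> (case b of Inl i \<Rightarrow> M i j | Inr _ \<Rightarrow> 0))"

lemma dilation_simps [simp]:
  "dilation M (Inl i) (Inl i') = 0" "dilation M (Inl i) (Inr j) = M i j"
  "dilation M (Inr j) (Inl i) = M i j" "dilation M (Inr j) (Inr j') = 0"
  by (simp_all add: dilation_def)

lemma symmat_dilation: "symmat (dilation M)"
  by (simp add: symmat_def dilation_def split: sum.splits)

lemma signsum_dilation: "signsum S (\<lambda>k. dilation (H k)) T = dilation (signsum S H T)"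
  by (intro ext) (simp add: signsum_def dilation_def split: sum.splits)

lemma mmul_pow_cong:
  assumes "\<And>i j. i \<in> I \<Longrightarrow> A i j = B i j" "i \<in> I"
  shows "(mmul I X ^^ n) A i j = (mmul I X ^^ n) B i j"
  using assms(2)
proof (induction n arbitrary: i j)
  case (Suc n)
  then show ?case by (simp add: mmul_def)
qed (simp add: assms(1))

lemma frob_mmul_le: "frob I (mmul I P A) (mmul I P A) \<le> frob I P P * frob I A A"
proof -
  have "frob I (mmul I P A) (mmul I P A) = (\<Sum>i\<in>I. \<Sum>j\<in>I. (\<Sum>k\<in>I. P i k * A k j)\<^sup>2)"
    by (simp add: frob_def mmul_def power2_eq_square)
  also have "\<dots> \<le> (\<Sum>i\<in>I. \<Sum>j\<in>I. (\<Sum>k\<in>I. (P i k)\<^sup>2) * (\<Sum>k\<in>I. (A k j)\<^sup>2))"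
    by (intro sum_mono Cauchy_Schwarz_ineq_sum)
  also have "\<dots> = (\<Sum>i\<in>I. \<Sum>k\<in>I. (P i k)\<^sup>2) * (\<Sum>j\<in>I. \<Sum>k\<in>I. (A k j)\<^sup>2)"
    by (simp add: sum_product)
  also have "(\<Sum>j\<in>I. \<Sum>k\<in>I. (A k j)\<^sup>2) = (\<Sum>k\<in>I. \<Sum>j\<in>I. (A k j)\<^sup>2)"
    by (rule sum.swap)
  finally show ?thesis by (simp add: frob_def power2_eq_square)
qed

text \<open>Log-convexity makes the ratios of successive values nondecreasing, and the first ratio
  is at least \<open>s 1\<close> because \<open>s 0 \<le> 1\<close>. The product form
  \<open>s 1 * s k \<le> s (Suc k)\<close> of this remark also covers zero values.\<close>

lemma log_convex_power_le:
  fixes s :: "nat \<Rightarrow> real"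
  assumes nonneg: "\<And>k. 0 \<le> s k" and "s 0 \<le> 1" and "p > 0"
    and conv: "\<And>k. (s (Suc k))\<^sup>2 \<le> s k * s (Suc (Suc k))"
  shows "s 1 ^ p \<le> s p"
proof (cases p)
  case (Suc n)
  have step: "s 1 * s k \<le> s (Suc k)" for k
  proof (induction k)
    case 0
    then show ?case using mult_left_le[OF \<open>s 0 \<le> 1\<close> nonneg[of 1]] by simp
  next
    case (Suc k)
    show ?case
    proof (cases "s (Suc k) = 0")
      case True
      then show ?thesis by (simp add: nonneg)
    next
      case False
      then have pos: "s (Suc k) > 0" using nonneg[of "Suc k"] by simp
      have "s 1 * (s (Suc k))\<^sup>2 \<le> s 1 * (s k * s (Suc (Suc k)))"
        by (intro mult_left_mono conv nonneg)
      also have "\<dots> = (s 1 * s k) * s (Suc (Suc k))" by simp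
      also have "\<dots> \<le> s (Suc k) * s (Suc (Suc k))"
        by (intro mult_right_mono Suc.IH nonneg)
      finally have "s (Suc k) * (s 1 * s (Suc k)) \<le> s (Suc k) * s (Suc (Suc k))"
        by (simp add: power2_eq_square mult_ac)
      then show ?thesis using pos by simp
    qed
  qed
  have "s 1 ^ Suc n \<le> s (Suc n)" for n
  proof (induction n)
    case (Suc n)
    have "s 1 * s 1 ^ Suc n \<le> s 1 * s (Suc n)"
      by (intro mult_left_mono Suc.IH nonneg)
    also have "\<dots> \<le> s (Suc (Suc n))" by (rule step)
    finally show ?case by simp
  qed simp
  then show ?thesis using Suc by simp
qed (use \<open>p > 0\<close> in simp)

text \<open>A power iteration in place of the spectral theorem. The squared norms of X^k A are
  log-convex in k, so the first one raised to the power p is at most the p-th, which is at most the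
  squared Frobenius norm of X^p, that is tr X^(2p).\<close>

lemma frob_pow_le_trpow:
  assumes "finite I" "symmat X" "frob I A A \<le> 1" "p > 0"
  shows "frob I (mmul I X A) (mmul I X A) ^ p \<le> trpow I (2 * p) X"
proof -
  define s where "s k = frob I ((mmul I X ^^ k) A) ((mmul I X ^^ k) A)" for k
  have "s 1 ^ p \<le> s p"
  proof (rule log_convex_power_le)
    fix k
    have "s (Suc k) = frob I (mmul I X ((mmul I X ^^ k) A)) ((mmul I X ^^ Suc k) A)"
      by (simp add: s_def)
    also have "\<dots> = frob I ((mmul I X ^^ k) A) ((mmul I X ^^ Suc (Suc k)) A)"
      by (simp only: frob_mmul_left[OF assms(2)] funpow.simps o_apply)
    finally show "(s (Suc k))\<^sup>2 \<le> s k * s (Suc (Suc k))"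
      unfolding s_def by (metis frob_Cauchy_Schwarz)
  qed (use assms in \<open>simp_all add: s_def frob_nonneg\<close>)
  also have "s p = frob I (mmul I ((mmul I X ^^ p) idmat) A) (mmul I ((mmul I X ^^ p) idmat) A)"
  proof -
    have "(mmul I X ^^ p) A i j = mmul I ((mmul I X ^^ p) idmat) A i j" if "i \<in> I" for i j
    proof -
      have "(mmul I X ^^ p) A i j = (mmul I X ^^ p) (mmul I idmat A) i j"
        using assms(1) that by (intro mmul_pow_cong) (simp_all add: mmul_def idmat_def)
      then show ?thesis by (simp only: mmul_pow_mmul)
    qed
    then show ?thesis unfolding s_def by (intro frob_cong) simp_all
  qed
  also have "\<dots> \<le> trpow I (2 * p) X * frob I A A"
    unfolding trpow_even[OF assms(2)] by (rule frob_mmul_le)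
  also have "\<dots> \<le> trpow I (2 * p) X"
    using assms(3) by (intro mult_left_le) (simp_all add: trpow_even[OF assms(2)] frob_nonneg)
  finally show ?thesis by (simp add: s_def)
qed

lemma opn_le_trpow_dilation:
  assumes "finite I" "finite J" "p > 0"
  shows "opn I J M ^ (2 * p) \<le> trpow (I <+> J) (2 * p) (dilation M)"
proof -
  let ?K = "I <+> J"
  define t where "t = trpow ?K (2 * p) (dilation M)"
  have fin: "finite ?K" using assms by (intro finite_Plus)
  have t0: "0 \<le> t" by (simp add: t_def trpow_even[OF symmat_dilation] frob_nonneg)
  have "opn I J M \<le> root (2 * p) t"
  proof (rule opn_least)
    fix x assume x: "L2_set x J \<le> 1"
    show "L2_set (\<lambda>r. \<Sum>s\<in>J. M r s * x s) I \<le> root (2 * p) t"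
    proof (cases "J = {}")
      case True
      then show ?thesis using t0 assms by (simp add: L2_set_def)
    next
      case False
      then obtain b where b: "b \<in> J" by blast
      have b': "Inr b \<in> I <+> J" using b by blast
      \<comment> \<open>The vector \<open>x\<close> is placed in a single column, indexed by some
        \<open>b\<close> in \<open>J\<close>, of an otherwise zero matrix, since the power iteration
        is formulated for matrices.\<close>
      define A :: "'a + 'b \<Rightarrow> 'a + 'b \<Rightarrow> real" where
        "A a c = (case a of Inl _ \<Rightarrow> 0 | Inr j \<Rightarrow> if c = Inr b then x j else 0)" for a c
      have A: "A (Inl i) c = 0" "A (Inr j) c = (if c = Inr b then x j else 0)" for i j c
        by (simp_all add: A_def)
      have ipA: "frob ?K A A = (\<Sum>j\<in>J. (x j)\<^sup>2)"
        using assms b b' by (simp add: frob_def sum.Plus A power2_eq_square if_distrib cong: if_cong)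
      have mmA: "mmul ?K (dilation M) A (Inl i) (Inr c) = (if c = b then \<Sum>s\<in>J. M i s * x s else 0)"
        "mmul ?K (dilation M) A a (Inl i) = 0"
        "mmul ?K (dilation M) A (Inr j) c' = 0" for a i j c c'
        using assms by (simp_all add: mmul_def sum.Plus A)
      have "frob ?K (mmul ?K (dilation M) A) (mmul ?K (dilation M) A) = (\<Sum>i\<in>I. (\<Sum>s\<in>J. M i s * x s)\<^sup>2)"
        using assms b b' by (simp add: frob_def sum.Plus mmA power2_eq_square if_distrib cong: if_cong)
      then have "(L2_set (\<lambda>r. \<Sum>s\<in>J. M r s * x s) I)\<^sup>2 = frob ?K (mmul ?K (dilation M) A) (mmul ?K (dilation M) A)"
        by (simp add: L2_set_def sum_nonneg)
      moreover have "frob ?K (mmul ?K (dilation M) A) (mmul ?K (dilation M) A) ^ p \<le> t"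
        unfolding t_def using x assms(3)
        by (intro frob_pow_le_trpow fin symmat_dilation) (simp_all add: ipA L2_set_le_1_iff)
      ultimately have "L2_set (\<lambda>r. \<Sum>s\<in>J. M r s * x s) I ^ (2 * p) \<le> t"
        by (simp add: power_mult)
      then have "root (2 * p) (L2_set (\<lambda>r. \<Sum>s\<in>J. M r s * x s) I ^ (2 * p)) \<le> root (2 * p) t"
        using assms(3) by (intro real_root_le_mono) auto
      then show ?thesis
        using assms(3) by (simp add: real_root_power_cancel L2_set_nonneg)
    qed
  qed
  then have "opn I J M ^ (2 * p) \<le> root (2 * p) t ^ (2 * p)"
    by (intro power_mono opn_nonneg)
  then show ?thesis
    using assms(3) t0 by (simp add: t_def)
qed

text \<open>The square of the dilation of H is block diagonal with blocks H H^T and H^T H, whence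
  one variance condition for each side and the dimension \<open>card I + card J\<close>.\<close>

theorem sign_opn_moment:
  assumes fin: "finite I" "finite J" "finite S" and v: "0 \<le> v" and p: "p > 0"
    and row: "\<And>x. (\<Sum>k\<in>S. \<Sum>i\<in>I. (\<Sum>j\<in>J. H k i j * x j)\<^sup>2) \<le> v * (\<Sum>j\<in>J. (x j)\<^sup>2)"
    and col: "\<And>y. (\<Sum>k\<in>S. \<Sum>j\<in>J. (\<Sum>i\<in>I. H k i j * y i)\<^sup>2) \<le> v * (\<Sum>i\<in>I. (y i)\<^sup>2)"
  shows "(\<Sum>T\<in>Pow S. opn I J (signsum S H T) ^ (2 * p)) \<le>
    2 ^ card S * real (card I + card J) * (4 * real p * v) ^ p"
proof -
  let ?K = "I <+> J"
  have "(\<Sum>T\<in>Pow S. opn I J (signsum S H T) ^ (2 * p)) \<le>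
      (\<Sum>T\<in>Pow S. trpow ?K (2 * p) (signsum S (\<lambda>k. dilation (H k)) T))"
    unfolding signsum_dilation by (intro sum_mono opn_le_trpow_dilation fin p)
  also have "\<dots> \<le> 2 ^ card S * real (card ?K) * (4 * real p * v) ^ p"
  proof (rule sign_trace_moment)
    show "finite ?K" using fin by (intro finite_Plus)
    fix z :: "'a + 'b \<Rightarrow> real"
    have "(\<Sum>k\<in>S. \<Sum>a\<in>?K. (\<Sum>b\<in>?K. dilation (H k) a b * z b)\<^sup>2) =
        (\<Sum>k\<in>S. \<Sum>i\<in>I. (\<Sum>j\<in>J. H k i j * z (Inr j))\<^sup>2) +
        (\<Sum>k\<in>S. \<Sum>j\<in>J. (\<Sum>i\<in>I. H k i j * z (Inl i))\<^sup>2)"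
      using fin by (simp add: sum.Plus sum.distrib)
    also have "\<dots> \<le> v * (\<Sum>j\<in>J. (z (Inr j))\<^sup>2) + v * (\<Sum>i\<in>I. (z (Inl i))\<^sup>2)"
      by (intro add_mono row col)
    also have "\<dots> = v * (\<Sum>a\<in>?K. (z a)\<^sup>2)"
      using fin by (simp add: sum.Plus algebra_simps)
    finally show "(\<Sum>k\<in>S. \<Sum>a\<in>?K. (\<Sum>b\<in>?K. dilation (H k) a b * z b)\<^sup>2) \<le> \<dots>" .
  qed (use fin v in \<open>auto intro: symmat_dilation\<close>)
  finally show ?thesis
    using fin by (simp add: card_Plus)
qed

text \<open>Numbers are matrices over the one-point index set \<open>{()}\<close>, so the scalar
  Khintchine inequality is a special case of the matrix bound.\<close>

lemma sign_scalar_moment: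
  assumes "finite S" and v: "(\<Sum>k\<in>S. (y k)\<^sup>2) \<le> v"
  shows "(\<Sum>T\<in>Pow S. (\<Sum>k\<in>S. rsign T k * y k) ^ (2 * q)) \<le> 2 ^ card S * (4 * real q * v) ^ q"
proof -
  have v0: "0 \<le> v" using v by (rule order_trans[rotated]) (simp add: sum_nonneg)
  have trp1: "trpow {()} n X = X () () ^ n" for n X
  proof -
    have "(mmul {()} X ^^ n) idmat () () = X () () ^ n"
      by (induction n) (simp_all add: idmat_def mmul_def)
    then show ?thesis by (simp add: trpow_def frob_def idmat_def)
  qed
  have "(\<Sum>T\<in>Pow S. trpow {()} (2 * q) (signsum S (\<lambda>k _ _. y k) T)) \<le>
      2 ^ card S * real (card {()}) * (4 * real q * v) ^ q"
  proof (rule sign_trace_moment)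
    fix x :: "unit \<Rightarrow> real"
    show "(\<Sum>k\<in>S. \<Sum>i\<in>{()}. (\<Sum>j\<in>{()}. y k * x j)\<^sup>2) \<le> v * (\<Sum>j\<in>{()}. (x j)\<^sup>2)"
      using v by (simp add: power_mult_distrib sum_distrib_right[symmetric] mult_right_mono)
  qed (use assms v0 in \<open>auto simp: symmat_def\<close>)
  then show ?thesis by (simp add: trp1 signsum_def)
qed

section \<open>A net bound for sign matrices\<close>

text \<open>Extensionality identifies functions that agree on \<open>I\<close>, and the box gives a
  finite product set over which weights factorise.\<close>

definition intball :: "nat \<Rightarrow> 'a set \<Rightarrow> ('a \<Rightarrow> int) set" where
  "intball m I = {z \<in> I \<rightarrow>\<^sub>E {- int m..int m}. (\<Sum>i\<in>I. (z i)\<^sup>2) \<le> int m}"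

lemma finite_intball: "finite I \<Longrightarrow> finite (intball m I)"
  unfolding intball_def by (rule finite_subset[of _ "I \<rightarrow>\<^sub>E {- int m..int m}"]) (auto intro: finite_PiE)

lemma sum_half_power_abs_le: "(\<Sum>k\<in>{- int m..int m}. (1/2 :: real) ^ nat \<bar>k\<bar>) \<le> 3"
proof -
  have "(\<Sum>k\<in>{- int m..int m}. (1/2 :: real) ^ nat \<bar>k\<bar>) = 3 - 2 * (1/2) ^ m"
  proof (induction m)
    case (Suc m)
    have "{- int (Suc m)..int (Suc m)} = insert (int (Suc m)) (insert (- int (Suc m)) {- int m..int m})"
      by auto
    then have "(\<Sum>k\<in>{- int (Suc m)..int (Suc m)}. (1/2 :: real) ^ nat \<bar>k\<bar>) =
        (1/2) ^ Suc m + ((1/2) ^ Suc m + (\<Sum>k\<in>{- int m..int m}. (1/2) ^ nat \<bar>k\<bar>))"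
      by (simp add: nat_add_distrib)
    then show ?case by (simp add: Suc.IH)
  qed simp
  then show ?thesis by simp
qed

text \<open>Counting by weights: an integer point of the ball has \<Sum> |z_i| \<le> \<Sum> z_i^2
  \<le> m, so its weight \<Prod> 2^(-|z_i|) is at least 2^(-m). The total weight of the box
  factorises into coordinate sums, each at most 3.\<close>

lemma card_intball_le:
  assumes "finite I"
  shows "real (card (intball m I)) \<le> 2 ^ m * 3 ^ card I"
proof -
  let ?Z = "{- int m..int m}"
  have *: "1 \<le> 2 ^ m * (\<Prod>i\<in>I. (1/2 :: real) ^ nat \<bar>z i\<bar>)" if "z \<in> intball m I" for z
  proof -
    have "int (\<Sum>i\<in>I. nat \<bar>z i\<bar>) = (\<Sum>i\<in>I. \<bar>z i\<bar>)" by simp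
    also have "\<dots> \<le> (\<Sum>i\<in>I. (z i)\<^sup>2)"
    proof (rule sum_mono)
      fix i
      show "\<bar>z i\<bar> \<le> (z i)\<^sup>2"
      proof (cases "z i = 0")
        case False
        then have "\<bar>z i\<bar> * 1 \<le> \<bar>z i\<bar> * \<bar>z i\<bar>" by (intro mult_left_mono) auto
        then show ?thesis by (simp add: power2_eq_square)
      qed simp
    qed
    also have "\<dots> \<le> int m" using that by (simp add: intball_def)
    finally have le: "(\<Sum>i\<in>I. nat \<bar>z i\<bar>) \<le> m" by (simp only: of_nat_le_iff)
    have "(\<Prod>i\<in>I. (1/2 :: real) ^ nat \<bar>z i\<bar>) = (1/2) ^ (\<Sum>i\<in>I. nat \<bar>z i\<bar>)"
      by (simp only: power_sum)
    also have "\<dots> \<ge> (1/2) ^ m" by (intro power_decreasing le) auto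
    finally have "(1/2) ^ m \<le> (\<Prod>i\<in>I. (1/2 :: real) ^ nat \<bar>z i\<bar>)" .
    then have "2 ^ m * (1/2) ^ m \<le> 2 ^ m * (\<Prod>i\<in>I. (1/2 :: real) ^ nat \<bar>z i\<bar>)"
      by (intro mult_left_mono) auto
    moreover have "(2::real) ^ m * (1/2) ^ m = 1" by (simp add: power_mult_distrib[symmetric])
    ultimately show ?thesis by simp
  qed
  have "real (card (intball m I)) = (\<Sum>z\<in>intball m I. 1)" by simp
  also have "\<dots> \<le> (\<Sum>z\<in>intball m I. 2 ^ m * (\<Prod>i\<in>I. (1/2 :: real) ^ nat \<bar>z i\<bar>))"
    by (intro sum_mono *)
  also have "\<dots> \<le> (\<Sum>z\<in>I \<rightarrow>\<^sub>E ?Z. 2 ^ m * (\<Prod>i\<in>I. (1/2 :: real) ^ nat \<bar>z i\<bar>))"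
    using assms by (intro sum_mono2 finite_PiE) (auto simp: intball_def intro!: mult_nonneg_nonneg prod_nonneg)
  also have "\<dots> = 2 ^ m * (\<Prod>i\<in>I. \<Sum>k\<in>?Z. (1/2 :: real) ^ nat \<bar>k\<bar>)"
    using assms by (subst prod_sum_PiE) (simp_all add: sum_distrib_left)
  also have "\<dots> \<le> 2 ^ m * (\<Prod>i\<in>I. 3)"
    by (intro mult_left_mono prod_mono conjI sum_nonneg sum_half_power_abs_le) auto
  finally show ?thesis by simp
qed

text \<open>Rounding to the nearest integer could push a point out of the ball; rounding toward zero
  never increases a coordinate.\<close>

lemma round_toward_zero:
  fixes y :: real
  obtains z :: int where "\<bar>real_of_int z\<bar> \<le> \<bar>y\<bar>" "\<bar>y - real_of_int z\<bar> \<le> 1"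
proof (cases "y \<ge> 0")
  case True
  have "real_of_int \<lfloor>y\<rfloor> \<le> y" "y < real_of_int \<lfloor>y\<rfloor> + 1" "0 \<le> real_of_int \<lfloor>y\<rfloor>"
    using True by (simp_all add: floor_correct)
  then have "\<bar>real_of_int \<lfloor>y\<rfloor>\<bar> \<le> \<bar>y\<bar>" "\<bar>y - real_of_int \<lfloor>y\<rfloor>\<bar> \<le> 1"
    using True by linarith+
  then show ?thesis by (rule that)
next
  case False
  have "y \<le> real_of_int \<lceil>y\<rceil>" "real_of_int \<lceil>y\<rceil> - 1 < y" "real_of_int \<lceil>y\<rceil> \<le> 0"
    using False ceiling_correct[of y] by (simp_all add: ceiling_le_iff)
  then have "\<bar>real_of_int \<lceil>y\<rceil>\<bar> \<le> \<bar>y\<bar>" "\<bar>y - real_of_int \<lceil>y\<rceil>\<bar> \<le> 1"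
    using False by linarith+
  then show ?thesis by (rule that)
qed

text \<open>Integer points scaled by \<open>4 sqrt (card I)\<close> form a 1/4-net of the unit ball.\<close>

definition netpt :: "'a set \<Rightarrow> ('a \<Rightarrow> int) \<Rightarrow> 'a \<Rightarrow> real" where
  "netpt I z i = real_of_int (z i) / (4 * sqrt (real (card I)))"

abbreviation net :: "'a set \<Rightarrow> ('a \<Rightarrow> int) set" where
  "net I \<equiv> intball (16 * card I) I"

lemma netpt_unit:
  assumes "finite I" "z \<in> net I"
  shows "(\<Sum>i\<in>I. (netpt I z i)\<^sup>2) \<le> 1"
proof (cases "I = {}")
  case False
  then have c: "card I > 0" using assms(1) by (simp add: card_gt_0_iff)
  have "real_of_int (\<Sum>i\<in>I. (z i)\<^sup>2) \<le> real_of_int (int (16 * card I))"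
    using assms(2) unfolding intball_def by (subst of_int_le_iff) simp
  then have "(\<Sum>i\<in>I. (real_of_int (z i))\<^sup>2) \<le> 16 * real (card I)"
    by simp
  then have "(\<Sum>i\<in>I. (real_of_int (z i))\<^sup>2) / (16 * real (card I)) \<le> 1"
    using c by (simp add: divide_le_eq)
  moreover have "(\<Sum>i\<in>I. (netpt I z i)\<^sup>2) = (\<Sum>i\<in>I. (real_of_int (z i))\<^sup>2) / (16 * real (card I))"
    by (simp add: netpt_def power_divide power_mult_distrib sum_divide_distrib)
  ultimately show ?thesis by simp
qed simp

lemma net_approx:
  fixes u :: "'a \<Rightarrow> real"
  assumes fin: "finite I" and u: "L2_set u I \<le> 1"
  obtains z where "z \<in> net I" "L2_set (\<lambda>i. u i - netpt I z i) I \<le> 1/4"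
proof (cases "I = {}")
  case True
  then show ?thesis
    by (intro that[of "\<lambda>_. undefined"]) (auto simp: intball_def)
next
  case False
  then have c: "card I > 0" using fin by (simp add: card_gt_0_iff)
  define s where "s = 4 * sqrt (real (card I))"
  have s: "s > 0" "s\<^sup>2 = 16 * real (card I)" using c by (simp_all add: s_def power_mult_distrib)
  have u2: "(\<Sum>i\<in>I. (u i)\<^sup>2) \<le> 1" using u by (simp add: L2_set_le_1_iff)
  have "\<exists>z::int. \<bar>real_of_int z\<bar> \<le> \<bar>s * u i\<bar> \<and> \<bar>s * u i - real_of_int z\<bar> \<le> 1" for i
    by (rule round_toward_zero[of "s * u i"]) blast
  then obtain z0 :: "'a \<Rightarrow> int" where
    z0: "\<bar>real_of_int (z0 i)\<bar> \<le> \<bar>s * u i\<bar>" "\<bar>s * u i - real_of_int (z0 i)\<bar> \<le> 1" for i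
    by metis
  define z where "z = restrict z0 I"
  have nvs: "netpt I z i = real_of_int (z i) / s" for i by (simp add: netpt_def s_def)
  have zi: "z i = z0 i" if "i \<in> I" for i using that by (simp add: z_def)
  have "(\<Sum>i\<in>I. (real_of_int (z i))\<^sup>2) \<le> (\<Sum>i\<in>I. (s * u i)\<^sup>2)"
  proof (rule sum_mono)
    fix i assume "i \<in> I"
    then show "(real_of_int (z i))\<^sup>2 \<le> (s * u i)\<^sup>2"
      unfolding zi[OF \<open>i \<in> I\<close>] by (intro iffD1[OF abs_le_square_iff] z0)
  qed
  also have "\<dots> = s\<^sup>2 * (\<Sum>i\<in>I. (u i)\<^sup>2)"
    by (simp add: power_mult_distrib sum_distrib_left)
  also have "\<dots> \<le> s\<^sup>2" using u2 by (intro mult_left_le) auto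
  finally have "real_of_int (\<Sum>i\<in>I. (z i)\<^sup>2) \<le> real_of_int (int (16 * card I))"
    by (simp add: s)
  then have sq: "(\<Sum>i\<in>I. (z i)\<^sup>2) \<le> int (16 * card I)" by (simp only: of_int_le_iff)
  have bd: "\<bar>z i\<bar> \<le> int (16 * card I)" if i: "i \<in> I" for i
  proof -
    have "\<bar>z i\<bar> \<le> (z i)\<^sup>2"
    proof (cases "z i = 0")
      case False
      then have "\<bar>z i\<bar> * 1 \<le> \<bar>z i\<bar> * \<bar>z i\<bar>" by (intro mult_left_mono) auto
      then show ?thesis by (simp add: power2_eq_square)
    qed simp
    also have "\<dots> \<le> (\<Sum>i\<in>I. (z i)\<^sup>2)" using fin i by (intro member_le_sum) auto
    finally show ?thesis using sq by linarith
  qed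
  have "z \<in> net I"
    unfolding intball_def using sq bd by (auto simp: z_def abs_le_iff minus_le_iff)
  \<comment> \<open>Every coordinate is off by at most 1/s, so the squared error is at most
    \<open>card I\<close> / s^2 = 1/16.\<close>
  moreover have "(\<Sum>i\<in>I. (u i - netpt I z i)\<^sup>2) \<le> (\<Sum>i\<in>I. (1 / s)\<^sup>2)"
  proof (rule sum_mono)
    fix i assume i: "i \<in> I"
    have "u i - netpt I z i = (s * u i - real_of_int (z0 i)) / s"
      using s(1) by (simp add: nvs zi[OF i] diff_divide_distrib)
    then have "\<bar>u i - netpt I z i\<bar> \<le> \<bar>1 / s\<bar>"
      using z0(2)[of i] s(1) by (simp add: divide_right_mono)
    then show "(u i - netpt I z i)\<^sup>2 \<le> (1 / s)\<^sup>2" by (simp only: abs_le_square_iff)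
  qed
  then have "(\<Sum>i\<in>I. (u i - netpt I z i)\<^sup>2) \<le> (1/4)\<^sup>2"
    using c by (simp add: power_divide s(2))
  then have "L2_set (\<lambda>i. u i - netpt I z i) I \<le> 1/4"
    unfolding L2_set_def by (intro real_le_lsqrt) (auto intro: sum_nonneg)
  ultimately show ?thesis by (rule that)
qed

lemma L2_set_Cauchy_Schwarz: "\<bar>\<Sum>i\<in>I. f i * g i\<bar> \<le> L2_set f I * L2_set g I"
proof -
  have "\<bar>\<Sum>i\<in>I. f i * g i\<bar> \<le> (\<Sum>i\<in>I. \<bar>f i\<bar> * \<bar>g i\<bar>)"
    by (rule order_trans[OF sum_abs]) (simp add: abs_mult)
  also have "\<dots> \<le> L2_set f I * L2_set g I" by (rule L2_set_mult_ineq)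
  finally show ?thesis .
qed

lemma bilinear_le:
  "\<bar>\<Sum>i\<in>I. u i * (\<Sum>j\<in>J. M i j * v j)\<bar> \<le> opn I J M * L2_set u I * L2_set v J"
proof -
  have "\<bar>\<Sum>i\<in>I. u i * (\<Sum>j\<in>J. M i j * v j)\<bar> \<le> L2_set u I * L2_set (\<lambda>i. \<Sum>j\<in>J. M i j * v j) I"
    by (rule L2_set_Cauchy_Schwarz)
  also have "\<dots> \<le> L2_set u I * (opn I J M * L2_set v J)"
    by (intro mult_left_mono opn_mult_vec L2_set_nonneg)
  finally show ?thesis by (simp add: mult_ac)
qed

definition netform :: "'a set \<Rightarrow> 'b set \<Rightarrow> ('a \<Rightarrow> 'b \<Rightarrow> real) \<Rightarrow> ('a \<Rightarrow> int) \<Rightarrow> ('b \<Rightarrow> int) \<Rightarrow> real" where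
  "netform I J M z w = (\<Sum>i\<in>I. netpt I z i * (\<Sum>j\<in>J. M i j * netpt J w j))"

lemma L2_set_dual_witness:
  assumes "L2_set y I \<noteq> 0"
  obtains u where "L2_set u I \<le> 1" "(\<Sum>i\<in>I. u i * y i) = L2_set y I"
proof -
  define n where "n = L2_set y I"
  have n: "n > 0" using assms L2_set_nonneg[of y I] by (simp add: n_def less_le)
  have sq: "(\<Sum>i\<in>I. y i * y i) = n * n"
    unfolding n_def L2_set_def by (simp add: sum_nonneg power2_eq_square)
  have "(\<Sum>i\<in>I. (inverse n * y i) * y i) = n"
    using n by (simp add: mult.assoc sum_distrib_left[symmetric] sq)
  moreover have "L2_set (\<lambda>i. inverse n * y i) I \<le> 1"
    unfolding L2_set_scale n_def[symmetric] using n by simp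
  ultimately show ?thesis using that unfolding n_def by blast
qed

text \<open>Replacing either vector of the bilinear form by a net point costs a quarter of the norm,
  so the norm \<beta> satisfies \<beta> \<le> \<mu> + \<beta>/2.\<close>

lemma opn_le_netform:
  assumes fin: "finite I" "finite J" and mu: "\<And>z w. z \<in> net I \<Longrightarrow> w \<in> net J \<Longrightarrow> \<bar>netform I J M z w\<bar> \<le> \<mu>"
    and mu0: "0 \<le> \<mu>"
  shows "opn I J M \<le> 2 * \<mu>"
proof -
  define \<beta> where "\<beta> = opn I J M"
  have b0: "0 \<le> \<beta>" by (simp add: \<beta>_def opn_nonneg)
  have "\<beta> \<le> \<mu> + \<beta> / 2"
    unfolding \<beta>_def
  proof (rule opn_least, fold \<beta>_def)
    fix v :: "'b \<Rightarrow> real" assume v: "L2_set v J \<le> 1"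
    let ?y = "\<lambda>i. \<Sum>j\<in>J. M i j * v j"
    show "L2_set ?y I \<le> \<mu> + \<beta> / 2"
    proof (cases "L2_set ?y I = 0")
      case True
      then show ?thesis using mu0 b0 by simp
    next
      case False
      then obtain u where u: "L2_set u I \<le> 1" "(\<Sum>i\<in>I. u i * ?y i) = L2_set ?y I"
        by (rule L2_set_dual_witness)
      obtain z where z: "z \<in> net I" "L2_set (\<lambda>i. u i - netpt I z i) I \<le> 1/4"
        using net_approx[OF fin(1) u(1)] .
      obtain w where w: "w \<in> net J" "L2_set (\<lambda>j. v j - netpt J w j) J \<le> 1/4"
        using net_approx[OF fin(2) v] .
      have nz: "L2_set (netpt I z) I \<le> 1" using netpt_unit[OF fin(1) z(1)] by (simp only: L2_set_le_1_iff)
      \<comment> \<open>First \<open>u\<close> is replaced by its net point with \<open>v\<close>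
        kept, then \<open>v\<close> with the net point of \<open>u\<close> kept; net points lie in
        the unit ball, so both errors are controlled.\<close>
      have "L2_set ?y I = netform I J M z w + (\<Sum>i\<in>I. (u i - netpt I z i) * ?y i) +
          (\<Sum>i\<in>I. netpt I z i * (\<Sum>j\<in>J. M i j * (v j - netpt J w j)))"
        unfolding u(2)[symmetric] netform_def
        by (simp add: left_diff_distrib right_diff_distrib sum_subtractf)
      also have "\<dots> \<le> \<mu> + \<beta> * (1/4) * 1 + \<beta> * 1 * (1/4)"
      proof (intro add_mono)
        show "netform I J M z w \<le> \<mu>" using mu[OF z(1) w(1)] by linarith
        have "(\<Sum>i\<in>I. (u i - netpt I z i) * ?y i) \<le> \<beta> * L2_set (\<lambda>i. u i - netpt I z i) I * L2_set v J"
          unfolding \<beta>_def by (rule order_trans[OF abs_ge_self bilinear_le])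
        also have "\<dots> \<le> \<beta> * (1/4) * 1"
          using b0 z(2) v by (intro mult_mono) (auto intro: L2_set_nonneg)
        finally show "(\<Sum>i\<in>I. (u i - netpt I z i) * ?y i) \<le> \<beta> * (1/4) * 1" .
        have "(\<Sum>i\<in>I. netpt I z i * (\<Sum>j\<in>J. M i j * (v j - netpt J w j))) \<le>
            \<beta> * L2_set (netpt I z) I * L2_set (\<lambda>j. v j - netpt J w j) J"
          unfolding \<beta>_def by (rule order_trans[OF abs_ge_self bilinear_le])
        also have "\<dots> \<le> \<beta> * 1 * (1/4)"
          using b0 w(2) nz by (intro mult_mono) (auto intro: L2_set_nonneg)
        finally show "(\<Sum>i\<in>I. netpt I z i * (\<Sum>j\<in>J. M i j * (v j - netpt J w j))) \<le> \<beta> * 1 * (1/4)" .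
      qed
      finally show ?thesis by simp
    qed
  qed
  then show ?thesis by (simp add: \<beta>_def)
qed

text \<open>A union bound in moment form: the maximum over the two nets is replaced by the sum of
  the even powers, and 4^q is the factor 2 of the net argument raised to the power 2q.\<close>

lemma opn_power_le_netform:
  assumes fin: "finite I" "finite J"
  shows "opn I J M ^ (2 * q) \<le> 4 ^ q * (\<Sum>z\<in>net I. \<Sum>w\<in>net J. netform I J M z w ^ (2 * q))"
proof -
  let ?N = "net I \<times> net J"
  let ?f = "\<lambda>p. \<bar>netform I J M (fst p) (snd p)\<bar>"
  have finN: "finite ?N" using fin by (simp add: finite_intball)
  have "restrict (\<lambda>_. 0) I \<in> net I" "restrict (\<lambda>_. 0) J \<in> net J" by (auto simp: intball_def)
  then have ne: "?N \<noteq> {}" by blast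
  have "Max (?f ` ?N) \<in> ?f ` ?N" using finN ne by (intro Max_in finite_imageI) blast+
  then obtain p where p: "p \<in> ?N" "Max (?f ` ?N) = ?f p" by blast
  have "opn I J M \<le> 2 * ?f p"
  proof (rule opn_le_netform[OF fin])
    fix z w assume "z \<in> net I" "w \<in> net J"
    then have "?f (z, w) \<in> ?f ` ?N" by blast
    then have "?f (z, w) \<le> Max (?f ` ?N)" using finN by (intro Max_ge finite_imageI)
    then show "\<bar>netform I J M z w\<bar> \<le> ?f p" by (simp only: p(2) fst_conv snd_conv)
  qed simp
  then have "opn I J M ^ (2 * q) \<le> (2 * ?f p) ^ (2 * q)"
    by (intro power_mono opn_nonneg)
  also have "\<dots> = 4 ^ q * netform I J M (fst p) (snd p) ^ (2 * q)"
    by (simp add: power_mult_distrib power_mult)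
  also have "netform I J M (fst p) (snd p) ^ (2 * q) \<le> (\<Sum>p\<in>?N. netform I J M (fst p) (snd p) ^ (2 * q))"
    using finN p(1) by (intro member_le_sum) (auto simp: power_mult)
  also have "\<dots> = (\<Sum>z\<in>net I. \<Sum>w\<in>net J. netform I J M z w ^ (2 * q))"
    by (simp add: sum.cartesian_product case_prod_unfold)
  finally show ?thesis by simp
qed

lemma netform_signsum:
  "netform I J (signsum S G T) z w = (\<Sum>k\<in>S. rsign T k * netform I J (G k) z w)"
proof -
  have "netform I J (signsum S G T) z w = (\<Sum>i\<in>I. \<Sum>j\<in>J. \<Sum>k\<in>S. rsign T k * (netpt I z i * (G k i j * netpt J w j)))"
    by (simp add: netform_def signsum_def sum_distrib_left sum_distrib_right mult_ac)
  also have "\<dots> = (\<Sum>i\<in>I. \<Sum>k\<in>S. \<Sum>j\<in>J. rsign T k * (netpt I z i * (G k i j * netpt J w j)))"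
    by (intro sum.cong refl sum.swap)
  also have "\<dots> = (\<Sum>k\<in>S. \<Sum>i\<in>I. \<Sum>j\<in>J. rsign T k * (netpt I z i * (G k i j * netpt J w j)))"
    by (rule sum.swap)
  finally show ?thesis by (simp add: netform_def sum_distrib_left)
qed

text \<open>This lowers the order of a moment bound at the cost of a factor 2: if the mean of x^q is
  at most t^q, the mean of x^p is at most 2 t^p.\<close>

lemma power_le_interpolate:
  fixes x t :: real
  assumes "0 \<le> x" "0 < t" "p \<le> q"
  shows "x ^ p \<le> t ^ p * (1 + (x / t) ^ q)"
proof -
  have "(x / t) ^ p \<le> 1 + (x / t) ^ q"
  proof (cases "x / t \<le> 1")
    case True
    then have "(x / t) ^ p \<le> 1" using assms by (intro power_le_one) auto
    then show ?thesis using assms by (simp add: add_increasing2)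
  next
    case False
    then have "(x / t) ^ p \<le> (x / t) ^ q" using assms by (intro power_increasing) auto
    then show ?thesis by simp
  qed
  then have "t ^ p * (x / t) ^ p \<le> t ^ p * (1 + (x / t) ^ q)"
    using assms by (intro mult_left_mono) auto
  then show ?thesis using assms by (simp add: power_divide)
qed

text \<open>The moment order \<open>q\<close> is at least the total dimension, so the number of net
  pairs is absorbed by a constant to the power \<open>q\<close>. That constant is 196608 = 3 * 2^16
  from counting the nets; with 4 from the net argument and 4 q from the scalar moment it gives
  3145728 q. The bound at order \<open>q\<close> is then interpolated down to
  \<open>p\<close>.\<close>

theorem sign_matrix_moment:
  assumes fin: "finite I" "finite J" "finite S"
    and unit: "\<And>u v. (\<Sum>i\<in>I. (u i)\<^sup>2) \<le> 1 \<Longrightarrow> (\<Sum>j\<in>J. (v j)\<^sup>2) \<le> 1 \<Longrightarrow>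
      (\<Sum>k\<in>S. (\<Sum>i\<in>I. u i * (\<Sum>j\<in>J. G k i j * v j))\<^sup>2) \<le> 1"
    and q: "card I + card J \<le> q" "p \<le> q" "0 < q"
  shows "(\<Sum>T\<in>Pow S. opn I J (signsum S G T) ^ (2 * p)) \<le> 2 ^ card S * 2 * (3145728 * real q) ^ p"
proof -
  let ?o = "\<lambda>T. opn I J (signsum S G T)"
  define t where "t = 3145728 * real q"
  have t: "t > 0" using q by (simp add: t_def)
  have cards: "real (card (net I)) * real (card (net J)) \<le> 196608 ^ q"
  proof -
    have "real (card (net I)) * real (card (net J)) \<le>
        (2 ^ (16 * card I) * 3 ^ card I) * (2 ^ (16 * card J) * 3 ^ card J)"
      by (intro mult_mono card_intball_le fin) auto
    also have "\<dots> = 196608 ^ (card I + card J)"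
      by (simp add: power_mult power_add power_mult_distrib[symmetric])
    also have "\<dots> \<le> 196608 ^ q" using q by (intro power_increasing) auto
    finally show ?thesis .
  qed
  have "(\<Sum>T\<in>Pow S. ?o T ^ (2 * q)) \<le>
      (\<Sum>T\<in>Pow S. 4 ^ q * (\<Sum>z\<in>net I. \<Sum>w\<in>net J. netform I J (signsum S G T) z w ^ (2 * q)))"
    by (intro sum_mono opn_power_le_netform fin)
  also have "\<dots> = 4 ^ q * (\<Sum>z\<in>net I. \<Sum>w\<in>net J. \<Sum>T\<in>Pow S. netform I J (signsum S G T) z w ^ (2 * q))"
  proof -
    let ?n = "\<lambda>T z w. netform I J (signsum S G T) z w ^ (2 * q)"
    have "(\<Sum>T\<in>Pow S. \<Sum>z\<in>net I. \<Sum>w\<in>net J. ?n T z w) = (\<Sum>z\<in>net I. \<Sum>T\<in>Pow S. \<Sum>w\<in>net J. ?n T z w)"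
      by (rule sum.swap)
    also have "\<dots> = (\<Sum>z\<in>net I. \<Sum>w\<in>net J. \<Sum>T\<in>Pow S. ?n T z w)"
      by (rule sum.cong[OF refl]) (rule sum.swap)
    finally show ?thesis by (simp only: sum_distrib_left[symmetric])
  qed
  also have "\<dots> \<le> 4 ^ q * (\<Sum>z\<in>net I. \<Sum>w\<in>net J. 2 ^ card S * (4 * real q * 1) ^ q)"
  proof (intro mult_left_mono sum_mono)
    fix z w assume zw: "z \<in> net I" "w \<in> net J"
    have "(\<Sum>k\<in>S. (netform I J (G k) z w)\<^sup>2) \<le> 1"
      unfolding netform_def by (intro unit netpt_unit fin zw)
    then show "(\<Sum>T\<in>Pow S. netform I J (signsum S G T) z w ^ (2 * q)) \<le> 2 ^ card S * (4 * real q * 1) ^ q"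
      unfolding netform_signsum by (rule sign_scalar_moment[OF fin(3)])
  qed simp
  also have "\<dots> = 2 ^ card S * ((real (card (net I)) * real (card (net J))) * (16 * real q) ^ q)"
  proof -
    have eq: "4 ^ q * (4 * real q * 1) ^ q = (16 * real q) ^ q"
      by (subst power_mult_distrib[symmetric]) simp
    show ?thesis unfolding eq[symmetric] sum_constant by (simp only: mult_ac)
  qed
  also have "\<dots> \<le> 2 ^ card S * (196608 ^ q * (16 * real q) ^ q)"
    by (intro mult_left_mono mult_right_mono cards) auto
  also have "196608 ^ q * (16 * real q) ^ q = t ^ q"
    by (subst power_mult_distrib[symmetric]) (simp add: t_def)
  finally have big: "(\<Sum>T\<in>Pow S. ?o T ^ (2 * q)) \<le> 2 ^ card S * t ^ q" .
  have "(\<Sum>T\<in>Pow S. ?o T ^ (2 * p)) \<le> (\<Sum>T\<in>Pow S. t ^ p * (1 + ((?o T)\<^sup>2 / t) ^ q))"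
    unfolding power_mult by (intro sum_mono power_le_interpolate q t) auto
  also have "\<dots> = t ^ p * (2 ^ card S + (\<Sum>T\<in>Pow S. ?o T ^ (2 * q)) / t ^ q)"
    using fin by (simp add: sum_distrib_left[symmetric] sum.distrib card_Pow power_divide
        power_mult[symmetric] sum_divide_distrib)
  also have "\<dots> \<le> t ^ p * (2 ^ card S + 2 ^ card S)"
    using big t by (intro mult_left_mono add_left_mono) (auto simp: pos_divide_le_eq)
  finally show ?thesis by (simp add: t_def mult_ac)
qed

section \<open>Decoupling\<close>

lemma opn_cong:
  assumes "\<And>r s. r \<in> I \<Longrightarrow> s \<in> J \<Longrightarrow> M r s = M' r s"
  shows "opn I J M = opn I J M'"
proof -
  have "L2_set (\<lambda>r. \<Sum>s\<in>J. M r s * x s) I = L2_set (\<lambda>r. \<Sum>s\<in>J. M' r s * x s) I" for x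
    using assms by (intro L2_set_cong refl sum.cong) simp_all
  then show ?thesis by (simp add: opn_def)
qed

lemma mean_power_le:
  fixes x :: "'a \<Rightarrow> real"
  assumes "finite A" "A \<noteq> {}" "even n"
  shows "((\<Sum>a\<in>A. x a) / real (card A)) ^ n \<le> (\<Sum>a\<in>A. x a ^ n) / real (card A)"
proof -
  have c: "card A > 0" using assms by (simp add: card_gt_0_iff)
  have "(\<Sum>a\<in>A. (1 / real (card A)) *\<^sub>R x a) ^ n \<le> (\<Sum>a\<in>A. (1 / real (card A)) * x a ^ n)"
    using c assms by (intro convex_on_sum[OF _ _ convex_power_even]) auto
  then show ?thesis by (simp add: sum_divide_distrib)
qed

lemma sum_Pow_rsign_eq_0: "a \<in> S \<Longrightarrow> (\<Sum>J\<in>Pow S. rsign J a) = 0"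
  using sum_rsign_by_parts[of a S "\<lambda>_. 1"] by simp

lemma sum_Pow_rsign_mult_eq_0: "a \<in> S \<Longrightarrow> a \<noteq> b \<Longrightarrow> (\<Sum>J\<in>Pow S. rsign J a * rsign J b) = 0"
  using sum_rsign_by_parts[of a S "\<lambda>J. rsign J b"] by (simp add: rsign_flip)

lemma sum_Pow_mask:
  assumes "finite S" "a \<in> S" "b \<in> S"
  shows "(\<Sum>J\<in>Pow S. (if a \<in> J then 1 else 0) * (if b \<in> - J then 1 else 0)) =
    (if a = b then 0 else 2 ^ card S / 4 :: real)"
proof (cases "a = b")
  case False
  \<comment> \<open>The two indicators are (1 + rsign J a)/2 and (1 - rsign J b)/2. In the expanded
    product all terms but the constant one average to zero.\<close>
  have "(if a \<in> J then 1 else 0) * (if b \<in> - J then 1 else 0) =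
      (1 + rsign J a - rsign J b - rsign J a * rsign J b) / (4 :: real)" for J
    by (simp add: rsign_def)
  then have "(\<Sum>J\<in>Pow S. (if a \<in> J then 1 else 0) * (if b \<in> - J then 1 else 0)) =
      ((\<Sum>J\<in>Pow S. 1) + (\<Sum>J\<in>Pow S. rsign J a) - (\<Sum>J\<in>Pow S. rsign J b)
        - (\<Sum>J\<in>Pow S. rsign J a * rsign J b)) / (4 :: real)"
    by (simp only: sum_divide_distrib[symmetric] sum.distrib sum_subtractf)
  then show ?thesis
    using assms False by (simp add: sum_Pow_rsign_eq_0 sum_Pow_rsign_mult_eq_0 card_Pow)
qed (auto intro: sum.neutral)

text \<open>An entry is a normalised sum of \<open>m\<close> signs of which only those in the mask \<open>J\<close> are kept. A uniformly
  random mask puts one of two distinct signs in \<open>J\<close> and the other outside with probability 1/4, and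
  never splits a sign from itself, so averaging over masks reproduces the chaos without its diagonal.\<close>

definition maskmean :: "('e \<times> nat) set \<Rightarrow> nat \<Rightarrow> ('e \<times> nat) set \<Rightarrow> 'e \<Rightarrow> real" where
  "maskmean J m T e = (\<Sum>t<m. if (e, t) \<in> J then rsign T (e, t) else 0) / sqrt (real m)"

text \<open>What masking drops are the products of a sign with itself. For e = e' there are m of
  them, each equal to 1, and after normalisation they add up to 1, the mean of a squared entry.
  Dropping the diagonal is therefore the same as centering.\<close>

lemma sum_mask_maskmean:
  fixes S0 :: "'e set"
  assumes "finite S0" "e \<in> S0" "e' \<in> S0" "m > 0"
  shows "(\<Sum>J\<in>Pow (S0 \<times> {..<m}). maskmean J m T e * maskmean (- J) m T e') =
    2 ^ card (S0 \<times> {..<m}) / 4 * (maskmean UNIV m T e * maskmean UNIV m T e' - (if e = e' then 1 else 0))"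
proof -
  let ?S = "S0 \<times> {..<m}"
  have fin: "finite ?S" using assms by simp
  have "maskmean J m T e * maskmean (- J) m T e' =
      (\<Sum>t<m. \<Sum>t'<m. rsign T (e, t) * rsign T (e', t') *
        ((if (e, t) \<in> J then 1 else 0) * (if (e', t') \<in> - J then 1 else 0))) / m" for J
  proof -
    have "maskmean J m T e * maskmean (- J) m T e' =
      (\<Sum>t<m. if (e, t) \<in> J then rsign T (e, t) else 0) * (\<Sum>t<m. if (e', t) \<in> - J then rsign T (e', t) else 0) / m"
      by (simp add: maskmean_def)
    also have "\<dots> = (\<Sum>t<m. \<Sum>t'<m. (if (e, t) \<in> J then rsign T (e, t) else 0) *
        (if (e', t') \<in> - J then rsign T (e', t') else 0)) / m"
      by (simp only: sum_product)
    also have "\<dots> = (\<Sum>t<m. \<Sum>t'<m. rsign T (e, t) * rsign T (e', t') *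
        ((if (e, t) \<in> J then 1 else 0) * (if (e', t') \<in> - J then 1 else 0))) / m"
      by (intro arg_cong[where f = "\<lambda>x. x / real m"] sum.cong refl) auto
    finally show ?thesis .
  qed
  then have "(\<Sum>J\<in>Pow ?S. maskmean J m T e * maskmean (- J) m T e') =
      (\<Sum>J\<in>Pow ?S. \<Sum>t<m. \<Sum>t'<m. rsign T (e, t) * rsign T (e', t') *
        ((if (e, t) \<in> J then 1 else 0) * (if (e', t') \<in> - J then 1 else 0))) / m"
    by (simp only: sum_divide_distrib)
  also have "(\<Sum>J\<in>Pow ?S. \<Sum>t<m. \<Sum>t'<m. rsign T (e, t) * rsign T (e', t') *
        ((if (e, t) \<in> J then 1 else 0) * (if (e', t') \<in> - J then 1 else 0))) =
      (\<Sum>t<m. \<Sum>J\<in>Pow ?S. \<Sum>t'<m. rsign T (e, t) * rsign T (e', t') *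
        ((if (e, t) \<in> J then 1 else 0) * (if (e', t') \<in> - J then 1 else 0)))"
    by (rule sum.swap)
  also have "\<dots> = (\<Sum>t<m. \<Sum>t'<m. \<Sum>J\<in>Pow ?S. rsign T (e, t) * rsign T (e', t') *
        ((if (e, t) \<in> J then 1 else 0) * (if (e', t') \<in> - J then 1 else 0)))"
    by (rule sum.cong[OF refl]) (rule sum.swap)
  also have "\<dots> = (\<Sum>t<m. \<Sum>t'<m. rsign T (e, t) * rsign T (e', t') *
      (if (e, t) = (e', t') then 0 else 2 ^ card ?S / 4))"
    unfolding sum_distrib_left[symmetric]
    using assms by (intro sum.cong refl arg_cong2[of _ _ _ _ "(*)"] sum_Pow_mask fin) auto
  also have "\<dots> = 2 ^ card ?S / 4 * (\<Sum>t<m. \<Sum>t'<m. rsign T (e, t) * rsign T (e', t') *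
      (if (e, t) = (e', t') then 0 else 1))"
    unfolding sum_distrib_left by (intro sum.cong refl) auto
  also have "(\<Sum>t<m. \<Sum>t'<m. rsign T (e, t) * rsign T (e', t') * (if (e, t) = (e', t') then 0 else 1)) =
      (\<Sum>t<m. rsign T (e, t)) * (\<Sum>t'<m. rsign T (e', t')) - (if e = e' then real m else 0)"
  proof (cases "e = e'")
    case True
    have "rsign T (e, t) * rsign T (e, t') * (if (e, t) = (e, t') then 0 else 1) =
        rsign T (e, t) * rsign T (e, t') - (if t' = t then 1 else 0)" for t t'
      by auto
    then show ?thesis
      using True by (simp add: sum_subtractf sum_product)
  next
    case False
    then show ?thesis by (simp add: sum_product)
  qed
  finally have eq: "(\<Sum>J\<in>Pow ?S. maskmean J m T e * maskmean (- J) m T e') = 2 ^ card ?S / 4 *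
      ((\<Sum>t<m. rsign T (e, t)) * (\<Sum>t'<m. rsign T (e', t')) - (if e = e' then real m else 0)) / real m" .
  have "maskmean UNIV m T e * maskmean UNIV m T e' - (if e = e' then 1 else 0) =
      ((\<Sum>t<m. rsign T (e, t)) * (\<Sum>t'<m. rsign T (e', t')) - (if e = e' then real m else 0)) / real m"
    using assms(4) by (simp add: maskmean_def diff_divide_distrib)
  then show ?thesis unfolding eq by simp
qed

text \<open>The flag \<open>b\<close> selects the second tensor factor: \<open>False\<close> for \<open>A\<close>, \<open>True\<close> for its transpose. In
  \<open>cenmat\<close> the mean of a product of two entries is written out as 1 if they coincide, else 0.\<close>

definition qidx :: "bool \<Rightarrow> nat \<Rightarrow> nat \<Rightarrow> nat \<times> nat" where
  "qidx b l s = (if b then (s, l) else (l, s))"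

definition cenmat :: "bool \<Rightarrow> nat \<Rightarrow> (nat \<times> nat \<times> nat \<Rightarrow> real) \<Rightarrow> nat \<times> nat \<Rightarrow> nat \<times> nat \<Rightarrow> real" where
  "cenmat b K f r s = (\<Sum>i<K. f (i, fst r, fst s) * f (i, qidx b (snd r) (snd s)) -
     (if (fst r, fst s) = qidx b (snd r) (snd s) then 1 else 0))"

text \<open>The decoupled sum of f_i \<otimes> g_i, with g_i transposed if \<open>b\<close> holds.
  No mean is subtracted: when \<open>f\<close> and \<open>g\<close> use disjoint sets of signs the
  expectation is zero.\<close>

definition decmat :: "bool \<Rightarrow> nat \<Rightarrow> (nat \<times> nat \<times> nat \<Rightarrow> real) \<Rightarrow> (nat \<times> nat \<times> nat \<Rightarrow> real) \<Rightarrow>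
    nat \<times> nat \<Rightarrow> nat \<times> nat \<Rightarrow> real" where
  "decmat b K f g r s = (\<Sum>i<K. f (i, fst r, fst s) * g (i, qidx b (snd r) (snd s)))"

abbreviation entries :: "nat \<Rightarrow> nat \<Rightarrow> (nat \<times> nat \<times> nat) set" where
  "entries K N \<equiv> {..<K} \<times> {..<N} \<times> {..<N}"

abbreviation signidx :: "nat \<Rightarrow> nat \<Rightarrow> nat \<Rightarrow> ((nat \<times> nat \<times> nat) \<times> nat) set" where
  "signidx K N m \<equiv> entries K N \<times> {..<m}"

abbreviation sqidx :: "nat \<Rightarrow> (nat \<times> nat) set" where
  "sqidx N \<equiv> {..<N} \<times> {..<N}"

lemma sum_signidx: "(\<Sum>a\<in>signidx K N m. f a) = (\<Sum>i<K. \<Sum>j<N. \<Sum>k<N. \<Sum>t<m. f ((i, j, k), t))"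
  by (simp add: sum.cartesian_product case_prod_unfold)
    (rule sum.reindex_bij_witness[of _ "\<lambda>(i, j, k, t). ((i, j, k), t)" "\<lambda>((i, j, k), t). (i, j, k, t)"]; auto)

lemma sum_sqidx: "(\<Sum>r\<in>sqidx N. f r) = (\<Sum>j<N. \<Sum>l<N. f (j, l))"
  by (simp add: sum.cartesian_product)

text \<open>The identity holds for every fixed sign vector \<open>T\<close>, since only the mask is
  averaged. The 4 compensates the probability 1/4 that a mask separates two distinct signs.\<close>

lemma cenmat_decouple:
  assumes "m > 0" "r \<in> sqidx N" "s \<in> sqidx N"
  shows "cenmat b K (maskmean UNIV m T) r s =
    (\<Sum>J\<in>Pow (signidx K N m). 4 / 2 ^ card (signidx K N m) * decmat b K (maskmean J m T) (maskmean (- J) m T) r s)"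
proof -
  let ?S = "signidx K N m"
  let ?Q = "qidx b (snd r) (snd s)"
  have "(\<Sum>J\<in>Pow ?S. decmat b K (maskmean J m T) (maskmean (- J) m T) r s) =
      (\<Sum>i<K. \<Sum>J\<in>Pow ?S. maskmean J m T (i, fst r, fst s) * maskmean (- J) m T (i, ?Q))"
    unfolding decmat_def by (rule sum.swap)
  also have "\<dots> = (\<Sum>i<K. 2 ^ card ?S / 4 * (maskmean UNIV m T (i, fst r, fst s) * maskmean UNIV m T (i, ?Q)
      - (if (i, fst r, fst s) = (i, ?Q) then 1 else 0)))"
    using assms by (intro sum.cong refl sum_mask_maskmean) (auto simp: qidx_def)
  also have "\<dots> = 2 ^ card ?S / 4 * cenmat b K (maskmean UNIV m T) r s"
    by (simp add: cenmat_def sum_distrib_left)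
  finally have eq: "(\<Sum>J\<in>Pow ?S. decmat b K (maskmean J m T) (maskmean (- J) m T) r s) =
      2 ^ card ?S / 4 * cenmat b K (maskmean UNIV m T) r s" .
  show ?thesis unfolding sum_distrib_left[symmetric] eq by simp
qed

text \<open>Triangle inequality and Jensen for the uniform average over masks; 16^p is the
  decoupling factor 4 to the power 2p.\<close>

lemma opn_cenmat_power_le:
  assumes "m > 0"
  shows "opn (sqidx N) (sqidx N) (cenmat b K (maskmean UNIV m T)) ^ (2 * p) \<le>
    16 ^ p * (\<Sum>J\<in>Pow (signidx K N m). opn (sqidx N) (sqidx N) (decmat b K (maskmean J m T) (maskmean (- J) m T)) ^ (2 * p))
      / 2 ^ card (signidx K N m)"
proof -
  let ?S = "signidx K N m"
  let ?o = "\<lambda>J. opn (sqidx N) (sqidx N) (decmat b K (maskmean J m T) (maskmean (- J) m T))"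
  have "opn (sqidx N) (sqidx N) (cenmat b K (maskmean UNIV m T)) =
      opn (sqidx N) (sqidx N) (\<lambda>r s. \<Sum>J\<in>Pow ?S. 4 / 2 ^ card ?S * decmat b K (maskmean J m T) (maskmean (- J) m T) r s)"
    by (intro opn_cong cenmat_decouple assms)
  also have "\<dots> \<le> (\<Sum>J\<in>Pow ?S. \<bar>4 / 2 ^ card ?S\<bar> * ?o J)"
    by (rule opn_lincomb_le)
  also have "\<dots> = 4 * ((\<Sum>J\<in>Pow ?S. ?o J) / real (card (Pow ?S)))"
    by (simp only: sum_distrib_left[symmetric]) (simp add: card_Pow)
  finally have "opn (sqidx N) (sqidx N) (cenmat b K (maskmean UNIV m T)) ^ (2 * p) \<le>
      (4 * ((\<Sum>J\<in>Pow ?S. ?o J) / real (card (Pow ?S)))) ^ (2 * p)"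
    by (intro power_mono opn_nonneg)
  also have "\<dots> = 16 ^ p * ((\<Sum>J\<in>Pow ?S. ?o J) / real (card (Pow ?S))) ^ (2 * p)"
    by (subst power_mult_distrib) (simp add: power_mult)
  also have "\<dots> \<le> 16 ^ p * ((\<Sum>J\<in>Pow ?S. ?o J ^ (2 * p)) / real (card (Pow ?S)))"
    by (intro mult_left_mono mean_power_le) auto
  finally show ?thesis by (simp add: card_Pow)
qed

section \<open>Conditioning on the signs outside the mask\<close>

lemma sum_Pow_split:
  fixes f :: "'a set \<Rightarrow> real"
  assumes "J \<subseteq> S"
  shows "(\<Sum>T\<in>Pow S. f T) = (\<Sum>T2\<in>Pow (S - J). \<Sum>T1\<in>Pow J. f (T1 \<union> T2))"
proof -
  have *: "T \<inter> J \<union> (T - J) = T" for T by blast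
  show ?thesis
    unfolding sum.cartesian_product
    by (rule sum.reindex_bij_witness[of _ "\<lambda>(T2, T1). T1 \<union> T2" "\<lambda>T. (T - J, T \<inter> J)"])
      (use assms in \<open>auto simp: *\<close>)
qed

lemma maskmean_cong:
  assumes "\<And>t. t < m \<Longrightarrow> (e, t) \<in> J \<Longrightarrow> (e, t) \<in> T \<longleftrightarrow> (e, t) \<in> T'"
  shows "maskmean J m T e = maskmean J m T' e"
  unfolding maskmean_def using assms
  by (intro arg_cong2[of _ _ _ _ "(/)"] sum.cong refl) (auto simp: rsign_def)

definition blockco :: "nat \<Rightarrow> (nat \<Rightarrow> nat \<Rightarrow> nat \<Rightarrow> real) \<Rightarrow> (nat \<times> nat \<times> nat) \<times> nat \<Rightarrow>
    nat \<times> nat \<Rightarrow> nat \<times> nat \<Rightarrow> real" where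
  "blockco m F a r s = (if (fst r, fst s) = snd (fst a) then F (fst (fst a)) (snd r) (snd s) / sqrt (real m) else 0)"

lemma decmat_eq_signsum:
  assumes "J \<subseteq> signidx K N m" "r \<in> sqidx N" "s \<in> sqidx N"
  shows "decmat b K (maskmean J m T) g r s = signsum J (blockco m (\<lambda>i l k. g (i, qidx b l k))) T r s"
proof -
  let ?S = "signidx K N m"
  let ?F = "\<lambda>i l k. g (i, qidx b l k)"
  have fin: "finite ?S" by simp
  have JS: "{a \<in> ?S. a \<in> J} = J" using assms(1) by auto
  have "signsum J (blockco m ?F) T r s = (\<Sum>a\<in>?S. if a \<in> J then rsign T a * blockco m ?F a r s else 0)"
    unfolding signsum_def using sum.inter_filter[OF fin, of "\<lambda>a. rsign T a * blockco m ?F a r s" "\<lambda>a. a \<in> J"]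
    by (simp only: JS)
  also have "\<dots> = (\<Sum>i<K. \<Sum>j<N. \<Sum>k<N. \<Sum>t<m. if ((i, j, k), t) \<in> J then rsign T ((i, j, k), t) * blockco m ?F ((i, j, k), t) r s else 0)"
    by (rule sum_signidx)
  also have "\<dots> = (\<Sum>i<K. \<Sum>j<N. \<Sum>k<N. if k = fst s then (if j = fst r then maskmean J m T (i, j, k) * ?F i (snd r) (snd s) else 0) else 0)"
  proof (intro sum.cong refl)
    fix i j k
    show "(\<Sum>t<m. if ((i, j, k), t) \<in> J then rsign T ((i, j, k), t) * blockco m ?F ((i, j, k), t) r s else 0) =
      (if k = fst s then (if j = fst r then maskmean J m T (i, j, k) * ?F i (snd r) (snd s) else 0) else 0)"
    proof (cases "j = fst r \<and> k = fst s")
      case True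
      then have "blockco m ?F ((i, j, k), t) r s = ?F i (snd r) (snd s) / sqrt (real m)" for t
        by (simp add: blockco_def)
      then show ?thesis using True
        by (simp add: maskmean_def sum_distrib_right sum_divide_distrib) (intro sum.cong; simp)
    next
      case False
      then have "blockco m ?F ((i, j, k), t) r s = 0" for t by (auto simp: blockco_def)
      then have "(\<Sum>t<m. if ((i, j, k), t) \<in> J then rsign T ((i, j, k), t) * blockco m ?F ((i, j, k), t) r s else 0) = 0"
        by (intro sum.neutral ballI) (simp split: if_split)
      then show ?thesis using False by auto
    qed
  qed
  also have "\<dots> = decmat b K (maskmean J m T) g r s"
    using assms by (auto simp: decmat_def sum.delta intro!: sum.cong)
  finally show ?thesis ..
qed

text \<open>E_jk reads the slice \<open>x (k, _)\<close> and writes into block j. The output norm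
  does not depend on j, which gives the factor N; the m copies of a sign cancel the normalisation
  1/m; and the sum over i is the stacked bound for that slice.\<close>

lemma blockco_row:
  assumes bnd: "\<And>x. (\<Sum>i<K. \<Sum>l<N. (\<Sum>k<N. F i l k * x k)\<^sup>2) \<le> v * (\<Sum>k<N. (x k)\<^sup>2)" and m: "m > 0"
  shows "(\<Sum>i<K. \<Sum>j<N. \<Sum>k<N. \<Sum>t<m. \<Sum>r\<in>sqidx N. (\<Sum>s\<in>sqidx N. blockco m F ((i, j, k), t) r s * x s)\<^sup>2)
    \<le> (real N * v) * (\<Sum>s\<in>sqidx N. (x s)\<^sup>2)"
proof -
  have inner: "(\<Sum>t<m. \<Sum>r\<in>sqidx N. (\<Sum>s\<in>sqidx N. blockco m F ((i, j, k), t) r s * x s)\<^sup>2) =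
      (\<Sum>l<N. (\<Sum>h<N. F i l h * x (k, h))\<^sup>2)" if "j < N" "k < N" for i j k
  proof -
    have "(\<Sum>s\<in>sqidx N. blockco m F ((i, j, k), t) r s * x s) =
        (if fst r = j then (\<Sum>h<N. F i (snd r) h * x (k, h)) / sqrt m else 0)" for t r
    proof -
      have "(\<Sum>s\<in>sqidx N. blockco m F ((i, j, k), t) r s * x s) =
          (\<Sum>k'<N. if k' = k then (if fst r = j then (\<Sum>h<N. F i (snd r) h * x (k', h)) / sqrt m else 0) else 0)"
        unfolding sum_sqidx by (intro sum.cong refl) (auto simp: blockco_def sum_divide_distrib)
      then show ?thesis using that by simp
    qed
    then have "(\<Sum>r\<in>sqidx N. (\<Sum>s\<in>sqidx N. blockco m F ((i, j, k), t) r s * x s)\<^sup>2) =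
        (\<Sum>j'<N. if j' = j then (\<Sum>l<N. (\<Sum>h<N. F i l h * x (k, h))\<^sup>2) / m else 0)" for t
      unfolding sum_sqidx by (intro sum.cong refl) (auto simp: power_divide sum_divide_distrib[symmetric])
    then show ?thesis using that m by simp
  qed
  have "(\<Sum>i<K. \<Sum>j<N. \<Sum>k<N. \<Sum>t<m. \<Sum>r\<in>sqidx N. (\<Sum>s\<in>sqidx N. blockco m F ((i, j, k), t) r s * x s)\<^sup>2) =
      (\<Sum>i<K. \<Sum>j<N. \<Sum>k<N. \<Sum>l<N. (\<Sum>h<N. F i l h * x (k, h))\<^sup>2)"
    by (intro sum.cong refl inner) auto
  also have "\<dots> = real N * (\<Sum>i<K. \<Sum>k<N. \<Sum>l<N. (\<Sum>h<N. F i l h * x (k, h))\<^sup>2)"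
    by (simp add: sum_distrib_left)
  also have "(\<Sum>i<K. \<Sum>k<N. \<Sum>l<N. (\<Sum>h<N. F i l h * x (k, h))\<^sup>2) =
      (\<Sum>k<N. \<Sum>i<K. \<Sum>l<N. (\<Sum>h<N. F i l h * x (k, h))\<^sup>2)"
    by (rule sum.swap)
  also have "real N * \<dots> \<le> real N * (\<Sum>k<N. v * (\<Sum>h<N. (x (k, h))\<^sup>2))"
    by (intro mult_left_mono sum_mono bnd) auto
  also have "\<dots> = (real N * v) * (\<Sum>s\<in>sqidx N. (x s)\<^sup>2)"
    by (simp add: sum_sqidx sum_distrib_left mult_ac)
  finally show ?thesis .
qed

text \<open>Transposing a coefficient exchanges j with k and transposes \<open>F\<close>, so the
  column variance is the row variance of the transposed family.\<close>

lemma blockco_col: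
  assumes bnd: "\<And>x. (\<Sum>i<K. \<Sum>l<N. (\<Sum>k<N. F i k l * x k)\<^sup>2) \<le> v * (\<Sum>k<N. (x k)\<^sup>2)" and m: "m > 0"
  shows "(\<Sum>i<K. \<Sum>j<N. \<Sum>k<N. \<Sum>t<m. \<Sum>s\<in>sqidx N. (\<Sum>r\<in>sqidx N. blockco m F ((i, j, k), t) r s * x r)\<^sup>2)
    \<le> (real N * v) * (\<Sum>s\<in>sqidx N. (x s)\<^sup>2)"
proof -
  have "blockco m F ((i, j, k), t) r s = blockco m (\<lambda>i l k. F i k l) ((i, k, j), t) s r" for i j k t r s
    by (auto simp: blockco_def)
  then have "(\<Sum>i<K. \<Sum>j<N. \<Sum>k<N. \<Sum>t<m. \<Sum>s\<in>sqidx N. (\<Sum>r\<in>sqidx N. blockco m F ((i, j, k), t) r s * x r)\<^sup>2) =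
     (\<Sum>i<K. \<Sum>j<N. \<Sum>k<N. \<Sum>t<m. \<Sum>s\<in>sqidx N. (\<Sum>r\<in>sqidx N. blockco m (\<lambda>i l k. F i k l) ((i, k, j), t) s r * x r)\<^sup>2)"
    by simp
  also have "\<dots> = (\<Sum>i<K. \<Sum>k<N. \<Sum>j<N. \<Sum>t<m. \<Sum>s\<in>sqidx N. (\<Sum>r\<in>sqidx N. blockco m (\<lambda>i l k. F i k l) ((i, k, j), t) s r * x r)\<^sup>2)"
    by (rule sum.cong[OF refl]) (rule sum.swap)
  also have "\<dots> \<le> (real N * v) * (\<Sum>s\<in>sqidx N. (x s)\<^sup>2)"
    by (rule blockco_row[OF bnd m])
  finally show ?thesis .
qed

text \<open>With \<open>g\<close> frozen the decoupled sum is a matrix sign series in the signs of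
  \<open>J\<close>. Its row and column variances are governed by the B_i and by their transposes,
  each stacked into a matrix with K N rows; transposing amounts to negating
  \<open>b\<close>.\<close>

lemma decmat_moment_fixed:
  assumes J: "J \<subseteq> signidx K N m" and m: "m > 0" and p: "p > 0"
  shows "(\<Sum>T\<in>Pow J. opn (sqidx N) (sqidx N) (decmat b K (maskmean J m T) g) ^ (2 * p)) \<le>
    2 ^ card J * (2 * (real N)\<^sup>2) * (4 * real p * real N) ^ p *
      (opn ({..<K} \<times> {..<N}) {..<N} (\<lambda>r k. g (fst r, qidx b (snd r) k)) ^ (2 * p) +
       opn ({..<K} \<times> {..<N}) {..<N} (\<lambda>r k. g (fst r, qidx (\<not> b) (snd r) k)) ^ (2 * p))"
proof -
  let ?F = "\<lambda>i l k. g (i, qidx b l k)"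
  let ?H = "blockco m ?F"
  define B where "B c = opn ({..<K} \<times> {..<N}) {..<N} (\<lambda>r k. g (fst r, qidx c (snd r) k))" for c
  define v where "v = max ((B b)\<^sup>2) ((B (\<not> b))\<^sup>2)"
  have v0: "0 \<le> v" by (simp add: v_def le_max_iff_disj)
  have bnd: "(\<Sum>i<K. \<Sum>l<N. (\<Sum>k<N. g (i, qidx c l k) * x k)\<^sup>2) \<le> v * (\<Sum>k<N. (x k)\<^sup>2)" for c x
  proof -
    have "(\<Sum>i<K. \<Sum>l<N. (\<Sum>k<N. g (i, qidx c l k) * x k)\<^sup>2) =
        (\<Sum>r\<in>{..<K} \<times> {..<N}. (\<Sum>k<N. g (fst r, qidx c (snd r) k) * x k)\<^sup>2)"
      by (simp add: sum.cartesian_product case_prod_unfold)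
    also have "\<dots> \<le> (B c)\<^sup>2 * (\<Sum>k<N. (x k)\<^sup>2)"
      unfolding B_def by (rule opn_sumsq)
    also have "\<dots> \<le> v * (\<Sum>k<N. (x k)\<^sup>2)"
      by (intro mult_right_mono) (cases "c = b"; simp add: v_def le_max_iff_disj sum_nonneg)+
    finally show ?thesis .
  qed
  have finS: "finite (signidx K N m)" by simp
  have finJ: "finite J" by (rule finite_subset[OF J finS])
  have swap: "qidx b l k = qidx (\<not> b) k l" for l k by (simp add: qidx_def)
  have "(\<Sum>T\<in>Pow J. opn (sqidx N) (sqidx N) (decmat b K (maskmean J m T) g) ^ (2 * p)) =
      (\<Sum>T\<in>Pow J. opn (sqidx N) (sqidx N) (signsum J ?H T) ^ (2 * p))"
    by (intro sum.cong refl arg_cong[where f = "\<lambda>x. x ^ (2 * p)"] opn_cong decmat_eq_signsum[OF J])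
  also have "\<dots> \<le> 2 ^ card J * real (card (sqidx N) + card (sqidx N)) * (4 * real p * (real N * v)) ^ p"
  proof (rule sign_opn_moment[OF _ _ finJ _ p])
    fix x :: "nat \<times> nat \<Rightarrow> real"
    have "(\<Sum>a\<in>J. \<Sum>r\<in>sqidx N. (\<Sum>s\<in>sqidx N. ?H a r s * x s)\<^sup>2) \<le>
        (\<Sum>a\<in>signidx K N m. \<Sum>r\<in>sqidx N. (\<Sum>s\<in>sqidx N. ?H a r s * x s)\<^sup>2)"
      by (rule sum_mono2[OF finS J]) (auto intro: sum_nonneg)
    also have "\<dots> \<le> (real N * v) * (\<Sum>s\<in>sqidx N. (x s)\<^sup>2)"
      unfolding sum_signidx by (rule blockco_row[OF bnd m])
    finally show "(\<Sum>a\<in>J. \<Sum>r\<in>sqidx N. (\<Sum>s\<in>sqidx N. ?H a r s * x s)\<^sup>2) \<le> \<dots>" .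
    have "(\<Sum>a\<in>J. \<Sum>s\<in>sqidx N. (\<Sum>r\<in>sqidx N. ?H a r s * x r)\<^sup>2) \<le>
        (\<Sum>a\<in>signidx K N m. \<Sum>s\<in>sqidx N. (\<Sum>r\<in>sqidx N. ?H a r s * x r)\<^sup>2)"
      by (rule sum_mono2[OF finS J]) (auto intro: sum_nonneg)
    also have "\<dots> \<le> (real N * v) * (\<Sum>s\<in>sqidx N. (x s)\<^sup>2)"
      unfolding sum_signidx by (rule blockco_col[OF bnd[of "\<not> b", folded swap] m])
    finally show "(\<Sum>a\<in>J. \<Sum>s\<in>sqidx N. (\<Sum>r\<in>sqidx N. ?H a r s * x r)\<^sup>2) \<le> \<dots>" .
  qed (use v0 in auto)
  also have "\<dots> = 2 ^ card J * (2 * (real N)\<^sup>2) * (4 * real p * real N) ^ p * v ^ p"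
    by (simp add: power_mult_distrib power2_eq_square)
  \<comment> \<open>The maximum is replaced by a sum so that the average over the signs outside
    \<open>J\<close> can later be taken term by term.\<close>
  also have "\<dots> \<le> 2 ^ card J * (2 * (real N)\<^sup>2) * (4 * real p * real N) ^ p *
      (B b ^ (2 * p) + B (\<not> b) ^ (2 * p))"
    by (intro mult_left_mono) (auto simp: v_def max_def power_mult)
  finally show ?thesis by (simp only: B_def)
qed

text \<open>In the stacked matrix each sign occurs in exactly one position, with coefficient 1 /
  sqrt m, and each position receives at most m signs. Hence the coefficients of the bilinear form at
  u and w have square sum at most |u|^2 |w|^2, the variance condition of
  \<open>sign_matrix_moment\<close>.\<close>

lemma mask_moment:
  assumes J: "J \<subseteq> signidx K N m" and m: "m > 0" and q: "K * N + N \<le> q" "p \<le> q" "0 < q"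
  shows "(\<Sum>T\<in>Pow (signidx K N m - J). opn ({..<K} \<times> {..<N}) {..<N}
      (\<lambda>r k. maskmean (- J) m T (fst r, qidx b (snd r) k)) ^ (2 * p)) \<le>
    2 ^ card (signidx K N m - J) * 2 * (3145728 * real q) ^ p"
proof -
  let ?S = "signidx K N m - J" and ?R = "{..<K} \<times> {..<N}"
  define G :: "(nat \<times> nat \<times> nat) \<times> nat \<Rightarrow> nat \<times> nat \<Rightarrow> nat \<Rightarrow> real" where
    "G a r k = (if fst a = (fst r, qidx b (snd r) k) then 1 / sqrt (real m) else 0)" for a r k
  have fin: "finite (signidx K N m)" by simp
  have eq: "maskmean (- J) m T (fst r, qidx b (snd r) k) = signsum ?S G T r k"
    if "r \<in> ?R" "k \<in> {..<N}" for T r k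
  proof -
    define i l where il: "i = fst r" "l = snd r"
    have r: "r = (i, l)" "i < K" "l < N" using that(1) by (simp_all add: il mem_Times_iff)
    define j h where jh_def: "j = fst (qidx b l k)" "h = snd (qidx b l k)"
    have jh: "qidx b l k = (j, h)" "j < N" "h < N"
      using that(2) r(3) by (simp_all add: jh_def qidx_def)
    have "signsum ?S G T r k = (\<Sum>a\<in>signidx K N m. if a \<in> - J then rsign T a * G a r k else 0)"
    proof -
      have S: "{a \<in> signidx K N m. a \<in> - J} = ?S" by auto
      show ?thesis unfolding signsum_def
        using sum.inter_filter[OF fin, of "\<lambda>a. rsign T a * G a r k" "\<lambda>a. a \<in> - J"]
        by (simp only: S)
    qed
    also have "\<dots> = (\<Sum>i'<K. \<Sum>j'<N. \<Sum>k'<N. \<Sum>t<m. if ((i', j', k'), t) \<in> - J then rsign T ((i', j', k'), t) * G ((i', j', k'), t) r k else 0)"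
      by (rule sum_signidx)
    also have "\<dots> = (\<Sum>i'<K. if i' = i then (\<Sum>j'<N. if j' = j then (\<Sum>k'<N. if k' = h then maskmean (- J) m T (i', j', k') else 0) else 0) else 0)"
    proof (intro sum.cong refl)
      fix i'
      have "(\<Sum>t<m. if ((i', j', k'), t) \<in> - J then rsign T ((i', j', k'), t) * G ((i', j', k'), t) r k else 0) =
          (if i' = i \<and> j' = j \<and> k' = h then maskmean (- J) m T (i', j', k') else 0)" for j' k'
      proof (cases "i' = i \<and> j' = j \<and> k' = h")
        case True
        then have "G ((i', j', k'), t) r k = 1 / sqrt (real m)" for t by (simp add: G_def r jh)
        then show ?thesis using True
          unfolding maskmean_def sum_divide_distrib by (auto intro!: sum.cong)
      next
        case False
        then have "G ((i', j', k'), t) r k = 0" for t by (auto simp: G_def r jh)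
        then have "(\<Sum>t<m. if ((i', j', k'), t) \<in> - J then rsign T ((i', j', k'), t) * G ((i', j', k'), t) r k else 0) = 0"
          by (intro sum.neutral ballI) (simp split: if_split)
        then show ?thesis using False by auto
      qed
      note * = this
      show "(\<Sum>j'<N. \<Sum>k'<N. \<Sum>t<m. if ((i', j', k'), t) \<in> - J then rsign T ((i', j', k'), t) * G ((i', j', k'), t) r k else 0) =
          (if i' = i then (\<Sum>j'<N. if j' = j then (\<Sum>k'<N. if k' = h then maskmean (- J) m T (i', j', k') else 0) else 0) else 0)"
      proof (cases "i' = i")
        case True
        show ?thesis unfolding *
          by (simp only: True simp_thms if_True) (rule sum.cong[OF refl], auto)
      next
        case False
        then show ?thesis unfolding * by simp
      qed
    qed
    also have "\<dots> = maskmean (- J) m T (i, j, h)"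
      using r jh by simp
    finally show ?thesis by (simp add: r jh)
  qed
  have "(\<Sum>T\<in>Pow ?S. opn ?R {..<N} (\<lambda>r k. maskmean (- J) m T (fst r, qidx b (snd r) k)) ^ (2 * p)) =
      (\<Sum>T\<in>Pow ?S. opn ?R {..<N} (signsum ?S G T) ^ (2 * p))"
    by (intro sum.cong refl arg_cong[where f = "\<lambda>x. x ^ (2 * p)"] opn_cong eq)
  also have "\<dots> \<le> 2 ^ card ?S * 2 * (3145728 * real q) ^ p"
  proof (rule sign_matrix_moment)
    fix u :: "nat \<times> nat \<Rightarrow> real" and w :: "nat \<Rightarrow> real"
    assume u: "(\<Sum>r\<in>?R. (u r)\<^sup>2) \<le> 1" and w: "(\<Sum>k<N. (w k)\<^sup>2) \<le> 1"
    define form where "form a = (\<Sum>r\<in>?R. u r * (\<Sum>k<N. G a r k * w k))" for a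
    have form: "form ((i, j, h), t) = u (i, fst (qidx b j h)) * w (snd (qidx b j h)) / sqrt (real m)"
      if "i < K" "j < N" "h < N" for i j h t
    proof -
      let ?l = "fst (qidx b j h)" and ?k = "snd (qidx b j h)"
      have lk: "?l < N" "?k < N" using that by (auto simp: qidx_def)
      have "form ((i, j, h), t) = (\<Sum>i'<K. \<Sum>l<N. u (i', l) * (\<Sum>k<N. G ((i, j, h), t) (i', l) k * w k))"
        by (simp add: form_def sum.cartesian_product case_prod_unfold)
      also have "\<dots> = (\<Sum>i'<K. if i' = i then (\<Sum>l<N. if l = ?l then u (i', l) * (\<Sum>k<N. if k = ?k then w k / sqrt (real m) else 0) else 0) else 0)"
      proof (intro sum.cong refl)
        fix i'
        have "(\<Sum>k<N. G ((i, j, h), t) (i', l) k * w k) =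
            (if i' = i \<and> l = ?l then (\<Sum>k<N. if k = ?k then w k / sqrt (real m) else 0) else 0)" for l
        proof -
          have "G ((i, j, h), t) (i', l) k * w k =
              (if i' = i \<and> l = ?l \<and> k = ?k then w k / sqrt (real m) else 0)" for k
            by (auto simp: G_def qidx_def)
          note * = this
          show ?thesis
          proof (cases "i' = i \<and> l = ?l")
            case True
            show ?thesis unfolding * by (simp only: True simp_thms if_True)
          next
            case False
            then have "(if i' = i \<and> l = ?l \<and> k = ?k then w k / sqrt (real m) else 0) = 0" for k by auto
            then show ?thesis unfolding * using False by (simp only: if_False sum.neutral_const)
          qed
        qed
        note * = this
        show "(\<Sum>l<N. u (i', l) * (\<Sum>k<N. G ((i, j, h), t) (i', l) k * w k)) =
            (if i' = i then (\<Sum>l<N. if l = ?l then u (i', l) * (\<Sum>k<N. if k = ?k then w k / sqrt (real m) else 0) else 0) else 0)"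
        proof (cases "i' = i")
          case True
          show ?thesis unfolding *
            by (simp only: True simp_thms if_True) (rule sum.cong[OF refl], auto)
        next
          case False
          then show ?thesis unfolding * by simp
        qed
      qed
      also have "\<dots> = u (i, ?l) * w ?k / sqrt (real m)"
        using that lk by simp
      finally show ?thesis .
    qed
    have "(\<Sum>a\<in>?S. (form a)\<^sup>2) \<le> (\<Sum>a\<in>signidx K N m. (form a)\<^sup>2)"
      by (rule sum_mono2[OF fin]) auto
    also have "\<dots> = (\<Sum>i<K. \<Sum>j<N. \<Sum>h<N. (u (i, fst (qidx b j h)))\<^sup>2 * (w (snd (qidx b j h)))\<^sup>2)"
      unfolding sum_signidx using m by (intro sum.cong refl) (simp add: form power_divide power_mult_distrib)
    also have "\<dots> = (\<Sum>i<K. \<Sum>l<N. \<Sum>k<N. (u (i, l))\<^sup>2 * (w k)\<^sup>2)"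
    proof (cases b)
      case True
      have "(\<Sum>j<N. \<Sum>h<N. (u (i, h))\<^sup>2 * (w j)\<^sup>2) = (\<Sum>l<N. \<Sum>k<N. (u (i, l))\<^sup>2 * (w k)\<^sup>2)" for i
        by (rule sum.swap)
      then show ?thesis using True by (simp add: qidx_def)
    qed (simp add: qidx_def)
    also have "\<dots> = (\<Sum>r\<in>?R. (u r)\<^sup>2) * (\<Sum>k<N. (w k)\<^sup>2)"
      by (simp add: sum_distrib_left[symmetric] sum_distrib_right[symmetric] sum.cartesian_product case_prod_unfold)
    also have "\<dots> \<le> 1"
      using u w by (intro mult_le_one sum_nonneg) auto
    finally show "(\<Sum>a\<in>?S. (\<Sum>r\<in>?R. u r * (\<Sum>k<N. G a r k * w k))\<^sup>2) \<le> 1"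
      unfolding form_def .
  qed (use q in auto)
  finally show ?thesis .
qed

text \<open>The signs in \<open>J\<close> and those outside are independent, so the conditional
  bound is summed over the outer signs. The constants combine as 4 * 3145728 = 12582912, and the two
  stackings double the prefactor.\<close>

lemma decmat_moment:
  assumes J: "J \<subseteq> signidx K N m" and m: "m > 0" and p: "p > 0" and q: "K * N + N \<le> q" "p \<le> q"
  shows "(\<Sum>T\<in>Pow (signidx K N m). opn (sqidx N) (sqidx N) (decmat b K (maskmean J m T) (maskmean (- J) m T)) ^ (2 * p)) \<le>
    2 ^ card (signidx K N m) * (8 * (real N)\<^sup>2) * (12582912 * real p * real q * real N) ^ p"
proof -
  let ?S = "signidx K N m"
  have fin: "finite ?S" by simp
  have q0: "q > 0" using p q by simp
  define B where "B c T = opn ({..<K} \<times> {..<N}) {..<N} (\<lambda>r k. maskmean (- J) m T (fst r, qidx c (snd r) k))" for c T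
  define A where "A = 2 ^ card J * (2 * (real N)\<^sup>2) * (4 * real p * real N) ^ p"
  have A0: "0 \<le> A" by (simp add: A_def)
  have sm1: "maskmean J m (T1 \<union> T2) = maskmean J m T1" if "T2 \<subseteq> ?S - J" for T1 T2
    using that by (intro ext maskmean_cong) auto
  have sm2: "maskmean (- J) m (T1 \<union> T2) = maskmean (- J) m T2" if "T1 \<subseteq> J" for T1 T2
    using that by (intro ext maskmean_cong) auto
  have cards: "card J + card (?S - J) = card ?S"
    using card_Diff_subset[OF finite_subset[OF J fin] J] card_mono[OF fin J] by simp
  have "(\<Sum>T\<in>Pow ?S. opn (sqidx N) (sqidx N) (decmat b K (maskmean J m T) (maskmean (- J) m T)) ^ (2 * p)) =
      (\<Sum>T2\<in>Pow (?S - J). \<Sum>T1\<in>Pow J. opn (sqidx N) (sqidx N) (decmat b K (maskmean J m (T1 \<union> T2)) (maskmean (- J) m (T1 \<union> T2))) ^ (2 * p))"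
    by (rule sum_Pow_split[OF J])
  also have "\<dots> = (\<Sum>T2\<in>Pow (?S - J). \<Sum>T1\<in>Pow J. opn (sqidx N) (sqidx N) (decmat b K (maskmean J m T1) (maskmean (- J) m T2)) ^ (2 * p))"
    by (intro sum.cong refl) (simp add: sm1 sm2)
  also have "\<dots> \<le> (\<Sum>T2\<in>Pow (?S - J). A * (B b T2 ^ (2 * p) + B (\<not> b) T2 ^ (2 * p)))"
    unfolding A_def B_def by (intro sum_mono decmat_moment_fixed J m p)
  also have "\<dots> = A * ((\<Sum>T2\<in>Pow (?S - J). B b T2 ^ (2 * p)) + (\<Sum>T2\<in>Pow (?S - J). B (\<not> b) T2 ^ (2 * p)))"
    by (simp add: sum_distrib_left[symmetric] sum.distrib)
  also have "\<dots> \<le> A * (2 ^ card (?S - J) * 2 * (3145728 * real q) ^ p + 2 ^ card (?S - J) * 2 * (3145728 * real q) ^ p)"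
    unfolding B_def by (intro mult_left_mono[OF _ A0] add_mono mask_moment J m q q0)
  also have "\<dots> = (2 ^ card J * 2 ^ card (?S - J)) * (8 * (real N)\<^sup>2) * ((4 * real p * real N) ^ p * (3145728 * real q) ^ p)"
    by (simp add: A_def)
  also have "2 ^ card J * 2 ^ card (?S - J) = (2 ^ card ?S :: real)"
    by (simp only: power_add[symmetric] cards)
  also have "(4 * real p * real N) ^ p * (3145728 * real q) ^ p = (12582912 * real p * real q * real N) ^ p"
    by (subst power_mult_distrib[symmetric]) (simp add: mult_ac)
  finally show ?thesis .
qed

text \<open>The decoupled bound is the same for all masks, so it persists after averaging over them;
  201326592 = 16 * 12582912.\<close>

theorem coupled_moment:
  assumes m: "m > 0" and p: "p > 0" and q: "K * N + N \<le> q" "p \<le> q"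
  shows "(\<Sum>T\<in>Pow (signidx K N m). opn (sqidx N) (sqidx N) (cenmat b K (maskmean UNIV m T)) ^ (2 * p)) \<le>
    2 ^ card (signidx K N m) * (8 * (real N)\<^sup>2) * (201326592 * real p * real q * real N) ^ p"
proof -
  let ?S = "signidx K N m" and ?W = "12582912 * real p * real q * real N"
  let ?d = "\<lambda>J T. opn (sqidx N) (sqidx N) (decmat b K (maskmean J m T) (maskmean (- J) m T)) ^ (2 * p)"
  have "(\<Sum>T\<in>Pow ?S. opn (sqidx N) (sqidx N) (cenmat b K (maskmean UNIV m T)) ^ (2 * p)) \<le>
      (\<Sum>T\<in>Pow ?S. 16 ^ p * (\<Sum>J\<in>Pow ?S. ?d J T) / 2 ^ card ?S)"
    by (intro sum_mono opn_cenmat_power_le m)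
  also have "\<dots> = 16 ^ p * (\<Sum>T\<in>Pow ?S. \<Sum>J\<in>Pow ?S. ?d J T) / 2 ^ card ?S"
    by (simp only: sum_divide_distrib[symmetric] sum_distrib_left[symmetric])
  also have "(\<Sum>T\<in>Pow ?S. \<Sum>J\<in>Pow ?S. ?d J T) = (\<Sum>J\<in>Pow ?S. \<Sum>T\<in>Pow ?S. ?d J T)"
    by (rule sum.swap)
  also have "16 ^ p * \<dots> / 2 ^ card ?S \<le> 16 ^ p * (\<Sum>J\<in>Pow ?S. 2 ^ card ?S * (8 * (real N)\<^sup>2) * ?W ^ p) / 2 ^ card ?S"
    by (intro divide_right_mono mult_left_mono sum_mono decmat_moment m p q) auto
  also have "\<dots> = 2 ^ card ?S * (8 * (real N)\<^sup>2) * (16 ^ p * ?W ^ p)"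
    by (simp add: card_Pow)
  also have "16 ^ p * ?W ^ p = (201326592 * real p * real q * real N) ^ p"
    by (subst power_mult_distrib[symmetric]) (simp add: mult_ac)
  finally show ?thesis .
qed

section \<open>Choice of the moment orders and the tail for sign entries\<close>

theorem cenmat_tail_count:
  fixes c d n m :: nat
  assumes n: "n \<ge> 2" and c: "c \<ge> 1" and d: "d \<ge> 1" and m: "m > 0"
  defines "K \<equiv> n ^ c" and "N \<equiv> n ^ d"
  defines "B \<equiv> 2600000 * sqrt (real d) * real n powr ((2 * real d + real c) / 2) * sqrt (ln (real n))"
  shows "real (card {T \<in> Pow (signidx K N m). B < opn (sqidx N) (sqidx N) (cenmat b K (maskmean UNIV m T))})
    \<le> 8 * real n powr (-100) * 2 ^ card (signidx K N m)"
proof -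
  let ?S = "signidx K N m"
  let ?o = "\<lambda>T. opn (sqidx N) (sqidx N) (cenmat b K (maskmean UNIV m T))"
  define L where "L = ln (real N)"
  have n1: "n \<le> N" unfolding N_def using n d self_le_power[of n d] by simp
  have N2: "2 \<le> N" using n n1 by simp
  have K1: "1 \<le> K" unfolding K_def using n by simp
  have L_eq: "L = real d * ln (real n)" using n by (simp add: L_def N_def ln_realpow)
  have L_half: "1 / 2 \<le> L"
  proof -
    have "1 / 2 \<le> ln (2::real)" using ln2_ge_two_thirds by simp
    also have "\<dots> \<le> L" unfolding L_def using N2 by (subst ln_le_cancel_iff) auto
    finally show ?thesis .
  qed
  have L_le: "L \<le> real N" unfolding L_def using N2 ln_le_minus_one[of "real N"] by simp
  \<comment> \<open>\<open>N\<^sup>2 exp (- p) \<le> N powr (-100)\<close> needs \<open>p \<ge> 102 ln N\<close>.\<close>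
  define p where "p = nat \<lceil>102 * L\<rceil>"
  have p_ge: "102 * L \<le> real p" using L_half by (simp add: p_def)
  have "real p \<le> 102 * L + 1" using L_half unfolding p_def by (simp add: of_nat_nat)
  \<comment> \<open>The rounding error 1 is at most 2 L because L \<ge> 1/2.\<close>
  then have p_le: "real p \<le> 104 * L" using L_half by linarith
  have "0 < real p" using p_ge L_half by linarith
  then have p0: "p > 0" by simp
  \<comment> \<open>\<open>q\<close> must dominate both the dimension K N + N of the stacked
    matrices and \<open>p\<close>. As p \<le> 104 ln N \<le> 104 N, the factor 104 suffices for
    both.\<close>
  define q where "q = 104 * (N * K)"
  have q_ge: "K * N + N \<le> q"
    using K1 by (simp add: q_def) 
  have "real p \<le> real q"
  proof -
    have "real p \<le> 104 * real N" using p_le L_le by linarith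
    also have "\<dots> = 104 * (real N * 1)" by simp
    also have "\<dots> \<le> 104 * (real N * real K)" using K1 by (intro mult_left_mono) auto
    finally show ?thesis by (simp add: q_def)
  qed
  then have pq: "p \<le> q" by simp
  have B2: "B\<^sup>2 = 6760000000000 * (real N)\<^sup>2 * real K * L"
  proof -
    have "(real n powr ((2 * real d + real c) / 2))\<^sup>2 = real n powr (real (2 * d + c))"
      using n by (simp add: power2_eq_square powr_add[symmetric])
    also have "\<dots> = (real N)\<^sup>2 * real K"
      using n by (subst powr_realpow) (simp_all add: N_def K_def power_add power_mult[symmetric] mult.commute)
    finally show ?thesis
      unfolding B_def using n by (simp add: power_mult_distrib L_eq)
  qed
  define W where "W = 201326592 * real p * real q * real N"
  have W0: "0 \<le> W" by (simp add: W_def)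
  \<comment> \<open>The constant 2600000 originates here: its square exceeds 3 * 201326592 * 104 *
    104, the second 104 coming from \<open>q\<close>.\<close>
  have W_le: "W \<le> B\<^sup>2 / 3"
  proof -
    have "W \<le> 201326592 * (104 * L) * real q * real N"
      unfolding W_def by (intro mult_right_mono mult_left_mono p_le) auto
    also have "\<dots> = 2177548419072 * ((real N)\<^sup>2 * real K * L)"
      by (simp add: q_def power2_eq_square)
    also have "\<dots> \<le> (6760000000000 / 3) * ((real N)\<^sup>2 * real K * L)"
      using L_half by (intro mult_right_mono) auto
    finally show ?thesis by (simp add: B2)
  qed
  have B0: "B > 0" unfolding B_def using n d by simp
  have "real (card {T \<in> Pow ?S. B < ?o T}) * (B\<^sup>2) ^ p = (\<Sum>T\<in>{T \<in> Pow ?S. B < ?o T}. B ^ (2 * p))"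
    by (simp add: power_mult)
  also have "\<dots> \<le> (\<Sum>T\<in>{T \<in> Pow ?S. B < ?o T}. ?o T ^ (2 * p))"
    using B0 by (intro sum_mono power_mono) auto
  also have "\<dots> \<le> (\<Sum>T\<in>Pow ?S. ?o T ^ (2 * p))"
    by (rule sum_mono2) (auto simp: opn_nonneg)
  also have "\<dots> \<le> 2 ^ card ?S * (8 * (real N)\<^sup>2) * W ^ p"
    unfolding W_def by (rule coupled_moment[OF m p0 q_ge pq])
  also have "\<dots> \<le> 2 ^ card ?S * (8 * (real N)\<^sup>2) * (B\<^sup>2 / 3) ^ p"
    by (intro mult_left_mono power_mono W_le W0) auto
  also have "\<dots> = (2 ^ card ?S * (8 * (real N)\<^sup>2) * (1 / 3) ^ p) * (B\<^sup>2) ^ p"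
    by (simp add: power_divide)
  finally have *: "real (card {T \<in> Pow ?S. B < ?o T}) \<le> 2 ^ card ?S * (8 * (real N)\<^sup>2) * (1 / 3) ^ p"
    by (rule mult_right_le_imp_le) (use B0 in simp)
  \<comment> \<open>Since 3 > e, a loss of 1/3 per moment order yields exp (-p); of the exponent
    102, two units pay for the dimension factor N^2.\<close>
  have third: "(1 / 3 :: real) ^ p \<le> real N powr (-102)"
  proof -
    have "(1 / 3 :: real) \<le> exp (- 1)" using exp_le by (simp add: exp_minus field_simps)
    then have "(1 / 3 :: real) ^ p \<le> exp (- 1) ^ p" by (intro power_mono) auto
    also have "\<dots> = exp (- real p)" by (simp add: exp_of_nat_mult[symmetric])
    also have "\<dots> \<le> exp (- (102 * L))" using p_ge by simp
    also have "\<dots> = real N powr (-102)" using N2 by (simp add: powr_def L_def)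
    finally show ?thesis .
  qed
  have "(real N)\<^sup>2 = real N powr 2" using N2 by simp
  then have "(real N)\<^sup>2 * real N powr (-102) = real N powr (2 + -102)"
    by (simp only: powr_add)
  also have "(2 + -102 :: real) = -100" by simp
  also have "real N powr (-100) \<le> real n powr (-100)"
    using n n1 by (intro powr_mono2') auto
  finally have NN: "(real N)\<^sup>2 * real N powr (-102) \<le> real n powr (-100)" .
  have "2 ^ card ?S * (8 * (real N)\<^sup>2) * (1 / 3) ^ p \<le> 2 ^ card ?S * (8 * (real N)\<^sup>2) * real N powr (-102)"
    by (intro mult_left_mono third) auto
  also have "\<dots> = 2 ^ card ?S * 8 * ((real N)\<^sup>2 * real N powr (-102))" by simp
  also have "\<dots> \<le> 2 ^ card ?S * 8 * real n powr (-100)"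
    by (intro mult_left_mono NN) auto
  finally have "2 ^ card ?S * (8 * (real N)\<^sup>2) * (1 / 3) ^ p \<le> 2 ^ card ?S * 8 * real n powr (-100)" .
  from order_trans[OF * this] show ?thesis by (simp only: mult_ac)
qed

text \<open>The left side is the characteristic function of a normalised sum of signs, so this is
  the central limit theorem in the form required by Levy's continuity theorem.\<close>

lemma cos_power_limit:
  "(\<lambda>m. cos (t / sqrt (real (Suc m))) ^ Suc m) \<longlonglongrightarrow> exp (- (t\<^sup>2) / 2)"
proof -
  have "(\<lambda>m. cos (t / sqrt (real m)) ^ m) \<longlonglongrightarrow> exp (- (t * t / 2))"
    by real_asymp
  then show ?thesis unfolding power2_eq_square minus_divide_left by (rule LIMSEQ_Suc)
qed

section \<open>Measurability and semicontinuity\<close>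

text \<open>A supremum over uncountably many vectors becomes a countable family of conditions, for
  measurability. The inequality is homogeneous because rational approximations of a vector in the
  unit ball may leave the ball.\<close>

lemma opn_le_iff_Rats:
  assumes fin: "finite I" "finite J" and B: "0 \<le> B"
  shows "opn I J M \<le> B \<longleftrightarrow>
    (\<forall>x \<in> J \<rightarrow>\<^sub>E \<rat>. (\<Sum>r\<in>I. (\<Sum>s\<in>J. M r s * x s)\<^sup>2) \<le> B\<^sup>2 * (\<Sum>s\<in>J. (x s)\<^sup>2))"
proof (intro iffI ballI)
  fix x assume "opn I J M \<le> B"
  then have "(opn I J M)\<^sup>2 \<le> B\<^sup>2" by (intro power_mono opn_nonneg)
  then have "(opn I J M)\<^sup>2 * (\<Sum>s\<in>J. (x s)\<^sup>2) \<le> B\<^sup>2 * (\<Sum>s\<in>J. (x s)\<^sup>2)"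
    by (intro mult_right_mono sum_nonneg) auto
  then show "(\<Sum>r\<in>I. (\<Sum>s\<in>J. M r s * x s)\<^sup>2) \<le> B\<^sup>2 * (\<Sum>s\<in>J. (x s)\<^sup>2)"
    by (rule order_trans[OF opn_sumsq])
next
  assume *: "\<forall>x \<in> J \<rightarrow>\<^sub>E \<rat>. (\<Sum>r\<in>I. (\<Sum>s\<in>J. M r s * x s)\<^sup>2) \<le> B\<^sup>2 * (\<Sum>s\<in>J. (x s)\<^sup>2)"
  show "opn I J M \<le> B"
  proof (rule opn_least)
    fix x :: "'b \<Rightarrow> real" assume x: "L2_set x J \<le> 1"
    define y :: "nat \<Rightarrow> 'b \<Rightarrow> real" where
      "y k s = real_of_int \<lfloor>real (Suc k) * x s\<rfloor> / real (Suc k)" for k s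
    have lim: "(\<lambda>k. y k s) \<longlonglongrightarrow> x s" for s
    proof -
      have "norm (y k s - x s) \<le> inverse (real (Suc k))" for k
      proof -
        have "y k s - x s = (real_of_int \<lfloor>real (Suc k) * x s\<rfloor> - real (Suc k) * x s) / real (Suc k)"
          unfolding y_def by (simp add: diff_divide_distrib del: of_nat_Suc)
        moreover have "\<bar>real_of_int \<lfloor>real (Suc k) * x s\<rfloor> - real (Suc k) * x s\<bar> \<le> 1"
          using floor_correct[of "real (Suc k) * x s"] by linarith
        ultimately show ?thesis
          by (simp add: divide_inverse abs_mult mult_left_le_one_le del: of_nat_Suc)
      qed
      then have "(\<lambda>k. y k s - x s) \<longlonglongrightarrow> 0"
        by (intro Lim_null_comparison[OF always_eventually LIMSEQ_inverse_real_of_nat]) auto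
      then show ?thesis by (simp add: LIM_zero_iff)
    qed
    have le: "(\<Sum>r\<in>I. (\<Sum>s\<in>J. M r s * y k s)\<^sup>2) \<le> B\<^sup>2 * (\<Sum>s\<in>J. (y k s)\<^sup>2)" for k
    proof -
      have "restrict (y k) J \<in> J \<rightarrow>\<^sub>E \<rat>"
        unfolding y_def by (intro restrict_PiE_iff[THEN iffD2] ballI Rats_divide Rats_of_int Rats_of_nat)
      from bspec[OF * this] show ?thesis by (simp cong: sum.cong)
    qed
    have l1: "(\<lambda>k. \<Sum>r\<in>I. (\<Sum>s\<in>J. M r s * y k s)\<^sup>2) \<longlonglongrightarrow> (\<Sum>r\<in>I. (\<Sum>s\<in>J. M r s * x s)\<^sup>2)"
      by (intro tendsto_intros lim)
    have l2: "(\<lambda>k. B\<^sup>2 * (\<Sum>s\<in>J. (y k s)\<^sup>2)) \<longlonglongrightarrow> B\<^sup>2 * (\<Sum>s\<in>J. (x s)\<^sup>2)"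
      by (intro tendsto_intros lim)
    have "(\<Sum>r\<in>I. (\<Sum>s\<in>J. M r s * x s)\<^sup>2) \<le> B\<^sup>2 * (\<Sum>s\<in>J. (x s)\<^sup>2)"
      by (rule LIMSEQ_le[OF l1 l2]) (use le in blast)
    also have "\<dots> \<le> B\<^sup>2"
      using x by (intro mult_left_le) (simp_all only: L2_set_le_1_iff zero_le_power2)
    finally show "L2_set (\<lambda>r. \<Sum>s\<in>J. M r s * x s) I \<le> B"
      unfolding L2_set_def using B by (intro real_le_lsqrt) (auto intro: sum_nonneg)
  qed
qed

text \<open>A single vector witnessing the strict inequality for the limit also witnesses it for all
  late terms.\<close>

lemma opn_lsc:
  assumes lim: "\<And>r s. r \<in> I \<Longrightarrow> s \<in> J \<Longrightarrow> (\<lambda>k. M k r s) \<longlonglongrightarrow> L r s" and B: "B < opn I J L"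
  shows "eventually (\<lambda>k. B < opn I J (M k)) sequentially"
proof -
  obtain x where x: "L2_set x J \<le> 1" "B < L2_set (\<lambda>r. \<Sum>s\<in>J. L r s * x s) I"
    using opn_least[of J L I B] B by (meson not_less)
  have "(\<lambda>k. L2_set (\<lambda>r. \<Sum>s\<in>J. M k r s * x s) I) \<longlonglongrightarrow> L2_set (\<lambda>r. \<Sum>s\<in>J. L r s * x s) I"
    unfolding L2_set_def by (intro tendsto_intros lim)
  then have "eventually (\<lambda>k. B < L2_set (\<lambda>r. \<Sum>s\<in>J. M k r s * x s) I) sequentially"
    using x(2) by (rule order_tendstoD)
  then show ?thesis
    by (rule eventually_mono) (use opn_unit[OF x(1)] in \<open>auto intro: less_le_trans\<close>)
qed

definition exceeds :: "bool \<Rightarrow> nat \<Rightarrow> nat \<Rightarrow> real \<Rightarrow> (nat \<times> nat \<times> nat \<Rightarrow> real) \<Rightarrow> bool" where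
  "exceeds b K N B f \<longleftrightarrow> B < opn (sqidx N) (sqidx N) (cenmat b K f)"

text \<open>Points of the product space are \<open>undefined\<close> outside
  \<open>entries K N\<close>, while \<open>maskmean\<close> is total; this lemma allows passing from
  one to the other.\<close>

lemma exceeds_cong:
  assumes "\<And>e. e \<in> entries K N \<Longrightarrow> f e = g e"
  shows "exceeds b K N B f = exceeds b K N B g"
proof -
  have "opn (sqidx N) (sqidx N) (cenmat b K f) = opn (sqidx N) (sqidx N) (cenmat b K g)"
  proof (rule opn_cong)
    fix r s assume "r \<in> sqidx N" "s \<in> sqidx N"
    then have "f (i, fst r, fst s) = g (i, fst r, fst s)"
      "f (i, qidx b (snd r) (snd s)) = g (i, qidx b (snd r) (snd s))" if "i < K" for i
      using that by (auto intro!: assms simp: qidx_def)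
    then show "cenmat b K f r s = cenmat b K g r s" by (simp add: cenmat_def)
  qed
  then show ?thesis by (simp add: exceeds_def)
qed

lemma pred_exceeds:
  assumes B: "0 \<le> B" and D: "sets D = sets (borel :: real measure)"
  shows "Measurable.pred (PiM (entries K N) (\<lambda>_. D)) (exceeds b K N B)"
proof -
  have comp: "(\<lambda>\<omega>. \<omega> e) \<in> borel_measurable (PiM (entries K N) (\<lambda>_. D))" if "e \<in> entries K N" for e
    using measurable_component_singleton[OF that, of "\<lambda>_. D"] measurable_cong_sets[OF refl D] by blast
  have cm: "(\<lambda>\<omega>. cenmat b K \<omega> r s) \<in> borel_measurable (PiM (entries K N) (\<lambda>_. D))" if "r \<in> sqidx N" "s \<in> sqidx N" for r s
    unfolding cenmat_def using that
    by (intro borel_measurable_sum borel_measurable_diff borel_measurable_times comp borel_measurable_const)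
      (auto simp: qidx_def)
  have cnt: "countable (sqidx N \<rightarrow>\<^sub>E (\<rat> :: real set))"
    by (intro countable_PiE countable_rat) auto
  have le: "Measurable.pred (PiM (entries K N) (\<lambda>_. D)) (\<lambda>\<omega>.
      (\<Sum>r\<in>sqidx N. (\<Sum>s\<in>sqidx N. cenmat b K \<omega> r s * x s)\<^sup>2) \<le> B\<^sup>2 * (\<Sum>s\<in>sqidx N. (x s)\<^sup>2))" for x
  proof -
    have [measurable]: "(\<lambda>\<omega>. \<Sum>r\<in>sqidx N. (\<Sum>s\<in>sqidx N. cenmat b K \<omega> r s * x s)\<^sup>2)
        \<in> borel_measurable (PiM (entries K N) (\<lambda>_. D))"
      by (intro borel_measurable_sum borel_measurable_power borel_measurable_times cm borel_measurable_const)
    show ?thesis by measurable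
  qed
  have "exceeds b K N B = (\<lambda>\<omega>. \<not> (\<forall>x \<in> sqidx N \<rightarrow>\<^sub>E \<rat>.
      (\<Sum>r\<in>sqidx N. (\<Sum>s\<in>sqidx N. cenmat b K \<omega> r s * x s)\<^sup>2) \<le> B\<^sup>2 * (\<Sum>s\<in>sqidx N. (x s)\<^sup>2)))"
    using opn_le_iff_Rats[of "sqidx N" "sqidx N" B] B by (intro ext) (simp add: exceeds_def not_le[symmetric])
  also have "Measurable.pred (PiM (entries K N) (\<lambda>_. D)) \<dots>"
    unfolding pred_def
    by (intro sets.sets_Collect_neg sets.sets_Collect_countable_All' cnt le[unfolded pred_def])
  finally show ?thesis .
qed

section \<open>From signs to the Gaussian law\<close>

text \<open>\<open>radmean 1\<close> is the Rademacher law, and \<open>radmean m\<close> tends to the Gaussian law as \<open>m\<close> grows.\<close>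

definition radmean :: "nat \<Rightarrow> real measure" where
  "radmean m = distr (measure_pmf (pmf_of_set (Pow {..<m}))) borel (\<lambda>\<tau>. (\<Sum>t<m. rsign \<tau> t) / sqrt (real m))"

lemma sets_radmean [simp, measurable_cong]: "sets (radmean m) = sets borel"
  by (simp add: radmean_def)

lemma real_distribution_radmean: "real_distribution (radmean m)"
  unfolding radmean_def by (intro prob_space.real_distribution_distr[OF measure_pmf.prob_space_axioms]) simp

lemma prob_space_radmean: "prob_space (radmean m)"
  using real_distribution_radmean by (simp add: real_distribution_def)

text \<open>Independence of the signs in finite form: a sum over sign vectors of a product
  factorises. It is used for characteristic functions.\<close>

lemma sum_Pow_prod_rsign:
  fixes f :: "real \<Rightarrow> 'b :: comm_semiring_1"
  assumes "finite S"
  shows "(\<Sum>T\<in>Pow S. \<Prod>k\<in>S. f (rsign T k)) = (f 1 + f (-1)) ^ card S"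
  using assms
proof (induction S)
  case (insert a S)
  have inj: "inj_on (insert a) (Pow S)" using insert.hyps by (auto simp: inj_on_def)
  have disj: "Pow S \<inter> insert a ` Pow S = {}" using insert.hyps by auto
  have 1: "(\<Prod>k\<in>insert a S. f (rsign T k)) = f (-1) * (\<Prod>k\<in>S. f (rsign T k))" if "T \<in> Pow S" for T
    using insert.hyps that by (auto simp: rsign_def)
  have 2: "(\<Prod>k\<in>insert a S. f (rsign (insert a T) k)) = f 1 * (\<Prod>k\<in>S. f (rsign T k))" for T
    using insert.hyps by (auto simp: rsign_def intro!: arg_cong2[of _ _ _ _ "(*)"] prod.cong)
  have "(\<Sum>T\<in>Pow (insert a S). \<Prod>k\<in>insert a S. f (rsign T k)) =
      (\<Sum>T\<in>Pow S. \<Prod>k\<in>insert a S. f (rsign T k)) + (\<Sum>T\<in>Pow S. \<Prod>k\<in>insert a S. f (rsign (insert a T) k))"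
    unfolding Pow_insert using insert.hyps disj
    by (subst sum.union_disjoint) (auto simp: sum.reindex[OF inj])
  also have "\<dots> = (\<Sum>T\<in>Pow S. f (-1) * (\<Prod>k\<in>S. f (rsign T k))) + (\<Sum>T\<in>Pow S. f 1 * (\<Prod>k\<in>S. f (rsign T k)))"
    by (intro arg_cong2[of _ _ _ _ "(+)"] sum.cong refl 1 2)
  finally show ?case
    using insert by (simp add: sum_distrib_left[symmetric] algebra_simps)
qed (simp add: rsign_def)

lemma char_radmean: "char (radmean m) t = complex_of_real (cos (t / sqrt (real m)) ^ m)"
proof -
  let ?y = "\<lambda>\<tau>. (\<Sum>t<m. rsign \<tau> t) / sqrt (real m)"
  let ?e = "\<lambda>s. iexp (t / sqrt (real m) * s)"
  have fin: "finite (Pow {..<m})" "Pow {..<m} \<noteq> {}" by auto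
  have "char (radmean m) t = (CLINT \<tau>|measure_pmf (pmf_of_set (Pow {..<m})). iexp (t * ?y \<tau>))"
    unfolding char_def radmean_def by (subst integral_distr) auto
  also have "\<dots> = (\<Sum>\<tau>\<in>Pow {..<m}. pmf (pmf_of_set (Pow {..<m})) \<tau> *\<^sub>R iexp (t * ?y \<tau>))"
    using fin by (intro integral_measure_pmf) auto
  also have "\<dots> = (\<Sum>\<tau>\<in>Pow {..<m}. iexp (t * ?y \<tau>)) / 2 ^ m"
    unfolding sum_divide_distrib using fin
    by (intro sum.cong refl) (simp add: card_Pow scaleR_conv_of_real)
  also have "(\<Sum>\<tau>\<in>Pow {..<m}. iexp (t * ?y \<tau>)) = (\<Sum>\<tau>\<in>Pow {..<m}. \<Prod>k<m. ?e (rsign \<tau> k))"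
  proof (intro sum.cong refl)
    fix \<tau>
    have "\<i> * complex_of_real (t * ?y \<tau>) = (\<Sum>k<m. \<i> * complex_of_real (t / sqrt (real m) * rsign \<tau> k))"
      by (simp add: sum_distrib_left sum_divide_distrib)
    then show "iexp (t * ?y \<tau>) = (\<Prod>k<m. ?e (rsign \<tau> k))"
      by (simp only: exp_sum[OF finite_lessThan])
  qed
  also have "\<dots> = (?e 1 + ?e (-1)) ^ m"
    using sum_Pow_prod_rsign[of "{..<m}" ?e] by simp
  also have "?e 1 + ?e (-1) = 2 * complex_of_real (cos (t / sqrt (real m)))"
    by (simp add: complex_eq_iff Re_exp Im_exp)
  finally show ?thesis by (simp add: power_mult_distrib)
qed

lemma weak_conv_radmean: "weak_conv_m (\<lambda>m. radmean (Suc m)) gaussian_measure"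
  unfolding gaussian_measure_def
proof (rule levy_continuity)
  fix t
  have "(\<lambda>m. complex_of_real (cos (t / sqrt (real (Suc m))) ^ Suc m)) \<longlonglongrightarrow> complex_of_real (exp (- (t\<^sup>2) / 2))"
    by (intro tendsto_of_real cos_power_limit)
  then show "(\<lambda>m. char (radmean (Suc m)) t) \<longlonglongrightarrow> char std_normal_distribution t"
    by (simp only: char_radmean char_std_normal_distribution)
qed (simp_all add: real_distribution_radmean real_dist_normal_dist)

lemma radmean_1: "radmean 1 = rademacher_measure"
proof -
  have "pmf_of_set {-1, 1::real} = map_pmf (\<lambda>\<tau>. rsign \<tau> 0) (pmf_of_set (Pow {..<1::nat}))"
  proof -
    have P: "Pow {..<1::nat} = {{}, {0}}" by (auto simp: lessThan_Suc)
    have "inj_on (\<lambda>\<tau>. rsign \<tau> (0::nat)) (Pow {..<1::nat})" unfolding P by (auto simp: inj_on_def rsign_def)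
    then have "map_pmf (\<lambda>\<tau>. rsign \<tau> 0) (pmf_of_set (Pow {..<1::nat})) = pmf_of_set ((\<lambda>\<tau>. rsign \<tau> 0) ` Pow {..<1::nat})"
      by (intro map_pmf_of_set_inj) auto
    also have "(\<lambda>\<tau>. rsign \<tau> 0) ` Pow {..<1::nat} = {-1, 1}" unfolding P by (auto simp: rsign_def)
    finally show ?thesis ..
  qed
  then show ?thesis
    by (simp add: rademacher_measure_def radmean_def map_pmf_rep_eq distr_distr comp_def)
qed

text \<open>This turns probability into counting. The product law is realised on independent uniform
  subsets of \<open>{..<m}\<close>, one for each entry, and \<Phi> merges such a family into one
  sign set over pairs.\<close>

lemma prob_exceeds_radmean:
  assumes KN: "K > 0" "N > 0" and B: "0 \<le> B"
  shows "measure (PiM (entries K N) (\<lambda>_. radmean m)) {\<omega> \<in> space (PiM (entries K N) (\<lambda>_. radmean m)). exceeds b K N B \<omega>} =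
    real (card {T \<in> Pow (signidx K N m). B < opn (sqidx N) (sqidx N) (cenmat b K (maskmean UNIV m T))}) / 2 ^ card (signidx K N m)"
proof -
  let ?S = "entries K N"
  let ?y = "\<lambda>\<tau>. (\<Sum>t<m. rsign \<tau> t) / sqrt (real m)"
  let ?P = "PiM ?S (\<lambda>_. radmean m)"
  define V where "V = Pi_pmf ?S {} (\<lambda>_. pmf_of_set (Pow {..<m}))"
  define \<Phi> where "\<Phi> x = {(e, t). e \<in> ?S \<and> t \<in> x e}" for x :: "nat \<times> nat \<times> nat \<Rightarrow> nat set"
  have ne: "?S \<noteq> {}" using KN by auto
  have fin: "finite ?S" by simp
  have "prob_space.indep_vars (measure_pmf V) (\<lambda>_. borel) (\<lambda>e x. ?y (x e)) ?S"
    unfolding V_def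
    by (rule prob_space.indep_vars_compose2[OF measure_pmf.prob_space_axioms indep_vars_Pi_pmf[OF fin]]) simp
  then have "distr V (PiM ?S (\<lambda>_. borel)) (\<lambda>x. \<lambda>e\<in>?S. ?y (x e)) = PiM ?S (\<lambda>e. distr V borel (\<lambda>x. ?y (x e)))"
    by (subst (asm) prob_space.indep_vars_iff_distr_eq_PiM'[OF measure_pmf.prob_space_axioms ne]) auto
  also have "\<dots> = ?P"
  proof (rule PiM_cong[OF refl])
    fix e assume "e \<in> ?S"
    then have "map_pmf (\<lambda>f. f e) V = pmf_of_set (Pow {..<m})"
      unfolding V_def by (simp add: Pi_pmf_component)
    then have "radmean m = distr (measure_pmf (map_pmf (\<lambda>f. f e) V)) borel ?y"
      by (simp add: radmean_def)
    then show "distr V borel (\<lambda>x. ?y (x e)) = radmean m"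
      by (simp add: map_pmf_rep_eq distr_distr comp_def)
  qed
  finally have P: "?P = distr V (PiM ?S (\<lambda>_. borel)) (\<lambda>x. \<lambda>e\<in>?S. ?y (x e))" ..
  have "{\<omega> \<in> space ?P. exceeds b K N B \<omega>} \<in> sets ?P"
    using pred_exceeds[OF B, where D = "radmean m" and K = K and N = N and b = b] by (simp add: pred_def)
  then have "measure ?P {\<omega> \<in> space ?P. exceeds b K N B \<omega>} = measure V {x. exceeds b K N B (\<lambda>e\<in>?S. ?y (x e))}"
    unfolding P by (subst measure_distr) (auto simp: space_PiM intro!: arg_cong[where f = "measure V"])
  also have "{x. exceeds b K N B (\<lambda>e\<in>?S. ?y (x e))} = \<Phi> -` {T. exceeds b K N B (maskmean UNIV m T)}"
  proof -
    have "exceeds b K N B (\<lambda>e\<in>?S. ?y (x e)) = exceeds b K N B (maskmean UNIV m (\<Phi> x))" for x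
    proof (rule exceeds_cong)
      fix e assume "e \<in> ?S"
      then have "rsign (\<Phi> x) (e, t) = rsign (x e) t" for t by (simp add: \<Phi>_def rsign_def)
      then show "(\<lambda>e\<in>?S. ?y (x e)) e = maskmean UNIV m (\<Phi> x) e"
        using \<open>e \<in> ?S\<close> by (simp add: maskmean_def)
    qed
    then show ?thesis by auto
  qed
  also have "measure V (\<Phi> -` {T. exceeds b K N B (maskmean UNIV m T)}) =
      measure (map_pmf \<Phi> V) {T. exceeds b K N B (maskmean UNIV m T)}"
    by simp
  also have "map_pmf \<Phi> V = pmf_of_set (Pow (signidx K N m))"
  proof -
    let ?A = "PiE_dflt ?S {} (\<lambda>_. Pow {..<m})"
    have V: "V = pmf_of_set ?A" unfolding V_def by (intro Pi_pmf_of_set) auto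
    have A: "finite ?A" "?A \<noteq> {}" by auto
    \<comment> \<open>Families take the default value {} outside \<open>?S\<close>, so a family can
      be recovered from its image and \<Phi> is injective.\<close>
    have sec: "x e = {t. (e, t) \<in> \<Phi> x}" if "x \<in> ?A" for x e
    proof (cases "e \<in> ?S")
      case True
      then show ?thesis by (simp add: \<Phi>_def)
    next
      case False
      then have "x e = {}" using that unfolding PiE_dflt_def by blast
      then show ?thesis by (simp add: \<Phi>_def)
    qed
    have "inj_on \<Phi> ?A"
    proof (rule inj_onI, rule ext)
      fix x x' e assume "x \<in> ?A" "x' \<in> ?A" "\<Phi> x = \<Phi> x'"
      then show "x e = x' e" using sec[of x e] sec[of x' e] by simp
    qed
    moreover have "\<Phi> ` ?A = Pow (signidx K N m)"
    proof
      show "\<Phi> ` ?A \<subseteq> Pow (signidx K N m)" by (auto simp: PiE_dflt_def \<Phi>_def)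
      show "Pow (signidx K N m) \<subseteq> \<Phi> ` ?A"
      proof
        fix T assume T: "T \<in> Pow (signidx K N m)"
        then have "T = \<Phi> (\<lambda>e. {t. (e, t) \<in> T})" "(\<lambda>e. {t. (e, t) \<in> T}) \<in> ?A"
          by (auto simp: PiE_dflt_def \<Phi>_def)
        then show "T \<in> \<Phi> ` ?A" by blast
      qed
    qed
    ultimately show ?thesis unfolding V using A by (simp add: map_pmf_of_set_inj)
  qed
  also have "measure (pmf_of_set (Pow (signidx K N m))) {T. exceeds b K N B (maskmean UNIV m T)} =
      real (card (Pow (signidx K N m) \<inter> {T. exceeds b K N B (maskmean UNIV m T)})) / real (card (Pow (signidx K N m)))"
    by (intro measure_pmf_of_set) auto
  also have "Pow (signidx K N m) \<inter> {T. exceeds b K N B (maskmean UNIV m T)} =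
      {T \<in> Pow (signidx K N m). B < opn (sqidx N) (sqidx N) (cenmat b K (maskmean UNIV m T))}"
    by (auto simp: exceeds_def)
  also have "card (Pow (signidx K N m)) = 2 ^ card (signidx K N m)" by (rule card_Pow) simp
  finally show ?thesis by (simp only: of_nat_power of_nat_numeral)
qed

text \<open>The coupling is made for a single entry and then applied coordinatewise on a product
  space, so convergence of the one-dimensional laws suffices.\<close>

lemma prob_exceeds_gaussian:
  assumes B: "0 \<le> B" and \<delta>: "0 \<le> \<delta>"
    and radmean: "\<And>m. measure (PiM (entries K N) (\<lambda>_. radmean (Suc m)))
      {\<omega> \<in> space (PiM (entries K N) (\<lambda>_. radmean (Suc m))). exceeds b K N B \<omega>} \<le> \<delta>"
  shows "measure (PiM (entries K N) (\<lambda>_. gaussian_measure))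
      {\<omega> \<in> space (PiM (entries K N) (\<lambda>_. gaussian_measure)). exceeds b K N B \<omega>} \<le> \<delta>"
proof -
  let ?S = "entries K N"
  have G: "real_distribution gaussian_measure"
    unfolding gaussian_measure_def by (rule real_dist_normal_dist)
  obtain \<Omega> :: "real measure" and Y :: "nat \<Rightarrow> real \<Rightarrow> real" and Y0 where
    \<Omega>: "prob_space \<Omega>" and Y: "\<And>n. Y n \<in> measurable \<Omega> borel" "\<And>n. distr \<Omega> borel (Y n) = radmean (Suc n)"
    and Y0: "Y0 \<in> measurable \<Omega> lborel" "distr \<Omega> borel Y0 = gaussian_measure"
    and lim: "\<And>x. x \<in> space \<Omega> \<Longrightarrow> (\<lambda>n. Y n x) \<longlonglongrightarrow> Y0 x"
    using Skorohod[OF real_distribution_radmean G weak_conv_radmean] by metis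
  have Y0': "Y0 \<in> measurable \<Omega> borel" using Y0(1) by (simp add: measurable_lborel2)
  interpret \<Omega>: prob_space \<Omega> by fact
  let ?Q = "PiM ?S (\<lambda>_. \<Omega>)"
  \<comment> \<open>The product of the laws of \<open>Z\<close> is the law of \<open>Z\<close>
    applied in each coordinate, so all approximations and the limit live on the single space
    \<open>?Q\<close>.\<close>
  have prod: "emeasure (PiM ?S (\<lambda>_. D)) {\<omega> \<in> space (PiM ?S (\<lambda>_. D)). exceeds b K N B \<omega>} =
      (\<integral>\<^sup>+\<omega>. indicator {\<omega> \<in> space ?Q. exceeds b K N B (compose ?S Z \<omega>)} \<omega> \<partial>?Q)"
    and meas: "{\<omega> \<in> space ?Q. exceeds b K N B (compose ?S Z \<omega>)} \<in> sets ?Q"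
    if Z: "Z \<in> measurable \<Omega> borel" and D: "distr \<Omega> borel Z = D" for Z D
  proof -
    have sD: "sets D = sets borel" using D by auto
    have pD: "prob_space D" unfolding D[symmetric] by (rule \<Omega>.prob_space_distr[OF Z])
    have ZD: "Z \<in> measurable \<Omega> D" using Z measurable_cong_sets[OF refl sD] by blast
    have DD: "distr \<Omega> D Z = D" using D distr_cong[OF refl sD, of \<Omega> Z Z] by simp
    have "distr ?Q (PiM ?S (\<lambda>_. D)) (compose ?S Z) = PiM ?S (\<lambda>_. distr \<Omega> D Z)"
      by (intro distr_PiM_finite_prob_space product_prob_spaceI ZD pD \<Omega>) auto
    then have eq: "PiM ?S (\<lambda>_. D) = distr ?Q (PiM ?S (\<lambda>_. D)) (compose ?S Z)"
      by (simp add: DD)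
    have cm: "compose ?S Z \<in> measurable ?Q (PiM ?S (\<lambda>_. D))"
      unfolding compose_def
    proof (rule measurable_restrict)
      fix e assume "e \<in> ?S"
      then have "(\<lambda>\<omega>. \<omega> e) \<in> measurable ?Q \<Omega>" by (rule measurable_component_singleton)
      then show "(\<lambda>\<omega>. Z (\<omega> e)) \<in> measurable ?Q D" using ZD by (rule measurable_compose)
    qed
    let ?E = "{\<omega> \<in> space (PiM ?S (\<lambda>_. D)). exceeds b K N B \<omega>}"
    have E: "?E \<in> sets (PiM ?S (\<lambda>_. D))"
      using pred_exceeds[OF B sD, where K = K and N = N and b = b] by (simp only: pred_def)
    have vim: "compose ?S Z -` ?E \<inter> space ?Q = {\<omega> \<in> space ?Q. exceeds b K N B (compose ?S Z \<omega>)}"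
      using measurable_space[OF cm] by auto
    show m: "{\<omega> \<in> space ?Q. exceeds b K N B (compose ?S Z \<omega>)} \<in> sets ?Q"
      using measurable_sets[OF cm E] by (simp only: vim)
    have "emeasure (PiM ?S (\<lambda>_. D)) ?E = emeasure (distr ?Q (PiM ?S (\<lambda>_. D)) (compose ?S Z)) ?E"
      by (simp only: eq[symmetric])
    also have "\<dots> = emeasure ?Q {\<omega> \<in> space ?Q. exceeds b K N B (compose ?S Z \<omega>)}"
      by (simp only: emeasure_distr[OF cm E] vim)
    finally show "emeasure (PiM ?S (\<lambda>_. D)) ?E =
      (\<integral>\<^sup>+\<omega>. indicator {\<omega> \<in> space ?Q. exceeds b K N B (compose ?S Z \<omega>)} \<omega> \<partial>?Q)"
      by (simp only: nn_integral_indicator[OF m])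
  qed
  let ?F = "\<lambda>n \<omega>. indicator {\<omega> \<in> space ?Q. exceeds b K N B (compose ?S (Y n) \<omega>)} \<omega> :: ennreal"
  have prad: "emeasure (PiM ?S (\<lambda>_. radmean (Suc n))) {\<omega> \<in> space (PiM ?S (\<lambda>_. radmean (Suc n))). exceeds b K N B \<omega>} \<le> ennreal \<delta>" for n
  proof -
    interpret prob_space "PiM ?S (\<lambda>_. radmean (Suc n))"
      by (intro prob_space_PiM prob_space_radmean)
    show ?thesis unfolding emeasure_eq_measure by (intro ennreal_leI radmean)
  qed
  have "emeasure (PiM ?S (\<lambda>_. gaussian_measure)) {\<omega> \<in> space (PiM ?S (\<lambda>_. gaussian_measure)). exceeds b K N B \<omega>} =
      (\<integral>\<^sup>+\<omega>. indicator {\<omega> \<in> space ?Q. exceeds b K N B (compose ?S Y0 \<omega>)} \<omega> \<partial>?Q)"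
    by (rule prod[OF Y0' Y0(2)])
  \<comment> \<open>Pointwise on \<open>?Q\<close>, exceeding \<open>B\<close> in the limit forces
    exceeding it eventually, which is the inequality between indicators that Fatou requires.\<close>
  also have "\<dots> \<le> (\<integral>\<^sup>+\<omega>. liminf (\<lambda>n. ?F n \<omega>) \<partial>?Q)"
  proof (rule nn_integral_mono)
    fix \<omega> assume \<omega>: "\<omega> \<in> space ?Q"
    show "indicator {\<omega> \<in> space ?Q. exceeds b K N B (compose ?S Y0 \<omega>)} \<omega> \<le> liminf (\<lambda>n. ?F n \<omega>)"
    proof (cases "exceeds b K N B (compose ?S Y0 \<omega>)")
      case True
      have lime: "(\<lambda>n. compose ?S (Y n) \<omega> e) \<longlonglongrightarrow> compose ?S Y0 \<omega> e" if "e \<in> ?S" for e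
        using that \<omega> by (auto simp: compose_def space_PiM intro!: lim)
      have "eventually (\<lambda>n. exceeds b K N B (compose ?S (Y n) \<omega>)) sequentially"
        unfolding exceeds_def
      proof (rule opn_lsc)
        fix r s assume "r \<in> sqidx N" "s \<in> sqidx N"
        then show "(\<lambda>n. cenmat b K (compose ?S (Y n) \<omega>) r s) \<longlonglongrightarrow> cenmat b K (compose ?S Y0 \<omega>) r s"
          unfolding cenmat_def by (intro tendsto_intros lime) (auto simp: qidx_def)
      qed (use True in \<open>simp add: exceeds_def\<close>)
      then have "eventually (\<lambda>n. 1 \<le> ?F n \<omega>) sequentially"
        by (rule eventually_mono) (use \<omega> in auto)
      then have "1 \<le> liminf (\<lambda>n. ?F n \<omega>)"
        by (rule Liminf_bounded)
      then show ?thesis using True \<omega> by simp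
    qed simp
  qed
  also have "\<dots> \<le> liminf (\<lambda>n. \<integral>\<^sup>+\<omega>. ?F n \<omega> \<partial>?Q)"
    by (intro nn_integral_liminf borel_measurable_indicator meas[OF Y(1,2)])
  also have "\<dots> \<le> liminf (\<lambda>n. ennreal \<delta>)"
    by (intro Liminf_mono always_eventually allI) (simp only: prod[OF Y(1,2), symmetric] prad)
  also have "\<dots> = ennreal \<delta>" by (simp add: Liminf_const)
  finally have le: "emeasure (PiM ?S (\<lambda>_. gaussian_measure)) {\<omega> \<in> space (PiM ?S (\<lambda>_. gaussian_measure)). exceeds b K N B \<omega>} \<le> ennreal \<delta>" .
  interpret PG: prob_space "PiM ?S (\<lambda>_. gaussian_measure)"
    using G by (intro prob_space_PiM) (simp add: real_distribution_def)
  show ?thesis using le \<delta> by (simp add: PG.emeasure_eq_measure)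
qed

section \<open>The tail bound\<close>

lemma opn_reindex_le:
  assumes bij: "bij_betw f I I'"
  shows "opn I I (\<lambda>r s. M (f r) (f s)) \<le> opn I' I' M"
proof (rule opn_least)
  fix x assume x: "L2_set x I \<le> 1"
  define y where "y = x \<circ> the_inv_into I f"
  have xy: "x s = y (f s)" if "s \<in> I" for s
    using bij that by (simp add: y_def bij_betw_def the_inv_into_f_f)
  have re: "(\<Sum>s\<in>I. g (f s)) = (\<Sum>s\<in>I'. g s)" for g :: "_ \<Rightarrow> real"
    by (rule sum.reindex_bij_betw[OF bij])
  have "(\<Sum>s\<in>I. (x s)\<^sup>2) = (\<Sum>s\<in>I'. (y s)\<^sup>2)"
    using re[of "\<lambda>s. (y s)\<^sup>2"] by (simp add: xy cong: sum.cong)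
  then have y: "L2_set y I' \<le> 1" using x by (simp only: L2_set_le_1_iff)
  have "(\<Sum>s\<in>I. M r (f s) * x s) = (\<Sum>s\<in>I'. M r s * y s)" for r
    using re[of "\<lambda>s. M r s * y s"] by (simp add: xy cong: sum.cong)
  then have "L2_set (\<lambda>r. \<Sum>s\<in>I. M (f r) (f s) * x s) I = L2_set (\<lambda>r. \<Sum>s\<in>I'. M r s * y s) I'"
    unfolding L2_set_def using re[of "\<lambda>r. (\<Sum>s\<in>I'. M r s * y s)\<^sup>2"] by simp
  also have "\<dots> \<le> opn I' I' M" by (rule opn_unit[OF y])
  finally show "L2_set (\<lambda>r. \<Sum>s\<in>I. M (f r) (f s) * x s) I \<le> \<dots>" .
qed

text \<open>The reverse inequality is the one-sided lemma applied to the inverse bijection.\<close>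

lemma opn_reindex:
  assumes bij: "bij_betw f I I'"
  shows "opn I I (\<lambda>r s. M (f r) (f s)) = opn I' I' M"
proof (rule antisym[OF opn_reindex_le[OF bij]])
  let ?g = "the_inv_into I f"
  have "opn I' I' M = opn I' I' (\<lambda>r s. M (f (?g r)) (f (?g s)))"
    using bij by (intro opn_cong) (simp add: bij_betw_def f_the_inv_into_f)
  also have "\<dots> \<le> opn I I (\<lambda>r s. M (f r) (f s))"
    using opn_reindex_le[OF bij_betw_the_inv_into[OF bij], of "\<lambda>r s. M (f r) (f s)"] .
  finally show "opn I' I' M \<le> opn I I (\<lambda>r s. M (f r) (f s))" .
qed

lemma bij_betw_divmod:
  assumes "N > 0"
  shows "bij_betw (\<lambda>r. (r div N, r mod N)) {..<N * N} (sqidx N)"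
proof (rule bij_betw_byWitness[of _ "\<lambda>(j, l). j * N + l"])
  show "(\<lambda>r. (r div N, r mod N)) ` {..<N * N} \<subseteq> sqidx N"
    using assms by (auto simp: less_mult_imp_div_less)
  show "(\<lambda>(j, l). j * N + l) ` sqidx N \<subseteq> {..<N * N}"
  proof clarsimp
    fix j l assume "j < N" "l < N"
    then have "j * N + l < Suc j * N" by simp
    also have "\<dots> \<le> N * N" using \<open>j < N\<close> by (intro mult_le_mono1) simp
    finally show "j * N + l < N * N" .
  qed
qed (use assms in auto)

text \<open>These moments of the entry law determine the expectation subtracted in
  \<open>centered_sum\<close>, so both laws are treated at once.\<close>

locale standardized_law =
  fixes D :: "real measure"
  assumes prob: "prob_space D" and sets_eq: "sets D = sets borel"
    and int1: "integrable D (\<lambda>x. x)" and mean: "(\<integral>x. x \<partial>D) = 0"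
    and second: "(\<integral>x. x * x \<partial>D) = 1"
begin

lemma entry_mult_expectation:
  assumes a: "a \<in> entries K N" and b: "b \<in> entries K N"
  shows "(\<integral>\<omega>. \<omega> a * \<omega> b \<partial>entry_space K N D) = (if a = b then 1 else 0)"
proof (cases "a = b")
  case True
  have comp: "distr (PiM (entries K N) (\<lambda>_. D)) D (\<lambda>\<omega>. \<omega> a) = D"
    by (rule distr_PiM_component[OF prob a])
  have "(\<integral>x. x * x \<partial>D) = (\<integral>x. x * x \<partial>distr (PiM (entries K N) (\<lambda>_. D)) D (\<lambda>\<omega>. \<omega> a))"
    by (simp only: comp)
  also have "\<dots> = (\<integral>\<omega>. \<omega> a * \<omega> a \<partial>PiM (entries K N) (\<lambda>_. D))"
  proof (rule integral_distr)
    show "(\<lambda>\<omega>. \<omega> a) \<in> measurable (PiM (entries K N) (\<lambda>_. D)) D"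
      using a by (rule measurable_component_singleton)
    show "(\<lambda>x. x * x) \<in> borel_measurable D"
      unfolding measurable_cong_sets[OF sets_eq refl] by simp
  qed
  finally show ?thesis using True second by (simp add: entry_space_def)
next
  case False
  \<comment> \<open>The product of two entries is written as a product over all coordinates with the
    constant 1 elsewhere, which is the shape Fubini's theorem for product measures expects.\<close>
  let ?f = "\<lambda>i. if i \<in> {a, b} then (\<lambda>x::real. x) else (\<lambda>_. 1)"
  interpret product_sigma_finite "\<lambda>_ :: nat \<times> nat \<times> nat. D"
    using prob by (simp add: product_sigma_finite_def prob_space_imp_sigma_finite)
  have ab: "entries K N \<inter> {a, b} = {a, b}" using a b by blast
  have "\<omega> a * \<omega> b = (\<Prod>i\<in>entries K N. ?f i (\<omega> i))" for \<omega> :: "nat \<times> nat \<times> nat \<Rightarrow> real"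
  proof -
    have "(\<Prod>i\<in>entries K N. ?f i (\<omega> i)) = (\<Prod>i\<in>entries K N. if i \<in> {a, b} then \<omega> i else 1)"
      by (intro prod.cong) auto
    also have "\<dots> = (\<Prod>i\<in>entries K N \<inter> {a, b}. \<omega> i)"
      by (rule prod.inter_restrict[symmetric]) simp
    finally show ?thesis using False by (simp add: ab)
  qed
  then have "(\<integral>\<omega>. \<omega> a * \<omega> b \<partial>entry_space K N D) =
      (\<integral>\<omega>. (\<Prod>i\<in>entries K N. ?f i (\<omega> i)) \<partial>PiM (entries K N) (\<lambda>_. D))"
    by (simp only: entry_space_def)
  also have "\<dots> = (\<Prod>i\<in>entries K N. \<integral>x. ?f i x \<partial>D)"
  proof (rule product_integral_prod)
    fix i
    interpret prob_space D by (rule prob)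
    show "integrable D (?f i)" using int1 by simp
  qed simp
  also have "\<dots> = 0"
    using a mean by (intro prod_zero bexI[of _ a]) auto
  finally show ?thesis using False by simp
qed

text \<open>The index r of a Kronecker product corresponds to the pair (r div N, r mod N), and the
  subtracted integrals are 0 or 1 by \<open>entry_mult_expectation\<close>.\<close>

lemma opnorm_centered_sum:
  assumes N: "N > 0"
  shows "opnorm (N * N) (centered_sum K N D (\<lambda>A. kron N A A) \<omega>) =
      opn (sqidx N) (sqidx N) (cenmat False K \<omega>)" (is ?A)
    and "opnorm (N * N) (centered_sum K N D (\<lambda>A. kron N A (transp_mat A)) \<omega>) =
      opn (sqidx N) (sqidx N) (cenmat True K \<omega>)" (is ?B)
proof -
  let ?f = "\<lambda>r. (r div N, r mod N)"
  have div: "r div N < N" if "r < N * N" for r using that by (rule less_mult_imp_div_less)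
  have mod: "r mod N < N" for r using N by simp
  have eqA: "centered_sum K N D (\<lambda>A. kron N A A) \<omega> r s = cenmat False K \<omega> (?f r) (?f s)"
    and eqB: "centered_sum K N D (\<lambda>A. kron N A (transp_mat A)) \<omega> r s = cenmat True K \<omega> (?f r) (?f s)"
    if "r < N * N" "s < N * N" for r s
    unfolding centered_sum_def cenmat_def kron_def rmat_def transp_mat_def
    using div[OF that(1)] div[OF that(2)] mod
    by (auto intro!: sum.cong simp: entry_mult_expectation qidx_def)
  show ?A
    unfolding opnorm_eq_opn opn_reindex[OF bij_betw_divmod[OF N], symmetric]
    by (intro opn_cong eqA) auto
  show ?B
    unfolding opnorm_eq_opn opn_reindex[OF bij_betw_divmod[OF N], symmetric]
    by (intro opn_cong eqB) auto
qed

end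

lemma standardized_law_gaussian: "standardized_law gaussian_measure"
proof (rule standardized_law.intro)
  show "prob_space gaussian_measure" "sets gaussian_measure = sets borel"
    using real_dist_normal_dist by (simp_all add: gaussian_measure_def real_distribution_def)
  show "integrable gaussian_measure (\<lambda>x. x)"
    using integrable_std_normal_distribution_moment[of 1] by (simp add: gaussian_measure_def)
  show "(\<integral>x. x \<partial>gaussian_measure) = 0"
    using integral_std_normal_distribution_moment_odd[of 1] by (simp add: gaussian_measure_def)
  show "(\<integral>x. x * x \<partial>gaussian_measure) = 1"
    using std_normal_distribution_even_moments(1)[of 1]
    by (simp add: gaussian_measure_def power2_eq_square fact_2)
qed

lemma standardized_law_rademacher: "standardized_law rademacher_measure"
proof (rule standardized_law.intro)
  have "prob_space (radmean 1)" by (rule prob_space_radmean)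
  then show "prob_space rademacher_measure" by (simp only: radmean_1)
  show "sets rademacher_measure = sets borel" by (simp add: rademacher_measure_def)
  show "integrable rademacher_measure (\<lambda>x. x)"
    unfolding rademacher_measure_def
    by (subst integrable_distr_eq) (auto intro!: integrable_measure_pmf_finite)
  show "(\<integral>x. x \<partial>rademacher_measure) = 0"
    unfolding rademacher_measure_def
    by (subst integral_distr) (auto simp: integral_pmf_of_set)
  show "(\<integral>x. x * x \<partial>rademacher_measure) = 1"
    unfolding rademacher_measure_def
    by (subst integral_distr) (auto simp: integral_pmf_of_set)
qed

theorem mainTheorem20:
  "\<exists>C1 C2 :: real. C1 > 0 \<and> C2 > 0 \<and>
    (\<forall>(c::nat) (d::nat) (n::nat) D. c \<in> {1, 2} \<longrightarrow> d \<ge> 1 \<longrightarrow> n \<ge> 2 \<longrightarrow>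
       D \<in> {rademacher_measure, gaussian_measure} \<longrightarrow>
       (let K = n ^ c; N = n ^ d; P = entry_space K N D;
            B = C2 * sqrt (real d) * real n powr ((2 * real d + real c) / 2) * sqrt (ln (real n))
        in measure P {\<omega> \<in> space P.
               opnorm (N * N) (centered_sum K N D (\<lambda>A. kron N A A) \<omega>) \<le> B \<and>
               opnorm (N * N) (centered_sum K N D (\<lambda>A. kron N A (transp_mat A)) \<omega>) \<le> B}
           \<ge> 1 - C1 * real n powr (-100)))"
\<comment> \<open>The failure probability is at most 8 n^(-100) for each of the two norms, hence 16;
  the other constant is the one of the tail bound for signs.\<close>
proof (rule exI[of _ 16], rule exI[of _ 2600000], intro conjI allI impI)
  fix c d n :: nat and D :: "real measure"
  assume c: "c \<in> {1, 2}" and d: "d \<ge> 1" and n: "n \<ge> 2" and D: "D \<in> {rademacher_measure, gaussian_measure}"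
  define K where "K = n ^ c"
  define N where "N = n ^ d"
  define B where "B = 2600000 * sqrt (real d) * real n powr ((2 * real d + real c) / 2) * sqrt (ln (real n))"
  define \<delta> where "\<delta> = 8 * real n powr (-100)"
  let ?P = "entry_space K N D"
  have c1: "c \<ge> 1" using c by auto
  have KN: "K > 0" "N > 0" using n by (simp_all add: K_def N_def)
  have B0: "0 \<le> B" unfolding B_def using n by simp
  have \<delta>0: "0 \<le> \<delta>" by (simp add: \<delta>_def)
  have radmean: "measure (PiM (entries K N) (\<lambda>_. radmean (Suc m))) {\<omega> \<in> space (PiM (entries K N) (\<lambda>_. radmean (Suc m))). exceeds b K N B \<omega>} \<le> \<delta>" for b m
  proof -
    have "real (card {T \<in> Pow (signidx K N (Suc m)). B < opn (sqidx N) (sqidx N) (cenmat b K (maskmean UNIV (Suc m) T))})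
        \<le> \<delta> * 2 ^ card (signidx K N (Suc m))"
      unfolding \<delta>_def B_def K_def N_def by (rule cenmat_tail_count[OF n c1 d]) simp
    then show ?thesis
      unfolding prob_exceeds_radmean[OF KN B0] by (subst pos_divide_le_eq) simp_all
  qed
  have exceeds_le: "measure ?P {\<omega> \<in> space ?P. exceeds b K N B \<omega>} \<le> \<delta>" for b
  proof (cases "D = gaussian_measure")
    case True
    show ?thesis unfolding entry_space_def True by (rule prob_exceeds_gaussian[OF B0 \<delta>0 radmean])
  next
    case False
    \<comment> \<open>The Rademacher law is the case of a single sign per entry, so the sign
      estimate applies directly.\<close>
    then have "D = radmean (Suc 0)" using D radmean_1 by simp
    then show ?thesis unfolding entry_space_def by (simp only: radmean)
  qed
  interpret standardized_law D
    using D standardized_law_gaussian standardized_law_rademacher by auto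
  interpret P: prob_space ?P
    unfolding entry_space_def by (intro prob_space_PiM prob)
  have meas: "{\<omega> \<in> space ?P. exceeds b K N B \<omega>} \<in> sets ?P" for b
    using pred_exceeds[OF B0 sets_eq, where K = K and N = N and b = b] by (simp only: pred_def entry_space_def)
  let ?G = "{\<omega> \<in> space ?P. opnorm (N * N) (centered_sum K N D (\<lambda>A. kron N A A) \<omega>) \<le> B \<and>
      opnorm (N * N) (centered_sum K N D (\<lambda>A. kron N A (transp_mat A)) \<omega>) \<le> B}"
  let ?U = "{\<omega> \<in> space ?P. exceeds False K N B \<omega>} \<union> {\<omega> \<in> space ?P. exceeds True K N B \<omega>}"
  have "?G = space ?P - ?U"
    by (auto simp: opnorm_centered_sum[OF KN(2)] exceeds_def)
  then have "measure ?P ?G = 1 - measure ?P ?U"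
    using P.prob_compl[of ?U] meas by simp
  moreover have "measure ?P ?U \<le> \<delta> + \<delta>"
    by (rule order_trans[OF measure_Un_le[OF meas meas]]) (intro add_mono exceeds_le)
  ultimately have "1 - 16 * real n powr (-100) \<le> measure ?P ?G"
    by (simp add: \<delta>_def)
  then show "let K = n ^ c; N = n ^ d; P = entry_space K N D;
            B = 2600000 * sqrt (real d) * real n powr ((2 * real d + real c) / 2) * sqrt (ln (real n))
        in measure P {\<omega> \<in> space P.
               opnorm (N * N) (centered_sum K N D (\<lambda>A. kron N A A) \<omega>) \<le> B \<and>
               opnorm (N * N) (centered_sum K N D (\<lambda>A. kron N A (transp_mat A)) \<omega>) \<le> B}
           \<ge> 1 - 16 * real n powr (-100)"
    unfolding Let_def K_def N_def B_def .
qed simp_all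

end
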